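(* Let $(Z,Z_{ac},h)$ be a normal accretive operator space. Then there exist a Hilbert space $H$ and a real-complete order embedding $\phi:Z\to B(H)$ such that $h_n(z)=\|\operatorname{Re}(\phi^{(n)}(z))\|_{B(H^n)}$ for all $n$ and all $z\in M_n(Z)$.
   Context: For a complex vector space $Z$, $M_n(Z)$ denotes the $n\times n$ matrices over $Z$; for scalar $X\in M_{n,k}$ and $A\in M_n(Z)$, $X^*AX$ is defined by matrix multiplication; $A\oplus B$ is the block diagonal matrix. A cone is a set $C$ with $C+C\subseteq C$, $tC\subseteq C$ for $t\ge0$; a matrix cone is a sequence of cones $C_n\subseteq M_n(Z)$ with $X^*C_nX\subseteq C_k$ for all $X\in M_{n,k}$; it is $\mathbb{C}$-proper if $C_1\cap-C_1\cap iC_1\cap-iC_1=\{0\}$, and then $(Z,Z_{ac})$ with $Z_{ac}=\{Z_{ac}^n\}$ is an accretive matrix-ordered vector space. A matrix gauge on $Z$ is a sequence $\{\nu_n:M_n(Z)\to[0,\infty)\}$ with $\nu_n(x+y)\le\nu_n(x)+\nu_n(y)$, $\nu_n(tx)=t\nu_n(x)$ ($t\ge0$), $\nu_k(X^*AX)\le\|X\|^2\nu_n(A)$, and $\nu_{n+m}(A\oplus B)=\max\{\nu_n(A),\nu_m(B)\}$; it is $\mathbb{C}$-proper if $\nu_1(i^kz)=0$ for $k=0,1,2,3$ implies $z=0$. A hermitian matrix gauge is a $\mathbb{C}$-proper matrix gauge $h$ with $h_n(tz)=|t|h_n(z)$ for all real $t$. Given an accretive matrix-ordered vector space $(Z,Z_{ac})$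 and a hermitian matrix gauge $h$, $Z_{ac}$ is $h$-closed if whenever $z_k\in Z_{ac}^n$ and $h_n(z_k-z)\to0$ then $z\in Z_{ac}^n$. $(Z,Z_{ac},h)$ is a normal accretive operator space if $Z_{ac}$ is $h$-closed and whenever $y-x,\ z-y\in Z_{ac}^n$ we have $h_n(y)\le\max\{h_n(x),h_n(z)\}$. For a Hilbert space $H$, $M_n(B(H))=B(H^n)$, $\operatorname{Re}(T)=\frac12(T+T^* )$, and $B(H)$ carries the accretive cones $\{T\in B(H^n):\operatorname{Re}T\ge0\}$. A linear map $\phi$ is real-completely positive if $\phi^{(n)}$ (entrywise) maps accretive cones into accretive cones for all $n$; a real-complete order embedding is an injective such $\phi$ whose inverse on its range is also real-completely positive. *)

theory Defs
  imports "HOL-Analysis.Analysis"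
begin

text \<open>An n x k matrix over 'a is a function nat => nat => 'a vanishing outside
  the index range {..<n} x {..<k}.  Indices start at 0.  Sizes are n >= 1.\<close>

definition rect :: "nat \<Rightarrow> nat \<Rightarrow> (nat \<Rightarrow> nat \<Rightarrow> 'a::zero) set" where
  "rect n k = {A. \<forall>i j. \<not> (i < n \<and> j < k) \<longrightarrow> A i j = 0}"

abbreviation mat :: "nat \<Rightarrow> (nat \<Rightarrow> nat \<Rightarrow> 'a::zero) set" where
  "mat n \<equiv> rect n n"

definition madd :: "(nat \<Rightarrow> nat \<Rightarrow> 'a::plus) \<Rightarrow> (nat \<Rightarrow> nat \<Rightarrow> 'a) \<Rightarrow> nat \<Rightarrow> nat \<Rightarrow> 'a" where
  "madd A B = (\<lambda>i j. A i j + B i j)"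

definition msub :: "(nat \<Rightarrow> nat \<Rightarrow> 'a::minus) \<Rightarrow> (nat \<Rightarrow> nat \<Rightarrow> 'a) \<Rightarrow> nat \<Rightarrow> nat \<Rightarrow> 'a" where
  "msub A B = (\<lambda>i j. A i j - B i j)"

definition mzero :: "nat \<Rightarrow> nat \<Rightarrow> 'a::zero" where
  "mzero = (\<lambda>i j. 0)"

definition msc :: "(complex \<Rightarrow> 'z \<Rightarrow> 'z) \<Rightarrow> complex \<Rightarrow> (nat \<Rightarrow> nat \<Rightarrow> 'z) \<Rightarrow> nat \<Rightarrow> nat \<Rightarrow> 'z" where
  "msc sc c A = (\<lambda>i j. sc c (A i j))"

text \<open>X^* A X for a scalar n x k matrix X and A in M_n(Z)\<close>
definition congr :: "(complex \<Rightarrow> 'z::comm_monoid_add \<Rightarrow> 'z) \<Rightarrow> nat \<Rightarrow> nat \<Rightarrow>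
    (nat \<Rightarrow> nat \<Rightarrow> complex) \<Rightarrow> (nat \<Rightarrow> nat \<Rightarrow> 'z) \<Rightarrow> nat \<Rightarrow> nat \<Rightarrow> 'z" where
  "congr sc n k X A = (\<lambda>i j. if i < k \<and> j < k
      then (\<Sum>p<n. \<Sum>q<n. sc (cnj (X p i) * X q j) (A p q)) else 0)"

definition dsum :: "nat \<Rightarrow> (nat \<Rightarrow> nat \<Rightarrow> 'a::zero) \<Rightarrow> (nat \<Rightarrow> nat \<Rightarrow> 'a) \<Rightarrow> nat \<Rightarrow> nat \<Rightarrow> 'a" where
  "dsum n A B = (\<lambda>i j. if i < n \<and> j < n then A i j
      else if n \<le> i \<and> n \<le> j then B (i - n) (j - n) else 0)"

definition sing :: "'a::zero \<Rightarrow> nat \<Rightarrow> nat \<Rightarrow> 'a" where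
  "sing z = (\<lambda>i j. if i = 0 \<and> j = 0 then z else 0)"

definition vnorm :: "nat \<Rightarrow> (nat \<Rightarrow> complex) \<Rightarrow> real" where
  "vnorm k v = sqrt (\<Sum>i<k. (cmod (v i))\<^sup>2)"

definition cmat_norm :: "nat \<Rightarrow> nat \<Rightarrow> (nat \<Rightarrow> nat \<Rightarrow> complex) \<Rightarrow> real" where
  "cmat_norm n k X = Sup ((\<lambda>v. vnorm n (\<lambda>p. \<Sum>q<k. X p q * v q)) ` {v. vnorm k v \<le> 1})"

definition is_cone_mat :: "(complex \<Rightarrow> 'z \<Rightarrow> 'z) \<Rightarrow> (nat \<Rightarrow> nat \<Rightarrow> 'z::plus) set \<Rightarrow> bool" where
  "is_cone_mat sc C \<longleftrightarrow> (\<forall>A\<in>C. \<forall>B\<in>C. madd A B \<in> C) \<and>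
      (\<forall>t::real. t \<ge> 0 \<longrightarrow> (\<forall>A\<in>C. msc sc (complex_of_real t) A \<in> C))"

definition matrix_cone :: "(complex \<Rightarrow> 'z::comm_monoid_add \<Rightarrow> 'z) \<Rightarrow> (nat \<Rightarrow> (nat \<Rightarrow> nat \<Rightarrow> 'z) set) \<Rightarrow> bool" where
  "matrix_cone sc C \<longleftrightarrow>
     (\<forall>n\<ge>1. C n \<subseteq> mat n \<and> is_cone_mat sc (C n)) \<and>
     (\<forall>n\<ge>1. \<forall>k\<ge>1. \<forall>X\<in>rect n k. \<forall>A\<in>C n. congr sc n k X A \<in> C k)"

definition C_proper_cone :: "(complex \<Rightarrow> 'z::comm_monoid_add \<Rightarrow> 'z) \<Rightarrow> (nat \<Rightarrow> (nat \<Rightarrow> nat \<Rightarrow> 'z) set) \<Rightarrow> bool" where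
  "C_proper_cone sc C \<longleftrightarrow>
     C 1 \<inter> (msc sc (-1) ` C 1) \<inter> (msc sc \<i> ` C 1) \<inter> (msc sc (-\<i>) ` C 1) = {mzero}"

definition accretive_mat_ordered :: "(complex \<Rightarrow> 'z::ab_group_add \<Rightarrow> 'z) \<Rightarrow> (nat \<Rightarrow> (nat \<Rightarrow> nat \<Rightarrow> 'z) set) \<Rightarrow> bool" where
  "accretive_mat_ordered sc C \<longleftrightarrow> vector_space sc \<and> matrix_cone sc C \<and> C_proper_cone sc C"

definition matrix_gauge :: "(complex \<Rightarrow> 'z::comm_monoid_add \<Rightarrow> 'z) \<Rightarrow> (nat \<Rightarrow> (nat \<Rightarrow> nat \<Rightarrow> 'z) \<Rightarrow> real) \<Rightarrow> bool" where
  "matrix_gauge sc \<nu> \<longleftrightarrow>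
     (\<forall>n\<ge>1. \<forall>A\<in>mat n. \<nu> n A \<ge> 0) \<and>
     (\<forall>n\<ge>1. \<forall>A\<in>mat n. \<forall>B\<in>mat n. \<nu> n (madd A B) \<le> \<nu> n A + \<nu> n B) \<and>
     (\<forall>n\<ge>1. \<forall>A\<in>mat n. \<forall>t::real. t \<ge> 0 \<longrightarrow> \<nu> n (msc sc (complex_of_real t) A) = t * \<nu> n A) \<and>
     (\<forall>n\<ge>1. \<forall>k\<ge>1. \<forall>X\<in>rect n k. \<forall>A\<in>mat n.
         \<nu> k (congr sc n k X A) \<le> (cmat_norm n k X)\<^sup>2 * \<nu> n A) \<and>
     (\<forall>n\<ge>1. \<forall>m\<ge>1. \<forall>A\<in>mat n. \<forall>B\<in>mat m. \<nu> (n + m) (dsum n A B) = max (\<nu> n A) (\<nu> m B))"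

definition C_proper_gauge :: "(complex \<Rightarrow> 'z::zero \<Rightarrow> 'z) \<Rightarrow> (nat \<Rightarrow> (nat \<Rightarrow> nat \<Rightarrow> 'z) \<Rightarrow> real) \<Rightarrow> bool" where
  "C_proper_gauge sc \<nu> \<longleftrightarrow> (\<forall>z. (\<forall>k::nat<4. \<nu> 1 (sing (sc (\<i> ^ k) z)) = 0) \<longrightarrow> z = 0)"

definition hermitian_gauge :: "(complex \<Rightarrow> 'z::comm_monoid_add \<Rightarrow> 'z) \<Rightarrow> (nat \<Rightarrow> (nat \<Rightarrow> nat \<Rightarrow> 'z) \<Rightarrow> real) \<Rightarrow> bool" where
  "hermitian_gauge sc h \<longleftrightarrow> matrix_gauge sc h \<and> C_proper_gauge sc h \<and>
     (\<forall>n\<ge>1. \<forall>A\<in>mat n. \<forall>t::real. h n (msc sc (complex_of_real t) A) = \<bar>t\<bar> * h n A)"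

definition h_closed :: "(nat \<Rightarrow> (nat \<Rightarrow> nat \<Rightarrow> 'z::ab_group_add) set) \<Rightarrow> (nat \<Rightarrow> (nat \<Rightarrow> nat \<Rightarrow> 'z) \<Rightarrow> real) \<Rightarrow> bool" where
  "h_closed C h \<longleftrightarrow> (\<forall>n\<ge>1. \<forall>zs z. (\<forall>k. zs k \<in> C n) \<and> z \<in> mat n \<and>
        (\<lambda>k. h n (msub (zs k) z)) \<longlonglongrightarrow> 0 \<longrightarrow> z \<in> C n)"

definition normal_accretive_operator_space ::
  "(complex \<Rightarrow> 'z::ab_group_add \<Rightarrow> 'z) \<Rightarrow> (nat \<Rightarrow> (nat \<Rightarrow> nat \<Rightarrow> 'z) set) \<Rightarrow> (nat \<Rightarrow> (nat \<Rightarrow> nat \<Rightarrow> 'z) \<Rightarrow> real) \<Rightarrow> bool" where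
  "normal_accretive_operator_space sc C h \<longleftrightarrow>
     accretive_mat_ordered sc C \<and> hermitian_gauge sc h \<and> h_closed C h \<and>
     (\<forall>n\<ge>1. \<forall>x\<in>mat n. \<forall>y\<in>mat n. \<forall>z\<in>mat n.
        msub y x \<in> C n \<and> msub z y \<in> C n \<longrightarrow> h n y \<le> max (h n x) (h n z))"

text \<open>Every complex Hilbert space is unitarily isomorphic to l2(J) for an index set J.\<close>

definition l2 :: "'j set \<Rightarrow> ('j \<Rightarrow> complex) set" where
  "l2 J = {f. (\<forall>x. x \<notin> J \<longrightarrow> f x = 0) \<and> (\<lambda>x. (cmod (f x))\<^sup>2) summable_on J}"

definition l2norm :: "'j set \<Rightarrow> ('j \<Rightarrow> complex) \<Rightarrow> real" where
  "l2norm J f = sqrt (infsum (\<lambda>x. (cmod (f x))\<^sup>2) J)"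

definition cinner :: "'j set \<Rightarrow> ('j \<Rightarrow> complex) \<Rightarrow> ('j \<Rightarrow> complex) \<Rightarrow> complex" where
  "cinner J f g = infsum (\<lambda>x. f x * cnj (g x)) J"

definition is_bop :: "'j set \<Rightarrow> (('j \<Rightarrow> complex) \<Rightarrow> ('j \<Rightarrow> complex)) \<Rightarrow> bool" where
  "is_bop J T \<longleftrightarrow> (\<forall>f\<in>l2 J. T f \<in> l2 J) \<and>
     (\<forall>f\<in>l2 J. \<forall>g\<in>l2 J. T (\<lambda>x. f x + g x) = (\<lambda>x. T f x + T g x)) \<and>
     (\<forall>c. \<forall>f\<in>l2 J. T (\<lambda>x. c * f x) = (\<lambda>x. c * T f x)) \<and>
     (\<exists>C. \<forall>f\<in>l2 J. l2norm J (T f) \<le> C * l2norm J f) \<and>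
     (\<forall>f. f \<notin> l2 J \<longrightarrow> T f = (\<lambda>x. 0))"

definition adj :: "'j set \<Rightarrow> (('j \<Rightarrow> complex) \<Rightarrow> ('j \<Rightarrow> complex)) \<Rightarrow> (('j \<Rightarrow> complex) \<Rightarrow> ('j \<Rightarrow> complex))" where
  "adj J T = (SOME S. is_bop J S \<and> (\<forall>f\<in>l2 J. \<forall>g\<in>l2 J. cinner J (T f) g = cinner J f (S g)))"

definition ReOp :: "'j set \<Rightarrow> (('j \<Rightarrow> complex) \<Rightarrow> ('j \<Rightarrow> complex)) \<Rightarrow> (('j \<Rightarrow> complex) \<Rightarrow> ('j \<Rightarrow> complex))" where
  "ReOp J T = (\<lambda>f x. (T f x + adj J T f x) / 2)"

definition pos_op :: "'j set \<Rightarrow> (('j \<Rightarrow> complex) \<Rightarrow> ('j \<Rightarrow> complex)) \<Rightarrow> bool" where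
  "pos_op J A \<longleftrightarrow> (\<forall>f\<in>l2 J. cinner J (A f) f \<in> \<real> \<and> 0 \<le> Re (cinner J (A f) f))"

definition accretive_op :: "'j set \<Rightarrow> (('j \<Rightarrow> complex) \<Rightarrow> ('j \<Rightarrow> complex)) \<Rightarrow> bool" where
  "accretive_op J T \<longleftrightarrow> is_bop J T \<and> pos_op J (ReOp J T)"

definition opnorm :: "'j set \<Rightarrow> (('j \<Rightarrow> complex) \<Rightarrow> ('j \<Rightarrow> complex)) \<Rightarrow> real" where
  "opnorm J T = Sup ((\<lambda>f. l2norm J (T f)) ` {f \<in> l2 J. l2norm J f \<le> 1})"

text \<open>phi^(n)(z) acting on H^n = l2(I)^n, identified with l2(I x {..<n})\<close>
definition amp :: "'i set \<Rightarrow> nat \<Rightarrow> ('z \<Rightarrow> (('i \<Rightarrow> complex) \<Rightarrow> ('i \<Rightarrow> complex))) \<Rightarrow>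
    (nat \<Rightarrow> nat \<Rightarrow> 'z) \<Rightarrow> (('i \<times> nat \<Rightarrow> complex) \<Rightarrow> ('i \<times> nat \<Rightarrow> complex))" where
  "amp I n \<phi> z = (\<lambda>F. if F \<in> l2 (I \<times> {..<n})
      then (\<lambda>(i, p). if p < n then (\<Sum>q<n. \<phi> (z p q) (\<lambda>j. F (j, q)) i) else 0)
      else (\<lambda>x. 0))"

definition complex_linear_into_B ::
  "(complex \<Rightarrow> 'z::plus \<Rightarrow> 'z) \<Rightarrow> 'i set \<Rightarrow> ('z \<Rightarrow> (('i \<Rightarrow> complex) \<Rightarrow> ('i \<Rightarrow> complex))) \<Rightarrow> bool" where
  "complex_linear_into_B sc I \<phi> \<longleftrightarrow> (\<forall>z. is_bop I (\<phi> z)) \<and>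
     (\<forall>z w. \<phi> (z + w) = (\<lambda>f x. \<phi> z f x + \<phi> w f x)) \<and>
     (\<forall>c z. \<phi> (sc c z) = (\<lambda>f x. c * \<phi> z f x))"

definition real_completely_positive ::
  "(nat \<Rightarrow> (nat \<Rightarrow> nat \<Rightarrow> 'z) set) \<Rightarrow> 'i set \<Rightarrow> ('z \<Rightarrow> (('i \<Rightarrow> complex) \<Rightarrow> ('i \<Rightarrow> complex))) \<Rightarrow> bool" where
  "real_completely_positive C I \<phi> \<longleftrightarrow>
     (\<forall>n\<ge>1. \<forall>z\<in>C n. accretive_op (I \<times> {..<n}) (amp I n \<phi> z))"

text \<open>the inverse of phi on its range is real-completely positive: since phi is injective,
  the elements of M_n(phi(Z)) are exactly the phi^(n)(z), z in M_n(Z)\<close>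
definition inverse_real_completely_positive ::
  "(nat \<Rightarrow> (nat \<Rightarrow> nat \<Rightarrow> 'z::zero) set) \<Rightarrow> 'i set \<Rightarrow> ('z \<Rightarrow> (('i \<Rightarrow> complex) \<Rightarrow> ('i \<Rightarrow> complex))) \<Rightarrow> bool" where
  "inverse_real_completely_positive C I \<phi> \<longleftrightarrow>
     (\<forall>n\<ge>1. \<forall>z\<in>mat n. accretive_op (I \<times> {..<n}) (amp I n \<phi> z) \<longrightarrow> z \<in> C n)"

definition real_complete_order_embedding ::
  "(complex \<Rightarrow> 'z::ab_group_add \<Rightarrow> 'z) \<Rightarrow> (nat \<Rightarrow> (nat \<Rightarrow> nat \<Rightarrow> 'z) set) \<Rightarrow> 'i set \<Rightarrow>
   ('z \<Rightarrow> (('i \<Rightarrow> complex) \<Rightarrow> ('i \<Rightarrow> complex))) \<Rightarrow> bool" where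
  "real_complete_order_embedding sc C I \<phi> \<longleftrightarrow>
     complex_linear_into_B sc I \<phi> \<and> inj \<phi> \<and>
     real_completely_positive C I \<phi> \<and> inverse_real_completely_positive C I \<phi>"

end

(* For z in M_n(Z) let nu_n(z) be the infimum of h_n(w) over all w above z.  Then nu is again a matrix gauge;
   normality gives h_n(z) = max (nu_n(z)) (nu_n(-z)), and h-closedness gives that z is accretive iff nu_n(-z) = 0.
   Hence it suffices to find enough linear maps phi : Z -> M_k ("matrix states") with Re phi^(m)(z) <= nu_m(z)
   for all m and z: their direct sum over all k is the desired embedding.

   Such maps norming a given z0 in M_n(Z), up to epsilon, are found by one application of the Hahn-Banach theorem
   on the real vector space M_n x M_n(Z).  It yields a state p of M_n and a functional f with f(z0) >= nu_n(z0) and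
   f(X* z X) <= p(X* X) whenever nu_m(z) <= 1.  Complexify f to F and let e_1, ..., e_n be orthonormal for the inner
   product p(x* y) + epsilon <x, y>; then phi(z)_ij = F(e_i* z e_j). *)

theory Submission
  imports Defs "HOL-Library.Function_Algebras"
begin

section \<open>The Hahn--Banach theorem for sublinear functionals\<close>

text \<open>A functional f with f(X* z X) <= p(X* X) is of no use without its state p, and one p
  must serve all sizes m of z. Treating pairs (A, y) as the variable finds both at once. The
  certified bounds of pairs add up because the column X over Y compresses the direct sum of z and w
  to X* z X + Y* w Y, while the gauge of a direct sum is only a maximum: this is where the gauge
  axioms enter. The form p(x* y) may be degenerate. Instead of passing to a quotient, a small
  multiple of the standard inner product is added, so that orthonormalization stays in C^n and the
  states take values in n x n matrices. The price is that z0 is normed at a vector of squared norm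
  at most 1 + epsilon, which disappears in the limit. The direct sum runs over all matrix states,
  with the state itself part of the index, so no family has to be chosen. A state is controlled by
  the gauge in its real part only, hence boundedness of the direct sum needs an argument of its own.
  Order, norm and injectivity are then all read off from the quadratic form of the amplified direct
  sum.\<close>

definition sublinear :: "(real \<Rightarrow> 'v \<Rightarrow> 'v) \<Rightarrow> ('v::ab_group_add \<Rightarrow> real) \<Rightarrow> bool" where
  "sublinear s q \<longleftrightarrow> (\<forall>x y. q (x + y) \<le> q x + q y) \<and> (\<forall>t>0. \<forall>x. q (s t x) \<le> t * q x)"

lemma sublinear_add: "sublinear s q \<Longrightarrow> q (x + y) \<le> q x + q y"
  by (simp add: sublinear_def)

text \<open>Scaling \<open>s t x\<close> back by 1/t gives the reverse inequality. This is why
  \<open>sublinear\<close> can ask for an inequality and t > 0 only, which is easy to verify for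
  infima.\<close>

lemma sublinear_scale:
  assumes "vector_space s" "sublinear s q" "t \<ge> 0"
  shows "q (s t x) = t * q x"
proof -
  interpret r: vector_space s by fact
  have le: "q (s t x) \<le> t * q x" if "t > 0" for t x
    using assms(2) that by (simp add: sublinear_def)
  have "q 0 = 0"
    using le[of 2 0] le[of "1/2" 0] by simp
  moreover have "t * q x \<le> q (s t x)" if "t > 0"
    using le[of "1 / t" "s t x"] that by (simp add: field_simps)
  ultimately show ?thesis
    using le[of t x] assms(3) by (cases "t = 0") auto
qed

lemma sublinear_lower:
  assumes "vector_space s" "sublinear s q"
  shows "- q (- x) \<le> q x"
proof -
  interpret r: vector_space s by fact
  have "q 0 = 0"
    using sublinear_scale[OF assms, of 0 0] by simp
  then show ?thesis
    using sublinear_add[OF assms(2), of x "- x"] by simp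
qed

text \<open>Replacing \<open>q\<close> by the infimum of \<open>q (x + t y) - t q y\<close> over \<open>t \<ge> 0\<close> makes it additive in direction
  \<open>y\<close>; a minimal sublinear functional is therefore linear.\<close>

lemma sublinear_shift:
  assumes vs: "vector_space s" and q: "sublinear s q"
  obtains r where "sublinear s r" "\<And>x. r x \<le> q x" "\<And>x. r x + q y \<le> q (x + y)"
proof -
  interpret r: vector_space s by fact
  define d where "d t x = q (x + s t y) - t * q y" for t x
  define r where "r x = (INF t\<in>{0..}. d t x)" for x
  have hom: "q (s t x) = t * q x" if "t \<ge> 0" for t x
    using sublinear_scale[OF vs q that] .
  have "- q (- x) \<le> d t x" if "t \<ge> 0" for t x
    using sublinear_add[OF q, of "x + s t y" "- x"] hom[OF that, of y] by (simp add: d_def)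
  then have bdd: "bdd_below ((\<lambda>t. d t x) ` {0..})" for x
    by (intro bdd_belowI2[where m = "- q (- x)"]) auto
  have le: "r x \<le> d t x" if "t \<ge> 0" for t x
    unfolding r_def using bdd that by (intro cINF_lower) auto
  have ge: "c \<le> r x" if "\<And>t. t \<ge> 0 \<Longrightarrow> c \<le> d t x" for c x
    unfolding r_def using that by (intro cINF_greatest) auto
  have "r (x + x') \<le> r x + r x'" for x x'
  proof -
    have "r (x + x') - d t x \<le> d u x'" if "t \<ge> 0" "u \<ge> 0" for t u
    proof -
      have "r (x + x') \<le> d (t + u) (x + x')"
        using that by (intro le) auto
      also have "\<dots> \<le> d t x + d u x'"
        using sublinear_add[OF q, of "x + s t y" "x' + s u y"]
        by (simp add: d_def r.scale_left_distrib algebra_simps)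
      finally show ?thesis by simp
    qed
    then have "r (x + x') - d t x \<le> r x'" if "t \<ge> 0" for t
      using that by (intro ge) auto
    then have "r (x + x') - r x' \<le> r x"
      by (intro ge) (simp add: algebra_simps)
    then show ?thesis by simp
  qed
  moreover have "r (s c x) \<le> c * r x" if "c > 0" for c x
  proof -
    have "r (s c x) / c \<le> d t x" if "t \<ge> 0" for t
    proof -
      have "r (s c x) \<le> d (c * t) (s c x)"
        using that \<open>c > 0\<close> by (intro le) auto
      also have "\<dots> = q (s c (x + s t y)) - c * t * q y"
        by (simp add: d_def r.scale_right_distrib)
      also have "\<dots> = c * d t x"
        using hom[of c "x + s t y"] \<open>c > 0\<close> by (simp add: d_def algebra_simps)
      finally show ?thesis using \<open>c > 0\<close> by (simp add: field_simps)
    qed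
    then have "r (s c x) / c \<le> r x" by (rule ge)
    then show ?thesis using \<open>c > 0\<close> by (simp add: field_simps)
  qed
  ultimately have "sublinear s r" by (simp add: sublinear_def)
  moreover have "r x \<le> q x" for x
    using le[of 0 x] by (simp add: d_def)
  moreover have "r x + q y \<le> q (x + y)" for x
    using le[of 1 x] by (simp add: d_def)
  ultimately show ?thesis by (rule that)
qed

text \<open>Zorn's lemma for the reversed pointwise order. A chain is bounded by its pointwise
  infimum, which is finite because every member r <= q satisfies -q(-x) <= -r(-x) <= r(x).\<close>

lemma sublinear_minimal:
  assumes vs: "vector_space s" and q: "sublinear s q"
  obtains g where "sublinear s g" "\<And>x. g x \<le> q x"
    "\<And>r. sublinear s r \<Longrightarrow> (\<And>x. r x \<le> g x) \<Longrightarrow> r = g"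
proof -
  define A where "A = {r. sublinear s r \<and> (\<forall>x. r x \<le> q x)}"
  define P where "P a b \<longleftrightarrow> (\<forall>x. b x \<le> a x)" for a b :: "'a \<Rightarrow> real"
  have "\<exists>m\<in>A. \<forall>a\<in>A. P m a \<longrightarrow> a = m"
  proof (rule predicate_Zorn)
    show "partial_order_on A (relation_of P A)"
      by (rule partial_order_on_relation_ofI) (auto simp: P_def fun_eq_iff intro: order_trans antisym)
  next
    fix C assume "C \<in> Chains (relation_of P A)"
    then have CA: "C \<subseteq> A" and ch: "\<And>a b. a \<in> C \<Longrightarrow> b \<in> C \<Longrightarrow> P a b \<or> P b a"
      unfolding Chains_def relation_of_def by auto
    show "\<exists>u\<in>A. \<forall>a\<in>C. P a u"
    proof (cases "C = {}")
      case True
      then show ?thesis using q by (auto simp: A_def)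
    next
      case False
      define u where "u x = (INF r\<in>C. r x)" for x
      have sub: "sublinear s r" if "r \<in> C" for r
        using that CA unfolding A_def by blast
      have leq: "r x \<le> q x" if "r \<in> C" for r x
        using that CA unfolding A_def by blast
      have "- q (- x) \<le> r x" if "r \<in> C" for r x
        using sublinear_lower[OF vs sub[OF that], of x] leq[OF that, of "- x"] by linarith
      then have bdd: "bdd_below ((\<lambda>r. r x) ` C)" for x
        by (intro bdd_belowI2[where m = "- q (- x)"]) auto
      have le: "u x \<le> r x" if "r \<in> C" for r x
        unfolding u_def using bdd that by (intro cINF_lower) auto
      have ge: "c \<le> u x" if "\<And>r. r \<in> C \<Longrightarrow> c \<le> r x" for c x
        unfolding u_def using that False by (intro cINF_greatest) auto
      have "u (x + y) \<le> u x + u y" for x y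
      proof -
        have "u (x + y) - r x \<le> r' y" if rr: "r \<in> C" "r' \<in> C" for r r'
        proof -
          \<comment> \<open>Chain members are comparable, so the smaller of \<open>r\<close> and
            \<open>r'\<close> lies below both, at \<open>x\<close> and at \<open>y\<close>
            simultaneously.\<close>
          obtain t where t: "t \<in> C" "t x \<le> r x" "t y \<le> r' y"
            using ch[OF rr] rr unfolding P_def by blast
          show ?thesis
            using le[OF t(1), of "x + y"] sublinear_add[OF sub[OF t(1)], of x y] t(2,3) by simp
        qed
        then have "u (x + y) - r x \<le> u y" if "r \<in> C" for r
          using that by (intro ge) auto
        then have "u (x + y) - u y \<le> u x"
          by (intro ge) (simp add: algebra_simps)
        then show ?thesis by simp
      qed
      moreover have "u (s t x) \<le> t * u x" if "t > 0" for t x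
      proof -
        have "u (s t x) / t \<le> r x" if "r \<in> C" for r
        proof -
          have "u (s t x) \<le> t * r x"
            using le[OF that, of "s t x"] sub[OF that] \<open>t > 0\<close>
            unfolding sublinear_def by (meson order_trans)
          then show ?thesis using \<open>t > 0\<close> by (simp add: field_simps)
        qed
        then have "u (s t x) / t \<le> u x" by (rule ge)
        then show ?thesis using \<open>t > 0\<close> by (simp add: field_simps)
      qed
      moreover have "u x \<le> q x" for x
        using False le leq by (meson all_not_in_conv order_trans)
      ultimately have "u \<in> A" by (simp add: A_def sublinear_def)
      moreover have "P r u" if "r \<in> C" for r
        using le[OF that] by (simp add: P_def)
      ultimately show ?thesis by blast
    qed
  qed
  then obtain g where g: "g \<in> A" "\<And>a. a \<in> A \<Longrightarrow> P g a \<Longrightarrow> a = g" by blast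
  show ?thesis
  proof (rule that)
    show "sublinear s g" "g x \<le> q x" for x using g(1) by (auto simp: A_def)
    fix r assume "sublinear s r" "\<And>x. r x \<le> g x"
    then show "r = g"
      using g by (intro g(2)) (auto simp: A_def P_def intro: order_trans)
  qed
qed

text \<open>A minimal functional equals its own shift in every direction \<open>y\<close>, and the
  shift inequality then reads as superadditivity. Shifting once along \<open>x0\<close> before
  minimizing fixes the value there: at \<open>- x0\<close> the shifted functional is at most
  \<open>- q x0\<close>.\<close>

theorem Hahn_Banach_sublinear:
  assumes vs: "vector_space s" and q: "sublinear s q"
  obtains g where "\<And>x y. g (x + y) = g x + g y" "\<And>t x. g (s t x) = t * g x"
    "\<And>x. g x \<le> q x" "g x0 = q x0"
proof -
  interpret r: vector_space s by fact
  obtain q' where q': "sublinear s q'" "\<And>x. q' x \<le> q x" "\<And>x. q' x + q x0 \<le> q (x + x0)"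
    using sublinear_shift[OF vs q] by metis
  obtain g where g: "sublinear s g" "\<And>x. g x \<le> q' x"
    and min: "\<And>r. sublinear s r \<Longrightarrow> (\<And>x. r x \<le> g x) \<Longrightarrow> r = g"
    using sublinear_minimal[OF vs q'(1)] by metis
  have add: "g (x + y) = g x + g y" for x y
  proof -
    obtain r where "sublinear s r" "\<And>x. r x \<le> g x" "\<And>x. r x + g y \<le> g (x + y)"
      using sublinear_shift[OF vs g(1)] by metis
    then have "g x + g y \<le> g (x + y)" using min by metis
    then show ?thesis using sublinear_add[OF g(1)] by (metis antisym)
  qed
  have zero: "g 0 = 0" using add[of 0 0] by simp
  have minus: "g (- x) = - g x" for x using add[of x "- x"] zero by simp
  have hom: "g (s t x) = t * g x" if "t \<ge> 0" for t x
    using sublinear_scale[OF vs g(1) that] .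
  have "g (s t x) = t * g x" for t x
    using hom[of t x] hom[of "- t" x] minus[of "s t x"] by (cases "t \<ge> 0") auto
  moreover have "g x0 = q x0"
  proof (rule antisym)
    have "q 0 = 0" using sublinear_scale[OF vs q, of 0 0] by simp
    then show "q x0 \<le> g x0" using q'(3)[of "- x0"] g(2)[of "- x0"] minus by simp
    show "g x0 \<le> q x0" using g(2) q'(2) order_trans by blast
  qed
  ultimately show ?thesis
    using that[of g] add g(2) q'(2) by (meson order_trans)
qed

section \<open>Bounded operators on sequence spaces\<close>

lemma l2_summable: "f \<in> l2 J \<Longrightarrow> (\<lambda>x. (cmod (f x))\<^sup>2) summable_on J"
  and l2_outside: "f \<in> l2 J \<Longrightarrow> x \<notin> J \<Longrightarrow> f x = 0"
  by (auto simp: l2_def)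

lemma l2_comparison:
  assumes "g summable_on J" "\<And>x. x \<in> J \<Longrightarrow> (cmod (f x))\<^sup>2 \<le> g x" "\<And>x. x \<notin> J \<Longrightarrow> f x = 0"
  shows "f \<in> l2 J"
proof -
  have "(\<lambda>x. (cmod (f x))\<^sup>2) summable_on J"
    by (rule summable_on_comparison_test[OF assms(1)]) (simp_all add: assms(2))
  then show ?thesis using assms(3) by (simp add: l2_def)
qed

lemma l2_scale:
  assumes "f \<in> l2 J"
  shows "(\<lambda>x. c * f x) \<in> l2 J"
proof (rule l2_comparison)
  show "(\<lambda>x. (cmod c)\<^sup>2 * (cmod (f x))\<^sup>2) summable_on J"
    by (intro summable_on_cmult_right l2_summable assms)
qed (simp_all add: norm_mult power_mult_distrib l2_outside[OF assms])

lemma cmod_add_squared_le: "(cmod (a + b))\<^sup>2 \<le> 2 * (cmod a)\<^sup>2 + 2 * (cmod b)\<^sup>2"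
proof -
  have "(cmod (a + b))\<^sup>2 \<le> (cmod a + cmod b)\<^sup>2"
    by (intro power_mono norm_triangle_ineq) auto
  also have "\<dots> \<le> 2 * (cmod a)\<^sup>2 + 2 * (cmod b)\<^sup>2"
    using zero_le_power2[of "cmod a - cmod b"] by (simp add: power2_eq_square algebra_simps)
  finally show ?thesis .
qed

lemma l2_add:
  assumes "f \<in> l2 J" "g \<in> l2 J"
  shows "(\<lambda>x. f x + g x) \<in> l2 J"
proof (rule l2_comparison)
  show "(\<lambda>x. 2 * (cmod (f x))\<^sup>2 + 2 * (cmod (g x))\<^sup>2) summable_on J"
    by (intro summable_on_cmult_right summable_on_add l2_summable assms)
qed (simp_all add: cmod_add_squared_le l2_outside[OF assms(1)] l2_outside[OF assms(2)])

lemma l2_zero [simp]: "(\<lambda>x. 0) \<in> l2 J"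
  by (simp add: l2_def)

lemma l2_sum: "finite A \<Longrightarrow> (\<And>a. a \<in> A \<Longrightarrow> f a \<in> l2 J) \<Longrightarrow> (\<lambda>x. \<Sum>a\<in>A. f a x) \<in> l2 J"
  by (induction A rule: finite_induct) (auto intro: l2_add)

lemma l2_restrict:
  assumes "f \<in> l2 J" "F \<subseteq> J"
  shows "(\<lambda>x. if x \<in> F then f x else 0) \<in> l2 J"
  by (rule l2_comparison[OF l2_summable[OF assms(1)]]) (use assms(2) in auto)

lemma l2_finite_support: "finite F \<Longrightarrow> F \<subseteq> J \<Longrightarrow> (\<lambda>x. if x \<in> F then f x else 0) \<in> l2 J"
proof -
  assume F: "finite F" "F \<subseteq> J"
  have "(\<lambda>x. (cmod (if x \<in> F then f x else 0))\<^sup>2) summable_on J"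
    by (rule finite_nonzero_values_imp_summable_on, rule finite_subset[OF _ F(1)]) auto
  then show ?thesis using F(2) by (auto simp: l2_def)
qed

lemma cinner_abs_summable:
  assumes "f \<in> l2 J" "g \<in> l2 J"
  shows "(\<lambda>x. norm (f x * cnj (g x))) summable_on J"
  by (rule abs_summable_product)
    (use l2_summable[OF assms(1)] l2_summable[OF assms(2)] in
      \<open>simp_all add: norm_mult power2_eq_square\<close>)

lemma cinner_has_sum:
  "f \<in> l2 J \<Longrightarrow> g \<in> l2 J \<Longrightarrow> ((\<lambda>x. f x * cnj (g x)) has_sum cinner J f g) J"
  unfolding cinner_def by (rule has_sum_infsum[OF abs_summable_summable[OF cinner_abs_summable]])

lemma cinner_add_left:
  assumes "f \<in> l2 J" "f' \<in> l2 J" "g \<in> l2 J"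
  shows "cinner J (\<lambda>x. f x + f' x) g = cinner J f g + cinner J f' g"
  unfolding cinner_def[of J "\<lambda>x. f x + f' x"] distrib_right
  by (intro infsumI has_sum_add cinner_has_sum assms)

lemma cinner_scale_left: "cinner J (\<lambda>x. c * f x) g = c * cinner J f g"
  by (simp add: cinner_def mult.assoc infsum_cmult_right')

lemma cinner_commute: "cinner J g f = cnj (cinner J f g)"
  unfolding cinner_def infsum_cnj[symmetric] by (intro infsum_cong) auto

lemma cinner_add_right:
  assumes "f \<in> l2 J" "f' \<in> l2 J" "g \<in> l2 J"
  shows "cinner J g (\<lambda>x. f x + f' x) = cinner J g f + cinner J g f'"
  unfolding cinner_commute[of J g] cinner_add_left[OF assms] by simp

lemma cinner_scale_right: "cinner J g (\<lambda>x. c * f x) = cnj c * cinner J g f"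
  unfolding cinner_commute[of J g] cinner_scale_left by simp

lemma cinner_zero_left [simp]: "cinner J (\<lambda>x. 0) g = 0"
  by (simp add: cinner_def)

lemma l2norm_nonneg [simp]: "l2norm J f \<ge> 0"
  unfolding l2norm_def by (simp add: infsum_nonneg)

lemma l2norm_squared: "(l2norm J f)\<^sup>2 = infsum (\<lambda>x. (cmod (f x))\<^sup>2) J"
  unfolding l2norm_def by (simp add: infsum_nonneg)

lemma cinner_self: "f \<in> l2 J \<Longrightarrow> cinner J f f = complex_of_real ((l2norm J f)\<^sup>2)"
  unfolding cinner_def l2norm_squared complex_norm_square[symmetric]
  by (intro infsumI has_sum_of_real) (simp add: l2_summable)

lemma l2norm_scale: "l2norm J (\<lambda>x. c * f x) = cmod c * l2norm J f"
  by (simp add: l2norm_def norm_mult power_mult_distrib infsum_cmult_right' real_sqrt_mult)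

lemma l2norm_eq_0:
  assumes "f \<in> l2 J" "l2norm J f = 0"
  shows "f = (\<lambda>x. 0)"
proof
  fix x
  have "infsum (\<lambda>x. (cmod (f x))\<^sup>2) J \<le> 0"
    using assms(2) l2norm_squared[of J f] by simp
  then show "f x = 0"
    using nonneg_infsum_le_0D[OF _ l2_summable[OF assms(1)], of x] l2_outside[OF assms(1), of x]
    by (cases "x \<in> J") auto
qed

lemma l2norm_squared_add:
  assumes "f \<in> l2 J" "g \<in> l2 J"
  shows "(l2norm J (\<lambda>x. f x + g x))\<^sup>2 = (l2norm J f)\<^sup>2 + (l2norm J g)\<^sup>2 + 2 * Re (cinner J f g)"
proof -
  note fg = l2_add[OF assms]
  have "cinner J (\<lambda>x. f x + g x) (\<lambda>x. f x + g x)
    = cinner J f f + cinner J g g + (cinner J f g + cinner J g f)"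
    using assms fg by (simp add: cinner_add_left cinner_add_right)
  moreover have "Re (cinner J f g + cinner J g f) = 2 * Re (cinner J f g)"
    using cinner_commute[of J g f] by simp
  ultimately show ?thesis
    using cinner_self[OF fg] cinner_self[OF assms(1)] cinner_self[OF assms(2)]
    by (metis Re_complex_of_real plus_complex.simps(1))
qed

text \<open>Cauchy--Schwarz: expand 0 <= ||b f - a g||^2 with a = ||f|| and b = ||g||, then divide
  by 2ab.\<close>

lemma Re_cinner_le:
  assumes "f \<in> l2 J" "g \<in> l2 J"
  shows "Re (cinner J f g) \<le> l2norm J f * l2norm J g"
proof (cases "l2norm J f = 0 \<or> l2norm J g = 0")
  case True
  then have "f = (\<lambda>x. 0) \<or> g = (\<lambda>x. 0)" using assms l2norm_eq_0 by blast
  then show ?thesis by (auto simp: cinner_def)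
next
  case False
  define a b where "a = l2norm J f" and "b = l2norm J g"
  have pos: "a > 0" "b > 0"
    using False l2norm_nonneg[of J f] l2norm_nonneg[of J g] by (auto simp: a_def b_def less_le)
  have "0 \<le> (l2norm J (\<lambda>x. complex_of_real b * f x + complex_of_real (- a) * g x))\<^sup>2"
    by simp
  also have "\<dots> = (b * a)\<^sup>2 + (a * b)\<^sup>2 + 2 * (- (a * b) * Re (cinner J f g))"
    using pos assms
    by (simp only: l2norm_squared_add l2_scale cinner_scale_left cinner_scale_right l2norm_scale)
       (simp add: a_def b_def)
  finally have "a * b * Re (cinner J f g) \<le> a * b * (a * b)"
    by (simp add: power2_eq_square algebra_simps)
  then show ?thesis using pos by (simp add: a_def b_def)
qed

lemma unimodular_rotation:
  obtains c where "cmod c = 1" "c * z = complex_of_real (cmod z)"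
proof (cases "z = 0")
  case True
  show ?thesis by (rule that[of 1]) (use True in auto)
next
  case False
  show ?thesis
  proof (rule that[of "cnj z / cmod z"])
    show "cmod (cnj z / cmod z) = 1" using False by (simp add: norm_divide)
    show "cnj z / cmod z * z = cmod z"
      using False complex_norm_square[of z] by (simp add: field_simps power2_eq_square)
  qed
qed

text \<open>Rotating \<open>f\<close> by a unimodular scalar makes the inner product real and
  nonnegative, so the bound on real parts applies.\<close>

lemma norm_cinner_le:
  assumes "f \<in> l2 J" "g \<in> l2 J"
  shows "cmod (cinner J f g) \<le> l2norm J f * l2norm J g"
proof -
  obtain c where c: "cmod c = 1" "c * cinner J f g = cmod (cinner J f g)"
    by (rule unimodular_rotation)
  have "cmod (cinner J f g) = Re (cinner J (\<lambda>x. c * f x) g)"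
    using c(2) by (simp add: cinner_scale_left)
  also have "\<dots> \<le> l2norm J (\<lambda>x. c * f x) * l2norm J g"
    using assms by (intro Re_cinner_le l2_scale)
  finally show ?thesis using c(1) by (simp add: l2norm_scale)
qed

section \<open>Bounded operators and their adjoints\<close>

lemma bop_l2: "is_bop J T \<Longrightarrow> f \<in> l2 J \<Longrightarrow> T f \<in> l2 J"
  and bop_add: "is_bop J T \<Longrightarrow> f \<in> l2 J \<Longrightarrow> g \<in> l2 J \<Longrightarrow> T (\<lambda>x. f x + g x) = (\<lambda>x. T f x + T g x)"
  and bop_scale: "is_bop J T \<Longrightarrow> f \<in> l2 J \<Longrightarrow> T (\<lambda>x. c * f x) = (\<lambda>x. c * T f x)"
  and bop_outside: "is_bop J T \<Longrightarrow> f \<notin> l2 J \<Longrightarrow> T f = (\<lambda>x. 0)"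
  unfolding is_bop_def by blast+

lemma bop_bounded:
  assumes "is_bop J T"
  obtains C where "C > 0" "\<And>f. f \<in> l2 J \<Longrightarrow> l2norm J (T f) \<le> C * l2norm J f"
proof -
  obtain C where C: "\<And>f. f \<in> l2 J \<Longrightarrow> l2norm J (T f) \<le> C * l2norm J f"
    using assms unfolding is_bop_def by blast
  have "l2norm J (T f) \<le> max C 1 * l2norm J f" if "f \<in> l2 J" for f
    using C[OF that] mult_right_mono[OF max.cobounded1 l2norm_nonneg] by (rule order_trans)
  then show ?thesis by (intro that[of "max C 1"]) simp
qed

lemma bop_zero: "is_bop J T \<Longrightarrow> T (\<lambda>x. 0) = (\<lambda>x. 0)"
  using bop_scale[of J T "\<lambda>x. 0" 0] by simp

lemma l2norm_restrict:
  assumes "f \<in> l2 J" "F \<subseteq> J"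
  shows "(l2norm J (\<lambda>x. if x \<in> F then f x else 0))\<^sup>2 = infsum (\<lambda>x. (cmod (f x))\<^sup>2) F"
  unfolding l2norm_squared using assms(2) by (intro infsum_cong_neutral) auto

lemma bop_finite_expansion:
  assumes T: "is_bop J T" and g: "g \<in> l2 J" and F: "finite F" "F \<subseteq> J"
  shows "cinner J (T (\<lambda>y. if y \<in> F then f y else 0)) g
    = (\<Sum>x\<in>F. f x * cinner J (T (\<lambda>y. if y = x then 1 else 0)) g)"
  using F
proof (induction F rule: finite_induct)
  case empty
  then show ?case using bop_zero[OF T] by simp
next
  case (insert x F)
  let ?e = "\<lambda>y. if y = x then 1 else (0::complex)" and ?f = "\<lambda>y. if y \<in> F then f y else 0"
  have e: "?e \<in> l2 J" using l2_finite_support[of "{x}" J "\<lambda>_. 1"] insert.prems by simp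
  have f: "?f \<in> l2 J" using insert by (intro l2_finite_support) auto
  have "(\<lambda>y. if y \<in> insert x F then f y else 0) = (\<lambda>y. f x * ?e y + ?f y)"
    using insert.hyps by auto
  then have "T (\<lambda>y. if y \<in> insert x F then f y else 0) = (\<lambda>y. f x * T ?e y + T ?f y)"
    using bop_add[OF T l2_scale[OF e] f] bop_scale[OF T e] by simp
  then show ?case
    using insert e f g
    by (simp add: cinner_add_left cinner_scale_left bop_l2[OF T] l2_scale)
qed

text \<open>\<open>adj\<close> is defined by choice and says nothing until an adjoint exists. Its
  coordinates are forced by testing on unit vectors: \<open>S g\<close> at x must be the conjugate
  of <T e_x, g>. The work lies in the square-summability of \<open>S g\<close> and in extending the
  identity beyond finitely supported vectors.\<close>

lemma ex_adjoint:
  assumes T: "is_bop J T"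
  shows "\<exists>S. is_bop J S \<and> (\<forall>f\<in>l2 J. \<forall>g\<in>l2 J. cinner J (T f) g = cinner J f (S g))"
proof -
  obtain C where C: "C > 0" "\<And>f. f \<in> l2 J \<Longrightarrow> l2norm J (T f) \<le> C * l2norm J f"
    using bop_bounded[OF T] by metis
  define e :: "'a \<Rightarrow> 'a \<Rightarrow> complex" where "e x = (\<lambda>y. if y = x then 1 else 0)" for x
  define S where "S g = (if g \<in> l2 J then (\<lambda>x. if x \<in> J then cnj (cinner J (T (e x)) g) else 0)
    else (\<lambda>x. 0))" for g
  have e: "e x \<in> l2 J" if "x \<in> J" for x
    using l2_finite_support[of "{x}" J "\<lambda>_. 1"] that by (simp add: e_def)
  have exp: "cinner J (T (\<lambda>y. if y \<in> F then f y else 0)) g = (\<Sum>x\<in>F. f x * cnj (S g x))"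
    if "finite F" "F \<subseteq> J" "g \<in> l2 J" for F f g
    using bop_finite_expansion[OF T that(3,1,2), of f] that
    by (auto simp: S_def e_def intro!: sum.cong)
  have bound: "cmod (cinner J (T f) g) \<le> C * l2norm J f * l2norm J g"
    if "f \<in> l2 J" "g \<in> l2 J" for f g
    using norm_cinner_le[OF bop_l2[OF T that(1)] that(2)]
      mult_right_mono[OF C(2)[OF that(1)] l2norm_nonneg[of J g]] by linarith
  \<comment> \<open>Testing T on the truncation of \<open>S g\<close> to F makes the pairing equal
    to s^2, while boundedness of T makes it at most C s ||g||; dividing by s bounds s.\<close>
  have fin: "(\<Sum>x\<in>F. (cmod (S g x))\<^sup>2) \<le> (C * l2norm J g)\<^sup>2"
    if "finite F" "F \<subseteq> J" "g \<in> l2 J" for F g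
  proof -
    define s where "s = sqrt (\<Sum>x\<in>F. (cmod (S g x))\<^sup>2)"
    let ?f = "\<lambda>y. if y \<in> F then S g y else 0"
    have f: "?f \<in> l2 J" using that by (intro l2_finite_support) auto
    have s2: "s\<^sup>2 = (\<Sum>x\<in>F. (cmod (S g x))\<^sup>2)"
      by (simp add: s_def sum_nonneg)
    have s0: "s \<ge> 0" by (simp add: s_def sum_nonneg)
    have "(l2norm J ?f)\<^sup>2 = infsum (\<lambda>x. (cmod (S g x))\<^sup>2) F"
      unfolding l2norm_squared using that(2) by (intro infsum_cong_neutral) auto
    then have "(l2norm J ?f)\<^sup>2 = s\<^sup>2" using s2 \<open>finite F\<close> by simp
    then have "l2norm J ?f = s" using s0 l2norm_nonneg[of J ?f]
      by (metis power2_eq_iff_nonneg)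
    moreover have "cinner J (T ?f) g = complex_of_real (s\<^sup>2)"
      using exp[OF that, of "S g"] unfolding s2 by (simp add: complex_norm_square del: of_real_power)
    ultimately have "s\<^sup>2 \<le> C * s * l2norm J g"
      using bound[OF f that(3)] by (simp del: of_real_power)
    then have "s * s \<le> s * (C * l2norm J g)" by (simp add: power2_eq_square ac_simps)
    then have "s \<le> C * l2norm J g"
      using s0 C(1) by (cases "s = 0") (auto simp: mult_le_cancel_left_pos less_le)
    then have "s\<^sup>2 \<le> (C * l2norm J g)\<^sup>2" using s0 by (intro power_mono)
    then show ?thesis by (simp add: s2)
  qed
  have Sl2: "S g \<in> l2 J" and Snorm: "l2norm J (S g) \<le> C * l2norm J g" if "g \<in> l2 J" for g
  proof -
    have summ: "(\<lambda>x. (cmod (S g x))\<^sup>2) summable_on J"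
      using fin[OF _ _ that]
      by (intro nonneg_bdd_above_summable_on) (auto intro!: bdd_aboveI2)
    then show "S g \<in> l2 J" using that by (auto simp: l2_def S_def)
    have "(l2norm J (S g))\<^sup>2 \<le> (C * l2norm J g)\<^sup>2"
      unfolding l2norm_squared[of J "S g"]
      using fin[OF _ _ that] by (intro infsum_le_finite_sums summ) auto
    then show "l2norm J (S g) \<le> C * l2norm J g"
      by (rule power2_le_imp_le) (use C(1) in simp)
  qed
  have adj: "cinner J (T f) g = cinner J f (S g)" if "f \<in> l2 J" "g \<in> l2 J" for f g
  proof -
    \<comment> \<open>\<open>r F\<close> is the norm of the tail of \<open>f\<close> outside F. It
      tends to 0 along finite F and, by boundedness of T, controls the error of the finite
      expansion.\<close>
    define r where "r F = l2norm J (\<lambda>y. if y \<in> J - F then f y else 0)" for F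
    have f2: "(\<lambda>x. (cmod (f x))\<^sup>2) summable_on J" using that(1) by (rule l2_summable)
    have r: "r F = sqrt (infsum (\<lambda>x. (cmod (f x))\<^sup>2) J - (\<Sum>x\<in>F. (cmod (f x))\<^sup>2))"
      if "finite F" "F \<subseteq> J" for F
    proof -
      have "(r F)\<^sup>2 = infsum (\<lambda>x. (cmod (f x))\<^sup>2) (J - F)"
        unfolding r_def using \<open>f \<in> l2 J\<close> by (intro l2norm_restrict) auto
      also have "\<dots> = infsum (\<lambda>x. (cmod (f x))\<^sup>2) J - infsum (\<lambda>x. (cmod (f x))\<^sup>2) F"
        using f2 that by (intro infsum_Diff) auto
      finally have "(r F)\<^sup>2 = infsum (\<lambda>x. (cmod (f x))\<^sup>2) J - (\<Sum>x\<in>F. (cmod (f x))\<^sup>2)"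
        using that by simp
      then show ?thesis
        by (metis r_def l2norm_nonneg real_sqrt_abs abs_of_nonneg)
    qed
    have "((\<lambda>F. sqrt (infsum (\<lambda>x. (cmod (f x))\<^sup>2) J - (\<Sum>x\<in>F. (cmod (f x))\<^sup>2)))
        \<longlongrightarrow> sqrt (infsum (\<lambda>x. (cmod (f x))\<^sup>2) J - infsum (\<lambda>x. (cmod (f x))\<^sup>2) J))
        (finite_subsets_at_top J)"
      by (intro tendsto_intros infsum_tendsto f2)
    then have "((\<lambda>F. sqrt (infsum (\<lambda>x. (cmod (f x))\<^sup>2) J - (\<Sum>x\<in>F. (cmod (f x))\<^sup>2))) \<longlongrightarrow> 0)
        (finite_subsets_at_top J)"
      by simp
    then have "(r \<longlongrightarrow> 0) (finite_subsets_at_top J)"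
      by (rule Lim_transform_eventually)
        (auto simp: r intro!: eventually_finite_subsets_at_top_weakI)
    then have lim: "((\<lambda>F. C * l2norm J g * r F) \<longlongrightarrow> 0) (finite_subsets_at_top J)"
      using tendsto_mult_right_zero by blast
    have "cmod ((\<Sum>x\<in>F. f x * cnj (S g x)) - cinner J (T f) g) \<le> C * l2norm J g * r F"
      if F: "finite F" "F \<subseteq> J" for F
    proof -
      let ?f = "\<lambda>y. if y \<in> F then f y else 0" and ?f' = "\<lambda>y. if y \<in> J - F then f y else 0"
      have l: "?f \<in> l2 J" "?f' \<in> l2 J"
        using \<open>f \<in> l2 J\<close> F by (intro l2_restrict; auto)+
      have "f = (\<lambda>y. ?f y + ?f' y)"
        using l2_outside[OF \<open>f \<in> l2 J\<close>] F(2) by auto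
      then have "T f = (\<lambda>y. T ?f y + T ?f' y)"
        using bop_add[OF T l] by simp
      then have "cinner J (T f) g = cinner J (T ?f) g + cinner J (T ?f') g"
        using \<open>g \<in> l2 J\<close> bop_l2[OF T l(1)] bop_l2[OF T l(2)] by (simp add: cinner_add_left)
      then show ?thesis
        using bound[OF l(2) \<open>g \<in> l2 J\<close>] exp[OF F \<open>g \<in> l2 J\<close>, of f]
        by (simp add: norm_minus_commute r_def ac_simps)
    qed
    then have "((\<lambda>F. (\<Sum>x\<in>F. f x * cnj (S g x)) - cinner J (T f) g) \<longlongrightarrow> 0)
        (finite_subsets_at_top J)"
      by (intro Lim_null_comparison[OF _ lim] eventually_finite_subsets_at_top_weakI) auto
    then have "((\<lambda>x. f x * cnj (S g x)) has_sum cinner J (T f) g) J"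
      unfolding has_sum_def by (simp add: LIM_zero_iff)
    then show ?thesis by (simp add: cinner_def infsumI)
  qed
  have "is_bop J S"
    unfolding is_bop_def
  proof (intro conjI ballI allI impI)
    fix f g assume "f \<in> l2 J" "g \<in> l2 J"
    then show "S (\<lambda>x. f x + g x) = (\<lambda>x. S f x + S g x)"
      using e by (auto simp: S_def l2_add cinner_add_right bop_l2[OF T])
  next
    fix c f assume "f \<in> l2 J"
    then show "S (\<lambda>x. c * f x) = (\<lambda>x. c * S f x)"
      using e by (auto simp: S_def l2_scale cinner_scale_right)
  next
    show "\<exists>C. \<forall>f\<in>l2 J. l2norm J (S f) \<le> C * l2norm J f" using Snorm by blast
  qed (use Sl2 in \<open>simp_all add: S_def\<close>)
  then show ?thesis using adj by blast
qed

lemma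
  assumes "is_bop J T"
  shows bop_adj: "is_bop J (adj J T)"
    and cinner_adj: "f \<in> l2 J \<Longrightarrow> g \<in> l2 J \<Longrightarrow> cinner J (T f) g = cinner J f (adj J T g)"
proof -
  have "is_bop J (adj J T) \<and> (\<forall>f\<in>l2 J. \<forall>g\<in>l2 J. cinner J (T f) g = cinner J f (adj J T g))"
    unfolding adj_def by (rule someI_ex[OF ex_adjoint[OF assms]])
  then show "is_bop J (adj J T)"
    and "f \<in> l2 J \<Longrightarrow> g \<in> l2 J \<Longrightarrow> cinner J (T f) g = cinner J f (adj J T g)"
    by blast+
qed

lemma l2norm_add_le:
  assumes "f \<in> l2 J" "g \<in> l2 J"
  shows "l2norm J (\<lambda>x. f x + g x) \<le> l2norm J f + l2norm J g"
proof (rule power2_le_imp_le)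
  show "(l2norm J (\<lambda>x. f x + g x))\<^sup>2 \<le> (l2norm J f + l2norm J g)\<^sup>2"
    using l2norm_squared_add[OF assms] Re_cinner_le[OF assms] by (simp add: power2_sum)
qed simp

lemma bop_half_sum:
  assumes "is_bop J T" "is_bop J S"
  shows "is_bop J (\<lambda>f x. (T f x + S f x) / 2)"
proof -
  obtain C where C: "\<And>f. f \<in> l2 J \<Longrightarrow> l2norm J (T f) \<le> C * l2norm J f"
    using bop_bounded[OF assms(1)] by metis
  obtain D where D: "\<And>f. f \<in> l2 J \<Longrightarrow> l2norm J (S f) \<le> D * l2norm J f"
    using bop_bounded[OF assms(2)] by metis
  have l2: "T f \<in> l2 J" "S f \<in> l2 J" if "f \<in> l2 J" for f
    using assms that by (auto intro: bop_l2)
  have half: "(\<lambda>x. (T f x + S f x) / 2) = (\<lambda>x. (1 / 2) * (T f x + S f x))" for f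
    by auto
  show ?thesis
    unfolding is_bop_def
  proof (intro conjI ballI allI impI exI[of _ "1 / 2 * (C + D)"])
    fix f assume f: "f \<in> l2 J"
    show "(\<lambda>x. (T f x + S f x) / 2) \<in> l2 J"
      unfolding half using l2[OF f] by (intro l2_scale l2_add)
    show "l2norm J (\<lambda>x. (T f x + S f x) / 2) \<le> 1 / 2 * (C + D) * l2norm J f"
      unfolding half l2norm_scale
      using l2norm_add_le[OF l2[OF f]] C[OF f] D[OF f] by (simp add: algebra_simps)
    show "(\<lambda>x. (T (\<lambda>x. c * f x) x + S (\<lambda>x. c * f x) x) / 2)
      = (\<lambda>x. c * ((T f x + S f x) / 2))" for c
      by (simp add: bop_scale[OF assms(1) f] bop_scale[OF assms(2) f] distrib_left)
    fix g assume g: "g \<in> l2 J"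
    show "(\<lambda>x. (T (\<lambda>x. f x + g x) x + S (\<lambda>x. f x + g x) x) / 2)
      = (\<lambda>x. (T f x + S f x) / 2 + (T g x + S g x) / 2)"
      by (simp add: bop_add[OF assms(1) f g] bop_add[OF assms(2) f g] add_divide_distrib
          add.assoc add.left_commute)
  next
    fix f assume "f \<notin> l2 J"
    then show "(\<lambda>x. (T f x + S f x) / 2) = (\<lambda>x. 0)"
      by (simp add: bop_outside[OF assms(1)] bop_outside[OF assms(2)])
  qed
qed

section \<open>Real parts, accretivity and operator norms\<close>

lemma bop_ReOp: "is_bop J T \<Longrightarrow> is_bop J (ReOp J T)"
  unfolding ReOp_def by (intro bop_half_sum bop_adj)

lemma cinner_ReOp:
  assumes "is_bop J T" "f \<in> l2 J" "g \<in> l2 J"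
  shows "cinner J (ReOp J T f) g = (cinner J (T f) g + cnj (cinner J (T g) f)) / 2"
proof -
  have "cinner J (ReOp J T f) g = cinner J (\<lambda>x. (1 / 2) * (T f x + adj J T f x)) g"
    unfolding ReOp_def by (simp add: mult.commute)
  also have "\<dots> = (cinner J (T f) g + cinner J (adj J T f) g) / 2"
    unfolding cinner_scale_left
    using assms(2,3) bop_l2[OF assms(1)] bop_l2[OF bop_adj[OF assms(1)]]
    by (simp add: cinner_add_left)
  also have "cinner J (adj J T f) g = cnj (cinner J (T g) f)"
    using cinner_adj[OF assms(1,3,2)] cinner_commute by metis
  finally show ?thesis .
qed

lemma cinner_ReOp_self:
  assumes "is_bop J T" "f \<in> l2 J"
  shows "cinner J (ReOp J T f) f = complex_of_real (Re (cinner J (T f) f))"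
  using cinner_ReOp[OF assms assms(2)] complex_add_cnj[of "cinner J (T f) f"] by simp

text \<open>The inner product of \<open>ReOp J T f\<close> with f is the real number Re <T f, f>, so
  the adjoint drops out and only the quadratic form of T remains.\<close>

lemma accretive_op_iff:
  "is_bop J T \<Longrightarrow> accretive_op J T \<longleftrightarrow> (\<forall>f\<in>l2 J. 0 \<le> Re (cinner J (T f) f))"
  by (simp add: accretive_op_def pos_op_def cinner_ReOp_self)

lemma opnorm_le:
  assumes "\<And>f. f \<in> l2 J \<Longrightarrow> l2norm J (T f) \<le> h * l2norm J f" "h \<ge> 0"
  shows "opnorm J T \<le> h"
  unfolding opnorm_def
proof (rule cSUP_least)
  have "(\<lambda>x. 0) \<in> {f \<in> l2 J. l2norm J f \<le> 1}" by (simp add: l2norm_def)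
  then show "{f \<in> l2 J. l2norm J f \<le> 1} \<noteq> {}" by blast
  fix f assume f: "f \<in> {f \<in> l2 J. l2norm J f \<le> 1}"
  then have "h * l2norm J f \<le> h * 1" using assms(2) by (intro mult_left_mono) auto
  then show "l2norm J (T f) \<le> h" using assms(1)[of f] f by auto
qed

lemma le_opnorm_unit:
  assumes T: "is_bop J T" and f: "f \<in> l2 J" "l2norm J f \<le> 1"
  shows "l2norm J (T f) \<le> opnorm J T"
  unfolding opnorm_def
proof (rule cSUP_upper)
  obtain C where C: "C > 0" "\<And>f. f \<in> l2 J \<Longrightarrow> l2norm J (T f) \<le> C * l2norm J f"
    using bop_bounded[OF T] by metis
  have "l2norm J (T g) \<le> C" if "g \<in> l2 J" "l2norm J g \<le> 1" for g
    using C(2)[OF that(1)] mult_left_mono[OF that(2), of C] C(1) by linarith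
  then show "bdd_above ((\<lambda>f. l2norm J (T f)) ` {f \<in> l2 J. l2norm J f \<le> 1})"
    by (intro bdd_aboveI2[where M = C]) auto
qed (use f in simp)

lemma opnorm_nonneg:
  assumes "is_bop J T"
  shows "0 \<le> opnorm J T"
proof -
  have "l2norm J (T (\<lambda>x. 0)) \<le> opnorm J T"
    by (rule le_opnorm_unit[OF assms l2_zero]) (simp add: l2norm_def)
  then show ?thesis using l2norm_nonneg order_trans by blast
qed

lemma le_opnorm:
  assumes T: "is_bop J T" and f: "f \<in> l2 J"
  shows "l2norm J (T f) \<le> opnorm J T * l2norm J f"
proof (cases "l2norm J f = 0")
  case True
  then have "f = (\<lambda>x. 0)" using f l2norm_eq_0 by blast
  then have "T f = (\<lambda>x. 0)" using bop_zero[OF T] by simp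
  then show ?thesis using True by (simp add: l2norm_def)
next
  case False
  then have pos: "l2norm J f > 0" using l2norm_nonneg[of J f] by linarith
  let ?c = "complex_of_real (1 / l2norm J f)"
  have "l2norm J (T f) / l2norm J f = l2norm J (T (\<lambda>x. ?c * f x))"
    using pos unfolding bop_scale[OF T f] l2norm_scale by (simp add: norm_divide)
  also have "\<dots> \<le> opnorm J T"
  proof (rule le_opnorm_unit[OF T l2_scale[OF f]])
    show "l2norm J (\<lambda>x. ?c * f x) \<le> 1"
      unfolding l2norm_scale using pos by (simp add: norm_divide)
  qed
  finally show ?thesis using pos by (simp add: field_simps)
qed

lemma abs_Re_cinner_le_opnorm:
  assumes "is_bop J T" "f \<in> l2 J"
  shows "\<bar>Re (cinner J (T f) f)\<bar> \<le> opnorm J (ReOp J T) * (l2norm J f)\<^sup>2"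
proof -
  have "\<bar>Re (cinner J (T f) f)\<bar> = cmod (cinner J (ReOp J T f) f)"
    using cinner_ReOp_self[OF assms] by simp
  also have "\<dots> \<le> l2norm J (ReOp J T f) * l2norm J f"
    by (rule norm_cinner_le[OF bop_l2[OF bop_ReOp[OF assms(1)] assms(2)] assms(2)])
  also have "\<dots> \<le> opnorm J (ReOp J T) * l2norm J f * l2norm J f"
    by (intro mult_right_mono le_opnorm[OF bop_ReOp[OF assms(1)] assms(2)]) simp
  finally show ?thesis by (simp add: power2_eq_square)
qed

text \<open>For a self-adjoint \<open>A\<close> the form bound at \<open>f \<plusminus> A f / c\<close> gives, by polarization, the norm bound.\<close>

lemma opnorm_ReOp_le:
  assumes T: "is_bop J T" and "h \<ge> 0"
    and form: "\<And>f. f \<in> l2 J \<Longrightarrow> \<bar>Re (cinner J (T f) f)\<bar> \<le> h * (l2norm J f)\<^sup>2"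
  shows "opnorm J (ReOp J T) \<le> h"
proof (rule field_le_epsilon)
  fix \<epsilon> :: real assume "\<epsilon> > 0"
  \<comment> \<open>The slack \<open>\<epsilon>\<close> keeps \<open>c\<close> positive even for h =
    0, so that 1/c makes sense.\<close>
  define c where "c = h + \<epsilon>"
  have c: "c > 0" using \<open>h \<ge> 0\<close> \<open>\<epsilon> > 0\<close> by (simp add: c_def)
  define A where "A = ReOp J T"
  have A: "is_bop J A" unfolding A_def by (rule bop_ReOp[OF T])
  have formA: "\<bar>Re (cinner J (A f) f)\<bar> \<le> c * (l2norm J f)\<^sup>2" if "f \<in> l2 J" for f
  proof -
    have "\<bar>Re (cinner J (A f) f)\<bar> \<le> h * (l2norm J f)\<^sup>2"
      unfolding A_def using cinner_ReOp_self[OF T that] form[OF that] by simp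
    also have "\<dots> \<le> c * (l2norm J f)\<^sup>2"
      using \<open>\<epsilon> > 0\<close> by (intro mult_right_mono) (auto simp: c_def)
    finally show ?thesis .
  qed
  have "l2norm J (A f) \<le> c * l2norm J f" if f: "f \<in> l2 J" for f
  proof -
    define s where "s = complex_of_real (1 / c)"
    define g where "g = A f"
    have g: "g \<in> l2 J" unfolding g_def using A f by (rule bop_l2)
    have sg: "(\<lambda>x. t * g x) \<in> l2 J" for t using g by (rule l2_scale)
    have quad: "Re (cinner J (A (\<lambda>x. f x + t * g x)) (\<lambda>x. f x + t * g x))
      = Re (cinner J (A f) f) + (cmod t)\<^sup>2 * Re (cinner J (A g) g) + 2 * Re t * (l2norm J g)\<^sup>2" for t
    proof -
      have "cinner J (A g) f = cnj (cinner J (A f) g)"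
        unfolding A_def cinner_ReOp[OF T g f] cinner_ReOp[OF T f g] by (simp add: add.commute)
      moreover have "cinner J (A f) g = complex_of_real ((l2norm J g)\<^sup>2)"
        using cinner_self[OF g] by (simp add: g_def)
      moreover have "cinner J (A (\<lambda>x. f x + t * g x)) (\<lambda>x. f x + t * g x)
        = cinner J (A f) f + t * cnj t * cinner J (A g) g + t * cinner J (A g) f
          + cnj t * cinner J (A f) g"
        unfolding bop_add[OF A f sg] bop_scale[OF A g]
        using f g sg bop_l2[OF A f] bop_l2[OF A g]
        by (simp add: cinner_add_left cinner_add_right cinner_scale_left cinner_scale_right
            l2_scale l2_add algebra_simps)
      ultimately show ?thesis
        by (simp add: complex_norm_square[symmetric] algebra_simps del: of_real_power)
    qed
    have nrm: "(l2norm J (\<lambda>x. f x + t * g x))\<^sup>2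
      = (l2norm J f)\<^sup>2 + (cmod t)\<^sup>2 * (l2norm J g)\<^sup>2 + 2 * Re (cnj t * cinner J f g)" for t
      using l2norm_squared_add[OF f sg]
      by (simp add: l2norm_scale power_mult_distrib cinner_scale_right)
    \<comment> \<open>The parallelogram law bounds (4/c)||g||^2 by 2c||f||^2 + (2/c)||g||^2;
      absorbing the last term leaves ||g|| <= c||f||. This is the reason for s = 1/c.\<close>
    have "4 * Re s * (l2norm J g)\<^sup>2
      = Re (cinner J (A (\<lambda>x. f x + s * g x)) (\<lambda>x. f x + s * g x))
        - Re (cinner J (A (\<lambda>x. f x + (- s) * g x)) (\<lambda>x. f x + (- s) * g x))"
      unfolding quad by simp
    also have "\<dots> \<le> c * (l2norm J (\<lambda>x. f x + s * g x))\<^sup>2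
        + c * (l2norm J (\<lambda>x. f x + (- s) * g x))\<^sup>2"
      using formA[OF l2_add[OF f sg[of s]]] formA[OF l2_add[OF f sg[of "- s"]]] by linarith
    also have "\<dots> = 2 * c * ((l2norm J f)\<^sup>2 + (cmod s)\<^sup>2 * (l2norm J g)\<^sup>2)"
      unfolding nrm by (simp add: algebra_simps)
    finally have "4 * (1 / c) * (l2norm J g)\<^sup>2
      \<le> 2 * c * ((l2norm J f)\<^sup>2 + (1 / c)\<^sup>2 * (l2norm J g)\<^sup>2)"
      using c by (simp add: s_def norm_divide power_divide)
    then have "(l2norm J g)\<^sup>2 \<le> (c * l2norm J f)\<^sup>2"
      using c by (simp add: field_simps power2_eq_square)
    then show ?thesis
      unfolding g_def by (rule power2_le_imp_le) (use c in simp)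
  qed
  then show "opnorm J (ReOp J T) \<le> h + \<epsilon>"
    unfolding A_def c_def[symmetric] using c by (intro opnorm_le) auto
qed

section \<open>Amplifications: l2 over \<open>I \<times> {..<n}\<close> as n copies of l2 over
  \<open>I\<close>\<close>

lemma has_sum_times_lessThan:
  fixes f :: "'i \<times> nat \<Rightarrow> 'b::topological_comm_monoid_add"
  assumes "\<And>p. p < n \<Longrightarrow> ((\<lambda>x. f (x, p)) has_sum s p) I"
  shows "(f has_sum (\<Sum>p<n. s p)) (I \<times> {..<n})"
  using assms
proof (induction n)
  case 0
  then show ?case by simp
next
  case (Suc n)
  have "inj_on (\<lambda>x. (x, n)) I" by (auto simp: inj_on_def)
  then have "(f has_sum s n) ((\<lambda>x. (x, n)) ` I)"
    unfolding has_sum_reindex[OF \<open>inj_on _ I\<close>] using Suc.prems[of n] by (simp add: o_def)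
  moreover have "(f has_sum (\<Sum>p<n. s p)) (I \<times> {..<n})"
    using Suc by simp
  ultimately have "(f has_sum ((\<Sum>p<n. s p) + s n)) (I \<times> {..<n} \<union> (\<lambda>x. (x, n)) ` I)"
    by (intro has_sum_Un_disjoint) auto
  moreover have "I \<times> {..<n} \<union> (\<lambda>x. (x, n)) ` I = I \<times> {..<Suc n}"
    by (auto simp: less_Suc_eq)
  ultimately show ?case by simp
qed

lemma has_sum_lessThan:
  fixes f :: "nat \<Rightarrow> 'i \<Rightarrow> 'b::topological_comm_monoid_add"
  assumes "\<And>p. p < n \<Longrightarrow> (f p has_sum s p) I"
  shows "((\<lambda>x. \<Sum>p<n. f p x) has_sum (\<Sum>p<n. s p)) I"
  using assms by (induction n) (simp_all add: has_sum_add)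

lemma l2_slice:
  fixes n :: nat
  assumes "F \<in> l2 (I \<times> {..<n})"
  shows "(\<lambda>x. F (x, p)) \<in> l2 I"
proof (cases "p < n")
  case True
  have inj: "inj_on (\<lambda>x. (x, p)) I" by (auto simp: inj_on_def)
  have "(\<lambda>x. (cmod (F x))\<^sup>2) summable_on ((\<lambda>x. (x, p)) ` I)"
    using True by (intro summable_on_subset_banach[OF l2_summable[OF assms]]) auto
  then have "(\<lambda>x. (cmod (F (x, p)))\<^sup>2) summable_on I"
    unfolding summable_on_reindex[OF inj] by (simp add: o_def)
  then show ?thesis using l2_outside[OF assms] by (simp add: l2_def)
next
  case False
  then have "F (x, p) = 0" for x using l2_outside[OF assms] by simp
  then show ?thesis by simp
qed

lemma l2_slicesI:
  fixes n :: nat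
  assumes "\<And>p. p < n \<Longrightarrow> (\<lambda>x. F (x, p)) \<in> l2 I" "\<And>x p. p \<ge> n \<Longrightarrow> F (x, p) = 0"
  shows "F \<in> l2 (I \<times> {..<n})"
proof -
  have "((\<lambda>x. (cmod (F x))\<^sup>2) has_sum (\<Sum>p<n. infsum (\<lambda>x. (cmod (F (x, p)))\<^sup>2) I)) (I \<times> {..<n})"
    by (rule has_sum_times_lessThan, rule has_sum_infsum, rule l2_summable[OF assms(1)])
  then have "(\<lambda>x. (cmod (F x))\<^sup>2) summable_on I \<times> {..<n}" by (rule has_sum_imp_summable)
  moreover have "F y = 0" if "y \<notin> I \<times> {..<n}" for y
  proof (cases y)
    case (Pair x p)
    then show ?thesis
      using that assms(2)[of p x] l2_outside[OF assms(1), of p x] by (cases "p < n") auto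
  qed
  ultimately show ?thesis by (simp add: l2_def)
qed

lemma l2norm_slices:
  fixes n :: nat
  assumes "F \<in> l2 (I \<times> {..<n})"
  shows "(l2norm (I \<times> {..<n}) F)\<^sup>2 = (\<Sum>p<n. (l2norm I (\<lambda>x. F (x, p)))\<^sup>2)"
  unfolding l2norm_squared
  by (intro infsumI has_sum_times_lessThan) (simp add: l2_summable[OF l2_slice[OF assms]])

lemma l2norm_slice_le:
  fixes n :: nat
  assumes "F \<in> l2 (I \<times> {..<n})" "p < n"
  shows "l2norm I (\<lambda>x. F (x, p)) \<le> l2norm (I \<times> {..<n}) F"
proof (rule power2_le_imp_le)
  show "(l2norm I (\<lambda>x. F (x, p)))\<^sup>2 \<le> (l2norm (I \<times> {..<n}) F)\<^sup>2"
    unfolding l2norm_slices[OF assms(1)] using assms(2)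
    by (intro member_le_sum[where f = "\<lambda>p. (l2norm I (\<lambda>x. F (x, p)))\<^sup>2"]) auto
qed simp

lemma cinner_slices:
  fixes n :: nat
  assumes "F \<in> l2 (I \<times> {..<n})" "G \<in> l2 (I \<times> {..<n})"
  shows "cinner (I \<times> {..<n}) F G = (\<Sum>p<n. cinner I (\<lambda>x. F (x, p)) (\<lambda>x. G (x, p)))"
  unfolding cinner_def[of "I \<times> {..<n}"]
  by (intro infsumI has_sum_times_lessThan cinner_has_sum l2_slice[OF assms(1)] l2_slice[OF assms(2)])

lemma l2norm_sum_le:
  assumes "finite A" "\<And>a. a \<in> A \<Longrightarrow> f a \<in> l2 J"
  shows "l2norm J (\<lambda>x. \<Sum>a\<in>A. f a x) \<le> (\<Sum>a\<in>A. l2norm J (f a))"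
  using assms
proof (induction A rule: finite_induct)
  case empty
  then show ?case by (simp add: l2norm_def)
next
  case (insert a A)
  have "l2norm J (\<lambda>x. f a x + (\<Sum>a\<in>A. f a x)) \<le> l2norm J (f a) + l2norm J (\<lambda>x. \<Sum>a\<in>A. f a x)"
    using insert by (intro l2norm_add_le l2_sum) auto
  then show ?case using insert by simp
qed

lemma amp_apply:
  "F \<in> l2 (I \<times> {..<n}) \<Longrightarrow>
    amp I n \<phi> z F (i, p) = (if p < n then (\<Sum>q<n. \<phi> (z p q) (\<lambda>j. F (j, q)) i) else 0)"
  by (simp add: amp_def)

lemma is_bop_amp:
  assumes bop: "\<And>w. is_bop I (\<phi> w)"
  shows "is_bop (I \<times> {..<n}) (amp I n \<phi> z)"
proof -
  let ?J = "I \<times> {..<n}"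
  have "\<forall>w. \<exists>C>0. \<forall>f\<in>l2 I. l2norm I (\<phi> w f) \<le> C * l2norm I f"
    using bop_bounded[OF bop] by metis
  then obtain C where C0: "\<And>w. C w > 0"
    and C: "\<And>w f. f \<in> l2 I \<Longrightarrow> l2norm I (\<phi> w f) \<le> C w * l2norm I f"
    by metis
  \<comment> \<open>Row sums of operator bounds: a crude constant, since only boundedness is at
    stake.\<close>
  define D where "D p = (\<Sum>q<n. C (z p q))" for p
  have entry: "\<phi> (z p q) (\<lambda>j. F (j, q)) \<in> l2 I" if "F \<in> l2 ?J" for F p q
    by (rule bop_l2[OF bop l2_slice[OF that]])
  have row: "(\<lambda>i. amp I n \<phi> z F (i, p)) = (\<lambda>i. \<Sum>q<n. \<phi> (z p q) (\<lambda>j. F (j, q)) i)"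
    if "F \<in> l2 ?J" "p < n" for F p
    using that by (simp add: amp_apply)
  have l2: "amp I n \<phi> z F \<in> l2 ?J" if F: "F \<in> l2 ?J" for F
  proof (rule l2_slicesI)
    fix p assume "p < n"
    show "(\<lambda>i. amp I n \<phi> z F (i, p)) \<in> l2 I"
      unfolding row[OF F \<open>p < n\<close>] by (rule l2_sum) (simp_all add: entry[OF F])
  qed (simp add: amp_apply[OF F])
  have bound: "l2norm ?J (amp I n \<phi> z F) \<le> sqrt (\<Sum>p<n. (D p)\<^sup>2) * l2norm ?J F" if F: "F \<in> l2 ?J" for F
  proof (rule power2_le_imp_le)
    have "(l2norm I (\<lambda>i. amp I n \<phi> z F (i, p)))\<^sup>2 \<le> (D p * l2norm ?J F)\<^sup>2" if p: "p < n" for p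
    proof (rule power_mono)
      have "l2norm I (\<lambda>i. amp I n \<phi> z F (i, p)) \<le> (\<Sum>q<n. l2norm I (\<phi> (z p q) (\<lambda>j. F (j, q))))"
        unfolding row[OF F p] by (rule l2norm_sum_le) (simp_all add: entry[OF F])
      also have "\<dots> \<le> (\<Sum>q<n. C (z p q) * l2norm ?J F)"
      proof (rule sum_mono)
        fix q assume "q \<in> {..<n}"
        then have "l2norm I (\<lambda>j. F (j, q)) \<le> l2norm ?J F" by (intro l2norm_slice_le[OF F]) simp
        then show "l2norm I (\<phi> (z p q) (\<lambda>j. F (j, q))) \<le> C (z p q) * l2norm ?J F"
          using C[OF l2_slice[OF F], of "z p q" q] mult_left_mono[of _ _ "C (z p q)"] C0[of "z p q"]
          by (meson less_imp_le order_trans)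
      qed
      finally show "l2norm I (\<lambda>i. amp I n \<phi> z F (i, p)) \<le> D p * l2norm ?J F"
        by (simp add: D_def sum_distrib_right)
    qed simp
    then have "(\<Sum>p<n. (l2norm I (\<lambda>i. amp I n \<phi> z F (i, p)))\<^sup>2) \<le> (\<Sum>p<n. (D p * l2norm ?J F)\<^sup>2)"
      by (intro sum_mono) simp
    also have "\<dots> = (sqrt (\<Sum>p<n. (D p)\<^sup>2) * l2norm ?J F)\<^sup>2"
      by (simp add: power_mult_distrib sum_distrib_right sum_nonneg)
    finally show "(l2norm ?J (amp I n \<phi> z F))\<^sup>2 \<le> (sqrt (\<Sum>p<n. (D p)\<^sup>2) * l2norm ?J F)\<^sup>2"
      unfolding l2norm_slices[OF l2[OF F]] .
  qed (simp add: sum_nonneg)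
  show ?thesis
    unfolding is_bop_def
  proof (intro conjI ballI allI impI exI[of _ "sqrt (\<Sum>p<n. (D p)\<^sup>2)"])
    fix F assume F: "F \<in> l2 ?J"
    show "amp I n \<phi> z F \<in> l2 ?J" by (rule l2[OF F])
    show "l2norm ?J (amp I n \<phi> z F) \<le> sqrt (\<Sum>p<n. (D p)\<^sup>2) * l2norm ?J F" by (rule bound[OF F])
    show "amp I n \<phi> z (\<lambda>x. c * F x) = (\<lambda>x. c * amp I n \<phi> z F x)" for c
    proof
      fix x
      show "amp I n \<phi> z (\<lambda>x. c * F x) x = c * amp I n \<phi> z F x"
        by (cases x) (simp add: amp_apply[OF F] amp_apply[OF l2_scale[OF F]]
            bop_scale[OF bop l2_slice[OF F]] sum_distrib_left)
    qed
    fix G assume G: "G \<in> l2 ?J"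
    show "amp I n \<phi> z (\<lambda>x. F x + G x) = (\<lambda>x. amp I n \<phi> z F x + amp I n \<phi> z G x)"
    proof
      fix x
      show "amp I n \<phi> z (\<lambda>x. F x + G x) x = amp I n \<phi> z F x + amp I n \<phi> z G x"
        by (cases x) (simp add: amp_apply[OF F] amp_apply[OF G] amp_apply[OF l2_add[OF F G]]
            bop_add[OF bop l2_slice[OF F] l2_slice[OF G]] sum.distrib)
    qed
  next
    fix F assume "F \<notin> l2 ?J"
    then show "amp I n \<phi> z F = (\<lambda>x. 0)" by (simp add: amp_def)
  qed
qed

text \<open>The index (k, \<phi>, i) stands for the i-th basis vector of a copy of C^k attached to
  \<phi>, so l2 over this set is the Hilbert space direct sum of these copies over all k >= 1 and
  all \<phi> in \<open>M k\<close>.\<close>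

definition blocks :: "(nat \<Rightarrow> 'f set) \<Rightarrow> (nat \<times> 'f \<times> nat) set" where
  "blocks M = (SIGMA k:{1..}. M k \<times> {..<k})"

lemma in_blocks [simp]: "(k, \<phi>, i) \<in> blocks M \<longleftrightarrow> k \<ge> 1 \<and> \<phi> \<in> M k \<and> i < k"
  by (auto simp: blocks_def)

text \<open>Only complete block sums have a sign, not the single terms, so the sum is first
  regrouped by blocks; summability of \<open>G\<close> justifies this.\<close>

lemma infsum_blocks_nonneg:
  fixes G :: "nat \<times> 'f \<times> nat \<Rightarrow> real"
  assumes G: "G summable_on blocks M"
    and block: "\<And>k \<phi>. k \<ge> 1 \<Longrightarrow> \<phi> \<in> M k \<Longrightarrow> 0 \<le> (\<Sum>i<k. G (k, \<phi>, i))"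
  shows "0 \<le> infsum G (blocks M)"
proof -
  have "infsum G (blocks M) = infsum (\<lambda>k. infsum (\<lambda>y. G (k, y)) (M k \<times> {..<k})) {1..}"
    using G unfolding blocks_def by (rule infsum_Sigma_banach[symmetric])
  moreover have "0 \<le> infsum (\<lambda>y. G (k, y)) (M k \<times> {..<k})" if "k \<in> {1..}" for k
  proof -
    have inj: "inj_on (Pair k) (M k \<times> {..<k})" by (auto simp: inj_on_def)
    have "G summable_on (Pair k ` (M k \<times> {..<k}))"
      using that by (intro summable_on_subset_banach[OF G]) (auto simp: blocks_def)
    then have "(\<lambda>y. G (k, y)) summable_on M k \<times> {..<k}"
      unfolding summable_on_reindex[OF inj] by (simp add: o_def)
    then have "infsum (\<lambda>y. G (k, y)) (M k \<times> {..<k}) = infsum (\<lambda>\<phi>. infsum (\<lambda>i. G (k, \<phi>, i)) {..<k}) (M k)"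
      by (rule infsum_Sigma_banach[symmetric])
    then show ?thesis using block that by (simp add: infsum_nonneg)
  qed
  ultimately show ?thesis by (simp only: infsum_nonneg)
qed

text \<open>Summability of \<open>F\<close> is part of the claim, so the bound goes through finite
  partial sums. A finite index set is enlarged to a union of complete blocks, which only increases
  the sum of the nonnegative \<open>F\<close> and makes the blockwise bound applicable.\<close>

lemma blocks_comparison:
  fixes F G :: "nat \<times> 'f \<times> nat \<Rightarrow> real"
  assumes G: "G summable_on blocks M" "\<And>x. x \<in> blocks M \<Longrightarrow> 0 \<le> G x"
    and F: "\<And>x. x \<in> blocks M \<Longrightarrow> 0 \<le> F x"
    and block: "\<And>k \<phi>. k \<ge> 1 \<Longrightarrow> \<phi> \<in> M k \<Longrightarrow> (\<Sum>i<k. F (k, \<phi>, i)) \<le> (\<Sum>i<k. G (k, \<phi>, i))"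
  shows "F summable_on blocks M" "infsum F (blocks M) \<le> infsum G (blocks M)"
proof -
  have fin: "sum F X \<le> infsum G (blocks M)" if X: "finite X" "X \<subseteq> blocks M" for X
  proof -
    define T where "T = (\<lambda>(k, \<phi>, i). (k, \<phi>)) ` X"
    define e where "e = (\<lambda>((k, \<phi>), j). (k :: nat, \<phi> :: 'f, j :: nat))"
    define U where "U = e ` (SIGMA b:T. {..<fst b})"
    have T: "finite T" "\<And>b. b \<in> T \<Longrightarrow> fst b \<ge> 1 \<and> snd b \<in> M (fst b)"
      using X by (auto simp: T_def)
    have U: "finite U" "U \<subseteq> blocks M"
      using T by (auto simp: U_def e_def)
    have "x \<in> U" if "x \<in> X" for x
    proof -
      obtain k \<phi> i where x: "x = (k, \<phi>, i)" by (metis surj_pair)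
      then have "(k, \<phi>) \<in> T" "i < k"
        using \<open>x \<in> X\<close> X(2) by (force simp: T_def)+
      then have "((k, \<phi>), i) \<in> (SIGMA b:T. {..<fst b})" by simp
      then show ?thesis unfolding U_def x by (force simp: e_def)
    qed
    then have "sum F X \<le> sum F U"
      using U F by (intro sum_mono2) auto
    have inj: "inj_on e (SIGMA b:T. {..<fst b})" by (auto simp: inj_on_def e_def)
    have sumU: "sum H U = (\<Sum>b\<in>T. \<Sum>i<fst b. H (fst b, snd b, i))" for H :: "nat \<times> 'f \<times> nat \<Rightarrow> real"
      unfolding U_def sum.reindex[OF inj] using T(1)
      by (simp add: sum.Sigma e_def split_def o_def)
    have "sum F U \<le> sum G U"
      unfolding sumU using T(2) by (intro sum_mono[where K = T] block) auto
    moreover have "sum G U \<le> infsum G (blocks M)"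
      using U G by (intro finite_sum_le_infsum) auto
    ultimately show ?thesis using \<open>sum F X \<le> sum F U\<close> by linarith
  qed
  show summ: "F summable_on blocks M"
    using F fin by (intro nonneg_bdd_above_summable_on) (auto intro!: bdd_aboveI2)
  show "infsum F (blocks M) \<le> infsum G (blocks M)"
    using fin by (intro infsum_le_finite_sums summ) auto
qed

section \<open>Matrix states of a contractive gauge\<close>

text \<open>If \<open>S x\<close> collects the certified upper bounds for x, then adding and scaling
  certificates becomes sublinearity of the best bound. Nonemptiness and boundedness below keep the
  real infimum meaningful.\<close>

lemma sublinear_Inf:
  fixes S :: "'v::ab_group_add \<Rightarrow> real set"
  assumes ne: "\<And>x. S x \<noteq> {}" and bdd: "\<And>x. bdd_below (S x)"
    and add: "\<And>x y c d. c \<in> S x \<Longrightarrow> d \<in> S y \<Longrightarrow> c + d \<in> S (x + y)"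
    and scale: "\<And>t x c. t > 0 \<Longrightarrow> c \<in> S x \<Longrightarrow> t * c \<in> S (s t x)"
  shows "sublinear s (\<lambda>x. Inf (S x))"
  unfolding sublinear_def
proof (intro conjI allI impI)
  fix x y
  have "Inf (S (x + y)) - c \<le> Inf (S y)" if "c \<in> S x" for c
  proof (rule cInf_greatest[OF ne])
    fix d assume "d \<in> S y"
    then have "Inf (S (x + y)) \<le> c + d" using that by (intro cInf_lower bdd add)
    then show "Inf (S (x + y)) - c \<le> d" by simp
  qed
  then have "Inf (S (x + y)) - Inf (S y) \<le> Inf (S x)"
    by (intro cInf_greatest[OF ne]) (simp add: algebra_simps)
  then show "Inf (S (x + y)) \<le> Inf (S x) + Inf (S y)" by simp
next
  fix t :: real and x assume t: "t > 0"
  have "Inf (S (s t x)) / t \<le> Inf (S x)"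
  proof (rule cInf_greatest[OF ne])
    fix c assume "c \<in> S x"
    then have "Inf (S (s t x)) \<le> t * c" using t by (intro cInf_lower bdd scale)
    then show "Inf (S (s t x)) / t \<le> c" using t by (simp add: field_simps)
  qed
  then show "Inf (S (s t x)) \<le> t * Inf (S x)" using t by (simp add: field_simps)
qed

lemma complexify_functional:
  fixes S :: "complex \<Rightarrow> 'v::ab_group_add \<Rightarrow> 'v" and f :: "'v \<Rightarrow> real"
  assumes vs: "vector_space S"
    and add: "\<And>x y. f (x + y) = f x + f y"
    and scale: "\<And>t x. f (S (complex_of_real t) x) = t * f x"
  obtains F where "\<And>x y. F (x + y) = F x + F y" "\<And>c x. F (S c x) = c * F x" "\<And>x. Re (F x) = f x"
proof -
  interpret S: vector_space S by fact
  \<comment> \<open>f(x) - i f(i x) is the only complex linear candidate with real part f.\<close>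
  define F where "F x = Complex (f x) (- f (S \<i> x))" for x
  have minus: "f (- x) = - f x" for x
    using scale[of "-1" x] by simp
  have "F (S c x) = c * F x" for c x
  proof -
    have fc: "f (S c y) = Re c * f y + Im c * f (S \<i> y)" for c y
    proof -
      have "S c y = S (complex_of_real (Re c)) y + S (complex_of_real (Im c)) (S \<i> y)"
        unfolding S.scale_scale S.scale_left_distrib[symmetric]
        by (simp add: complex_eq_iff)
      then show ?thesis by (simp only: add scale)
    qed
    have "f (S \<i> (S c x)) = Re (\<i> * c) * f x + Im (\<i> * c) * f (S \<i> x)"
      unfolding S.scale_scale by (rule fc)
    then show ?thesis
      unfolding F_def using fc[of c x] by (simp add: complex_eq_iff algebra_simps)
  qed
  moreover have "F (x + y) = F x + F y" for x y
    by (simp add: F_def add S.scale_right_distrib complex_eq_iff)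
  moreover have "Re (F x) = f x" for x by (simp add: F_def)
  ultimately show ?thesis using that by blast
qed

lemma additive_sum:
  fixes F :: "('i \<Rightarrow> 'j \<Rightarrow> 'a::comm_monoid_add) \<Rightarrow> 'b::ab_group_add"
  assumes "\<And>x y. F (\<lambda>a b. x a b + y a b) = F x + F y"
  shows "F (\<lambda>a b. \<Sum>k\<in>K. g k a b) = (\<Sum>k\<in>K. F (g k))"
proof -
  have F0: "F (\<lambda>a b. 0) = 0"
    using assms[of "\<lambda>a b. 0" "\<lambda>a b. 0"] by simp
  show ?thesis
    by (induction K rule: infinite_finite_induct) (simp_all add: F0 assms)
qed

text \<open>Vectors are infinite sequences, but positivity of \<open>B\<close> concerns the first n
  coordinates only. Hence supports are carried along in the induction: the first k vectors live in
  the first k coordinates and span them.\<close>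

lemma gram_schmidt:
  fixes B :: "(nat \<Rightarrow> complex) \<Rightarrow> (nat \<Rightarrow> complex) \<Rightarrow> complex"
  assumes add: "\<And>x y z. B x (\<lambda>a. y a + z a) = B x y + B x z"
    and scale: "\<And>c x y. B x (\<lambda>a. c * y a) = c * B x y"
    and herm: "\<And>x y. B y x = cnj (B x y)"
    and pos: "\<And>x. (\<exists>a<n. x a \<noteq> 0) \<Longrightarrow> Re (B x x) > 0"
    and "k \<le> n"
  shows "\<exists>e. (\<forall>i<k. \<forall>a\<ge>k. e i a = 0) \<and> (\<forall>i<k. \<forall>j<k. B (e i) (e j) = (if i = j then 1 else 0)) \<and>
    (\<forall>x. (\<forall>a\<ge>k. x a = 0) \<longrightarrow> (\<exists>c. \<forall>a. x a = (\<Sum>i<k. c i * e i a)))"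
  using \<open>k \<le> n\<close>
proof (induction k)
  case 0
  then show ?case by auto
next
  case (Suc k)
  then obtain e where E: "\<forall>i<k. \<forall>a\<ge>k. e i a = 0"
      "\<forall>i<k. \<forall>j<k. B (e i) (e j) = (if i = j then 1 else 0)"
      "\<forall>x. (\<forall>a\<ge>k. x a = 0) \<longrightarrow> (\<exists>c. \<forall>a. x a = (\<Sum>i<k. c i * e i a))"
    using Suc_leD by blast
  have supp: "e i a = 0" if "i < k" "a \<ge> k" for i a using E(1) that by blast
  have orth: "B (e i) (e j) = (if i = j then 1 else 0)" if "i < k" "j < k" for i j
    using E(2) that by blast
  have span: "\<exists>c. \<forall>a. x a = (\<Sum>i<k. c i * e i a)" if "\<forall>a\<ge>k. x a = 0" for x
    using E(3) that by blast
  have B0: "B x (\<lambda>a. 0) = 0" for x using scale[of x 0 "\<lambda>a. 0"] by simp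
  have Bsum: "B x (\<lambda>a. \<Sum>i\<in>I. c i * e i a) = (\<Sum>i\<in>I. c i * B x (e i))" if "finite I" for x c I
    using that by (induction I rule: finite_induct) (simp_all add: add scale B0)
  define d where "d = (\<lambda>a. if a = k then 1 else (0::complex))"
  \<comment> \<open>The unit vector at k minus its projection onto the earlier \<open>e i\<close>.
    These vanish at k, so \<open>u\<close> keeps the coordinate 1 there and \<open>B u u\<close> is
    positive.\<close>
  define u where "u = (\<lambda>a. d a + (\<Sum>i<k. (- B (e i) d) * e i a))"
  have uk: "u k = 1"
    using supp by (simp add: u_def d_def)
  have usupp: "u a = 0" if "a > k" for a
    using that supp by (simp add: u_def d_def)
  have eu: "B (e j) u = 0" if "j < k" for j
  proof -
    have "(\<Sum>i<k. (- B (e i) d) * B (e j) (e i)) = (\<Sum>i<k. if i = j then - B (e i) d else 0)"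
      using orth that by (intro sum.cong) auto
    then show ?thesis
      using that unfolding u_def add Bsum[OF finite_lessThan] by simp
  qed
  define r where "r = Re (B u u)"
  have "k < n" using Suc.prems by simp
  then have r: "r > 0" unfolding r_def using uk by (intro pos) (metis zero_neq_one)
  have Buu: "B u u = complex_of_real r"
    using herm[of u u] by (simp add: r_def complex_eq_iff)
  define s where "s = complex_of_real (1 / sqrt r)"
  define w where "w = (\<lambda>a. s * u a)"
  have ew: "B (e j) w = 0" if "j < k" for j
    using eu[OF that] by (simp add: w_def scale)
  have we: "B w (e j) = 0" if "j < k" for j
    using ew[OF that] herm[of w "e j"] by simp
  have "B w w = s * cnj (s * B u u)"
    using scale[of w s u] herm[of w u] scale[of u s u] by (simp add: w_def)
  then have ww: "B w w = 1"
    using r by (simp add: Buu s_def of_real_mult[symmetric] del: of_real_mult)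
  define e' where "e' = e(k := w)"
  have sk: "s \<noteq> 0" using r by (simp add: s_def)
  show ?case
  proof (intro exI[of _ e'] conjI allI impI)
    fix i a assume "i < Suc k" "a \<ge> Suc k"
    then show "e' i a = 0"
      using supp usupp by (auto simp: e'_def w_def)
  next
    fix i j assume "i < Suc k" "j < Suc k"
    then show "B (e' i) (e' j) = (if i = j then 1 else 0)"
      using orth ew we ww by (auto simp: e'_def less_Suc_eq)
  next
    fix x :: "nat \<Rightarrow> complex" assume x: "\<forall>a\<ge>Suc k. x a = 0"
    \<comment> \<open>Subtracting the right multiple of \<open>u\<close> clears coordinate k; the
      induction hypothesis expands what remains.\<close>
    have "\<forall>a\<ge>k. x a - x k * u a = 0"
    proof (intro allI impI)
      fix a assume "k \<le> a"
      then show "x a - x k * u a = 0"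
        using x uk usupp[of a] by (cases "a = k") auto
    qed
    from span[OF this] obtain c where c: "\<And>a. x a - x k * u a = (\<Sum>i<k. c i * e i a)"
      by auto
    have "x a = (\<Sum>i<Suc k. (c(k := x k / s)) i * e' i a)" for a
      using c[of a] sk by (simp add: e'_def w_def algebra_simps)
    then show "\<exists>c. \<forall>a. x a = (\<Sum>i<Suc k. c i * e' i a)" by blast
  qed
qed

section \<open>Congruences by scalar matrices\<close>

lemma sum_lessThan_add:
  fixes f :: "nat \<Rightarrow> 'a::comm_monoid_add"
  shows "(\<Sum>p<m + k. f p) = (\<Sum>p<m. f p) + (\<Sum>p<k. f (m + p))"
  by (induction k) (simp_all add: ac_simps)

definition stack :: "nat \<Rightarrow> (nat \<Rightarrow> nat \<Rightarrow> 'a) \<Rightarrow> (nat \<Rightarrow> nat \<Rightarrow> 'a) \<Rightarrow> nat \<Rightarrow> nat \<Rightarrow> 'a" where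
  "stack m X Y = (\<lambda>p a. if p < m then X p a else Y (p - m) a)"

lemma stack_rect: "X \<in> rect m n \<Longrightarrow> Y \<in> rect k n \<Longrightarrow> stack m X Y \<in> rect (m + k) n"
  by (auto simp: rect_def stack_def)

lemma dsum_mat: "A \<in> mat n \<Longrightarrow> B \<in> mat m \<Longrightarrow> dsum n A B \<in> mat (n + m)"
  by (auto simp: rect_def dsum_def less_diff_conv2)

lemma congr_mat: "congr sc n k X A \<in> mat k"
  by (auto simp: rect_def congr_def)

lemma mat_eqI: "A \<in> mat n \<Longrightarrow> B \<in> mat n \<Longrightarrow> (\<And>i j. i < n \<Longrightarrow> j < n \<Longrightarrow> A i j = B i j) \<Longrightarrow> A = B"
  unfolding rect_def by (intro ext) (metis (mono_tags, lifting) mem_Collect_eq)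

text \<open>Converts a sum of two compressions into a single compression of a direct sum; this is
  what makes \<open>pair_bounds\<close> additive.\<close>

lemma congr_stack_dsum:
  assumes "vector_space sc"
  shows "congr sc (m + k) n (stack m X Y) (dsum m A B)
    = madd (congr sc m n X A) (congr sc k n Y B)"
proof -
  interpret vector_space sc by fact
  show ?thesis
    unfolding congr_def madd_def
    by (intro ext) (simp add: sum_lessThan_add stack_def dsum_def sum.distrib)
qed

text \<open>Scalar multiples of the identity: s = sqrt t turns scaling by t >= 0 into a congruence,
  and s = 1 gives the trivial congruence.\<close>

definition dmat :: "nat \<Rightarrow> complex \<Rightarrow> nat \<Rightarrow> nat \<Rightarrow> complex" where
  "dmat n s = (\<lambda>p i. if p = i \<and> i < n then s else 0)"

lemma dmat_rect: "dmat n s \<in> mat n"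
  by (auto simp: dmat_def rect_def)

lemma dmat_apply: "p < n \<Longrightarrow> (\<Sum>i<n. dmat n s p i * v i) = s * v p"
  by (simp add: dmat_def if_distrib[of "\<lambda>x. x * _"] sum.If_cases cong: if_cong)

lemma msc_mat:
  assumes "vector_space sc" "A \<in> mat n"
  shows "msc sc c A \<in> mat n"
proof -
  interpret vector_space sc by fact
  show ?thesis using assms(2) by (auto simp: msc_def rect_def)
qed

lemma congr_dmat:
  assumes "vector_space sc" "A \<in> mat n"
  shows "congr sc n n (dmat n s) A = msc sc (cnj s * s) A"
proof -
  interpret vector_space sc by fact
  have "(\<Sum>p<n. \<Sum>q<n. sc (cnj (dmat n s p i) * dmat n s q j) (A p q)) = sc (cnj s * s) (A i j)"
    if "i < n" "j < n" for i j
  proof -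
    have "(\<Sum>p<n. \<Sum>q<n. sc (cnj (dmat n s p i) * dmat n s q j) (A p q))
      = (\<Sum>p<n. \<Sum>q<n. if q = j then if p = i then sc (cnj s * s) (A p q) else 0 else 0)"
      using that by (intro sum.cong refl) (auto simp: dmat_def)
    also have "\<dots> = sc (cnj s * s) (A i j)" using that by simp
    finally show ?thesis .
  qed
  then show ?thesis
    using assms(2) by (intro ext) (auto simp: congr_def msc_def rect_def)
qed

text \<open>Each |v_a v_b| is at most the sum of all squares. The constant is far from sharp; it
  only serves to show that every \<open>A\<close> admits some bound in
  \<open>pair_bounds\<close>.\<close>

lemma quadratic_form_bound:
  fixes A :: "nat \<Rightarrow> nat \<Rightarrow> complex"
  shows "Re (\<Sum>a<n. \<Sum>b<n. A a b * v b * cnj (v a))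
    \<le> (\<Sum>a<n. \<Sum>b<n. cmod (A a b)) * (\<Sum>a<n. (cmod (v a))\<^sup>2)"
proof -
  let ?N = "\<Sum>a<n. (cmod (v a))\<^sup>2"
  have le: "(cmod (v a))\<^sup>2 \<le> ?N" if "a < n" for a
    using that by (intro member_le_sum) auto
  have "cmod (A a b * v b * cnj (v a)) \<le> cmod (A a b) * ?N" if "a < n" "b < n" for a b
  proof -
    have "2 * (cmod (v b) * cmod (v a)) \<le> (cmod (v b))\<^sup>2 + (cmod (v a))\<^sup>2"
      using zero_le_power2[of "cmod (v b) - cmod (v a)"]
      by (simp add: power2_eq_square algebra_simps)
    then have "cmod (v b) * cmod (v a) \<le> ?N"
      using le[OF that(1)] le[OF that(2)] by linarith
    then show ?thesis by (simp add: norm_mult mult.assoc mult_left_mono)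
  qed
  then have "(\<Sum>a<n. \<Sum>b<n. cmod (A a b * v b * cnj (v a))) \<le> (\<Sum>a<n. \<Sum>b<n. cmod (A a b) * ?N)"
    by (intro sum_mono) simp
  then have *: "(\<Sum>a<n. \<Sum>b<n. cmod (A a b * v b * cnj (v a)))
      \<le> (\<Sum>a<n. \<Sum>b<n. cmod (A a b)) * ?N"
    by (simp only: sum_distrib_right)
  have "Re (\<Sum>a<n. \<Sum>b<n. A a b * v b * cnj (v a))
      \<le> cmod (\<Sum>a<n. \<Sum>b<n. A a b * v b * cnj (v a))"
    by (rule complex_Re_le_cmod)
  also have "\<dots> \<le> (\<Sum>a<n. \<Sum>b<n. cmod (A a b * v b * cnj (v a)))"
    by (rule order_trans[OF norm_sum sum_mono]) (rule norm_sum)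
  finally show ?thesis using * by linarith
qed

lemma congr_scale_left:
  assumes "vector_space sc"
  shows "congr sc n k (\<lambda>p i. complex_of_real t * X p i) A = msc sc (complex_of_real (t\<^sup>2)) (congr sc n k X A)"
proof -
  interpret vector_space sc by fact
  show ?thesis
    unfolding congr_def msc_def
    by (intro ext) (auto simp: scale_sum_right power2_eq_square ac_simps intro!: sum.cong)
qed

lemma congr_msc:
  assumes "vector_space sc"
  shows "congr sc n k X (msc sc c A) = msc sc c (congr sc n k X A)"
proof -
  interpret vector_space sc by fact
  show ?thesis
    unfolding congr_def msc_def
    by (intro ext) (auto simp: scale_sum_right ac_simps intro!: sum.cong)
qed

lemma congr_zero_left:
  assumes "vector_space sc"
  shows "congr sc n k (\<lambda>p i. 0) A = (\<lambda>i j. 0)"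
proof -
  interpret vector_space sc by fact
  show ?thesis by (intro ext) (simp add: congr_def)
qed

text \<open>The norm of X enters through a number c with |X v|^2 <= c |v|^2 for all v, that is, X* X
  <= c. This form matches the inequality in \<open>pair_bounds\<close> and avoids the supremum in
  \<open>cmat_norm\<close>.\<close>

locale contractive_gauge = vector_space sc for sc :: "complex \<Rightarrow> 'z::ab_group_add \<Rightarrow> 'z" +
  fixes \<nu> :: "nat \<Rightarrow> (nat \<Rightarrow> nat \<Rightarrow> 'z) \<Rightarrow> real"
  assumes nonneg: "n \<ge> 1 \<Longrightarrow> A \<in> mat n \<Longrightarrow> 0 \<le> \<nu> n A"
    and dsum_le: "n \<ge> 1 \<Longrightarrow> m \<ge> 1 \<Longrightarrow> A \<in> mat n \<Longrightarrow> B \<in> mat m \<Longrightarrow>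
      \<nu> (n + m) (dsum n A B) \<le> max (\<nu> n A) (\<nu> m B)"
    and congr_le: "n \<ge> 1 \<Longrightarrow> k \<ge> 1 \<Longrightarrow> X \<in> rect n k \<Longrightarrow> A \<in> mat n \<Longrightarrow> c \<ge> 0 \<Longrightarrow>
      (\<And>v. (\<Sum>p<n. (cmod (\<Sum>i<k. X p i * v i))\<^sup>2) \<le> c * (\<Sum>i<k. (cmod (v i))\<^sup>2)) \<Longrightarrow>
      \<nu> k (congr sc n k X A) \<le> c * \<nu> n A"
begin

lemma vs: "vector_space sc" ..

lemma zero_mat: "(\<lambda>i j. 0) \<in> mat n"
  by (simp add: rect_def)

lemma gauge_zero:
  assumes "n \<ge> 1"
  shows "\<nu> n (\<lambda>i j. 0) = 0"
proof -
  have "\<nu> n (congr sc n n (\<lambda>p i. 0) (\<lambda>i j. 0)) \<le> 0 * \<nu> n (\<lambda>i j. 0)"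
    using assms by (intro congr_le) (auto simp: rect_def)
  then show ?thesis
    using nonneg[OF assms zero_mat] by (simp add: congr_zero_left[OF vs])
qed

lemma gauge_scale_le:
  assumes "n \<ge> 1" "A \<in> mat n" "t \<ge> 0"
  shows "\<nu> n (msc sc (complex_of_real t) A) \<le> t * \<nu> n A"
proof -
  have "\<nu> n (congr sc n n (dmat n (complex_of_real (sqrt t))) A) \<le> t * \<nu> n A"
    using assms
    by (intro congr_le)
      (auto simp: dmat_rect dmat_apply norm_mult power_mult_distrib sum_distrib_left)
  moreover have "cnj (complex_of_real (sqrt t)) * complex_of_real (sqrt t) = complex_of_real t"
    using assms(3) by (simp add: of_real_mult[symmetric] del: of_real_mult)
  ultimately show ?thesis
    unfolding congr_dmat[OF vs assms(2)] by simp
qed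

text \<open>The real number \<open>c\<close> bounds the pair \<open>(A, y)\<close> if \<open>y = X\<^sup>* z X\<close> on the \<open>n \<times> n\<close> entries, where
  \<open>\<nu> z \<le> 1\<close> and \<open>A + X\<^sup>* X \<le> c\<close>.  A functional \<open>(p, f)\<close> below the infimum of these bounds consists of
  a state \<open>p\<close> and a functional \<open>f\<close> with \<open>f (X\<^sup>* z X) \<le> p (X\<^sup>* X)\<close>.\<close>

definition pair_bounds :: "nat \<Rightarrow> (nat \<Rightarrow> nat \<Rightarrow> complex) \<times> (nat \<Rightarrow> nat \<Rightarrow> 'z) \<Rightarrow> real set" where
  "pair_bounds n x = {c. \<exists>m X z. m \<ge> 1 \<and> X \<in> rect m n \<and> z \<in> mat m \<and> \<nu> m z \<le> 1 \<and>
     (\<forall>a<n. \<forall>b<n. snd x a b = congr sc m n X z a b) \<and>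
     (\<forall>v. Re (\<Sum>a<n. \<Sum>b<n. fst x a b * v b * cnj (v a)) + (\<Sum>p<m. (cmod (\<Sum>a<n. X p a * v a))\<^sup>2)
       \<le> c * (\<Sum>a<n. (cmod (v a))\<^sup>2))}"

definition pair_scale :: "real \<Rightarrow> (nat \<Rightarrow> nat \<Rightarrow> complex) \<times> (nat \<Rightarrow> nat \<Rightarrow> 'z)
    \<Rightarrow> (nat \<Rightarrow> nat \<Rightarrow> complex) \<times> (nat \<Rightarrow> nat \<Rightarrow> 'z)" where
  "pair_scale t x = ((\<lambda>a b. complex_of_real t * fst x a b), (\<lambda>a b. sc (complex_of_real t) (snd x a b)))"

lemma pair_boundsI:
  assumes "m \<ge> 1" "X \<in> rect m n" "z \<in> mat m" "\<nu> m z \<le> 1"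
    "\<And>a b. a < n \<Longrightarrow> b < n \<Longrightarrow> y a b = congr sc m n X z a b"
    "\<And>v. Re (\<Sum>a<n. \<Sum>b<n. A a b * v b * cnj (v a)) + (\<Sum>p<m. (cmod (\<Sum>a<n. X p a * v a))\<^sup>2)
       \<le> c * (\<Sum>a<n. (cmod (v a))\<^sup>2)"
  shows "c \<in> pair_bounds n (A, y)"
  unfolding pair_bounds_def using assms by auto

lemma pair_boundsE:
  assumes "c \<in> pair_bounds n (A, y)"
  obtains m X z where "m \<ge> 1" "X \<in> rect m n" "z \<in> mat m" "\<nu> m z \<le> 1"
    "\<And>a b. a < n \<Longrightarrow> b < n \<Longrightarrow> y a b = congr sc m n X z a b"
    "\<And>v. Re (\<Sum>a<n. \<Sum>b<n. A a b * v b * cnj (v a)) + (\<Sum>p<m. (cmod (\<Sum>a<n. X p a * v a))\<^sup>2)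
       \<le> c * (\<Sum>a<n. (cmod (v a))\<^sup>2)"
  using assms unfolding pair_bounds_def by auto

lemma pair_scale_vector_space: "vector_space pair_scale"
  by unfold_locales
    (simp_all add: pair_scale_def prod_eq_iff fun_eq_iff scale_right_distrib scale_left_distrib
      distrib_left distrib_right)

text \<open>Testing on the first unit vector gives a lower bound independent of the witnesses m, X,
  z, so the infimum over \<open>pair_bounds\<close> is finite. For A = 0 it says c >= 0.\<close>

lemma pair_bounds_ge:
  assumes "n \<ge> 1" "c \<in> pair_bounds n (A, y)"
  shows "Re (A 0 0) \<le> c"
proof -
  obtain m X z where "m \<ge> 1" "X \<in> rect m n" "z \<in> mat m" "\<nu> m z \<le> 1"
    "\<And>a b. a < n \<Longrightarrow> b < n \<Longrightarrow> y a b = congr sc m n X z a b"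
    and *: "\<And>v. Re (\<Sum>a<n. \<Sum>b<n. A a b * v b * cnj (v a))
      + (\<Sum>p<m. (cmod (\<Sum>a<n. X p a * v a))\<^sup>2) \<le> c * (\<Sum>a<n. (cmod (v a))\<^sup>2)"
    using pair_boundsE[OF assms(2)] by blast
  let ?v = "\<lambda>a::nat. if a = 0 then 1 else (0::complex)"
  have "A a b * ?v b * cnj (?v a) = (if b = 0 then if a = 0 then A a b else 0 else 0)" for a b
    by simp
  then have form: "(\<Sum>a<n. \<Sum>b<n. A a b * ?v b * cnj (?v a)) = A 0 0"
    using assms(1) by simp
  have "(cmod (?v a))\<^sup>2 = (if a = 0 then 1 else 0)" for a
    by simp
  then have norm: "(\<Sum>a<n. (cmod (?v a))\<^sup>2) = 1"
    using assms(1) by simp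
  have "(\<Sum>p<m. (cmod (\<Sum>a<n. X p a * ?v a))\<^sup>2) \<ge> 0"
    by (intro sum_nonneg) simp
  then show ?thesis using *[of ?v] unfolding form norm by linarith
qed

lemma pair_bounds_nonempty:
  assumes "n \<ge> 1"
  shows "pair_bounds n (A, y) \<noteq> {}"
proof -
  \<comment> \<open>The pair consists of arbitrary functions, so \<open>y\<close> is first cut down
    to its n x n corner.\<close>
  define y' where "y' = (\<lambda>i j. if i < n \<and> j < n then y i j else 0)"
  have y': "y' \<in> mat n" by (auto simp: y'_def rect_def)
  \<comment> \<open>With X = sqrt c times the identity and z = y'/c, one has X* z X = y' and the
    gauge of z is at most 1; adding 1 keeps \<open>c\<close> positive.\<close>
  define c where "c = \<nu> n y' + 1"
  have c: "c > 0" using nonneg[OF assms y'] by (simp add: c_def)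
  have "\<nu> n (msc sc (complex_of_real (1 / c)) y') \<le> 1 / c * \<nu> n y'"
    using c by (intro gauge_scale_le assms y') simp
  also have "\<dots> \<le> 1" using c by (simp add: field_simps) (simp add: c_def)
  finally have le1: "\<nu> n (msc sc (complex_of_real (1 / c)) y') \<le> 1" .
  have "(\<Sum>a<n. \<Sum>b<n. cmod (A a b)) + c \<in> pair_bounds n (A, y)"
  proof (rule pair_boundsI[OF assms dmat_rect msc_mat[OF vs y'] le1])
    fix a b assume "a < n" "b < n"
    have "cnj (complex_of_real (sqrt c)) * complex_of_real (sqrt c) = complex_of_real c"
      using c by (simp add: of_real_mult[symmetric] del: of_real_mult)
    then show "y a b = congr sc n n (dmat n (complex_of_real (sqrt c))) (msc sc (complex_of_real (1 / c)) y') a b"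
      unfolding congr_dmat[OF vs msc_mat[OF vs y']]
      using c \<open>a < n\<close> \<open>b < n\<close> by (simp add: msc_def y'_def)
  next
    fix v
    show "Re (\<Sum>a<n. \<Sum>b<n. A a b * v b * cnj (v a))
        + (\<Sum>p<n. (cmod (\<Sum>a<n. dmat n (complex_of_real (sqrt c)) p a * v a))\<^sup>2)
       \<le> ((\<Sum>a<n. \<Sum>b<n. cmod (A a b)) + c) * (\<Sum>a<n. (cmod (v a))\<^sup>2)"
      using quadratic_form_bound[where A = A and n = n and v = v] c
      by (simp add: dmat_apply norm_mult power_mult_distrib sum_distrib_left[symmetric] distrib_right)
  qed
  then show ?thesis by blast
qed

text \<open>The witnesses are stacked: X over Y, and \<open>dsum m z w\<close>. The gauge stays at
  most 1 because a direct sum costs only the maximum, while the two quadratic forms add.\<close>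

lemma pair_bounds_add:
  assumes "c \<in> pair_bounds n x" "d \<in> pair_bounds n x'"
  shows "c + d \<in> pair_bounds n (x + x')"
proof -
  obtain A y A' y' where x: "x = (A, y)" "x' = (A', y')" by (metis surj_pair)
  obtain m X z where X: "m \<ge> 1" "X \<in> rect m n" "z \<in> mat m" "\<nu> m z \<le> 1"
    "\<And>a b. a < n \<Longrightarrow> b < n \<Longrightarrow> y a b = congr sc m n X z a b"
    "\<And>v. Re (\<Sum>a<n. \<Sum>b<n. A a b * v b * cnj (v a)) + (\<Sum>p<m. (cmod (\<Sum>a<n. X p a * v a))\<^sup>2)
       \<le> c * (\<Sum>a<n. (cmod (v a))\<^sup>2)"
    using pair_boundsE[OF assms(1)[unfolded x]] by blast
  obtain k Y w where Y: "k \<ge> 1" "Y \<in> rect k n" "w \<in> mat k" "\<nu> k w \<le> 1"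
    "\<And>a b. a < n \<Longrightarrow> b < n \<Longrightarrow> y' a b = congr sc k n Y w a b"
    "\<And>v. Re (\<Sum>a<n. \<Sum>b<n. A' a b * v b * cnj (v a)) + (\<Sum>p<k. (cmod (\<Sum>a<n. Y p a * v a))\<^sup>2)
       \<le> d * (\<Sum>a<n. (cmod (v a))\<^sup>2)"
    using pair_boundsE[OF assms(2)[unfolded x]] by blast
  have "c + d \<in> pair_bounds n (A + A', y + y')"
  proof (rule pair_boundsI)
    show "m + k \<ge> 1" using X(1) by simp
    show "stack m X Y \<in> rect (m + k) n" by (rule stack_rect[OF X(2) Y(2)])
    show "dsum m z w \<in> mat (m + k)" by (rule dsum_mat[OF X(3) Y(3)])
    show "\<nu> (m + k) (dsum m z w) \<le> 1"
      using dsum_le[OF X(1) Y(1) X(3) Y(3)] X(4) Y(4) by simp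
    show "(y + y') a b = congr sc (m + k) n (stack m X Y) (dsum m z w) a b" if "a < n" "b < n" for a b
      using X(5)[OF that] Y(5)[OF that] by (simp add: congr_stack_dsum[OF vs] madd_def)
    show "Re (\<Sum>a<n. \<Sum>b<n. (A + A') a b * v b * cnj (v a))
        + (\<Sum>p<m + k. (cmod (\<Sum>a<n. stack m X Y p a * v a))\<^sup>2)
       \<le> (c + d) * (\<Sum>a<n. (cmod (v a))\<^sup>2)" for v
      using X(6)[of v] Y(6)[of v]
      by (simp add: sum_lessThan_add stack_def distrib_right sum.distrib)
  qed
  then show ?thesis by (simp add: x)
qed

text \<open>The scalar goes into X as sqrt t and leaves z alone, so the constraint on the gauge of z
  is preserved.\<close>

lemma pair_bounds_scale:
  assumes "t > 0" "c \<in> pair_bounds n x"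
  shows "t * c \<in> pair_bounds n (pair_scale t x)"
proof -
  obtain A y where x: "x = (A, y)" by (metis surj_pair)
  obtain m X z where X: "m \<ge> 1" "X \<in> rect m n" "z \<in> mat m" "\<nu> m z \<le> 1"
    "\<And>a b. a < n \<Longrightarrow> b < n \<Longrightarrow> y a b = congr sc m n X z a b"
    "\<And>v. Re (\<Sum>a<n. \<Sum>b<n. A a b * v b * cnj (v a)) + (\<Sum>p<m. (cmod (\<Sum>a<n. X p a * v a))\<^sup>2)
       \<le> c * (\<Sum>a<n. (cmod (v a))\<^sup>2)"
    using pair_boundsE[OF assms(2)[unfolded x]] by blast
  have "t * c \<in> pair_bounds n (\<lambda>a b. complex_of_real t * A a b, \<lambda>a b. sc (complex_of_real t) (y a b))"
  proof (rule pair_boundsI[OF X(1) _ X(3,4)])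
    show "(\<lambda>p a. complex_of_real (sqrt t) * X p a) \<in> rect m n"
      using X(2) by (simp add: rect_def)
    show "sc (complex_of_real t) (y a b)
        = congr sc m n (\<lambda>p a. complex_of_real (sqrt t) * X p a) z a b" if "a < n" "b < n" for a b
      using X(5)[OF that] assms(1) by (simp add: congr_scale_left[OF vs] msc_def)
    fix v
    have "(\<Sum>a<n. \<Sum>b<n. complex_of_real t * A a b * v b * cnj (v a))
        = complex_of_real t * (\<Sum>a<n. \<Sum>b<n. A a b * v b * cnj (v a))"
      by (simp add: sum_distrib_left mult.assoc)
    moreover have "(\<Sum>a<n. complex_of_real (sqrt t) * X p a * v a)
        = complex_of_real (sqrt t) * (\<Sum>a<n. X p a * v a)" for p
      by (simp add: sum_distrib_left mult.assoc)
    ultimately show "Re (\<Sum>a<n. \<Sum>b<n. complex_of_real t * A a b * v b * cnj (v a))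
        + (\<Sum>p<m. (cmod (\<Sum>a<n. complex_of_real (sqrt t) * X p a * v a))\<^sup>2)
       \<le> t * c * (\<Sum>a<n. (cmod (v a))\<^sup>2)"
      using mult_left_mono[OF X(6)[of v], of t] assms(1)
      by (simp add: norm_mult power_mult_distrib sum_distrib_left[symmetric] algebra_simps)
  qed
  then show ?thesis by (simp add: x pair_scale_def)
qed

text \<open>Three kinds of pairs give the inequalities. The pair (-X* X, X* z X) has bound 0, whence
  f(X* z X) <= p(X* X). The pair (A, 0), with X = 0, has bound c as soon as the form of A is at most
  c. Any bound c of (0, z0) comes with X* X <= c, so the congruence axiom gives \<nu>(z0) <= c, and
  Hahn--Banach attains the infimum of these c at (0, z0).\<close>

lemma ex_state:
  assumes n: "n \<ge> 1" and z0: "z0 \<in> mat n"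
  obtains p :: "(nat \<Rightarrow> nat \<Rightarrow> complex) \<Rightarrow> real" and f :: "(nat \<Rightarrow> nat \<Rightarrow> 'z) \<Rightarrow> real"
  where "\<And>A A'. p (A + A') = p A + p A'" "\<And>t A. p (\<lambda>a b. complex_of_real t * A a b) = t * p A"
    "\<And>y y'. f (y + y') = f y + f y'" "\<And>t y. f (\<lambda>a b. sc (complex_of_real t) (y a b)) = t * f y"
    "\<And>m X z. m \<ge> 1 \<Longrightarrow> X \<in> rect m n \<Longrightarrow> z \<in> mat m \<Longrightarrow> \<nu> m z \<le> 1 \<Longrightarrow>
      f (congr sc m n X z) \<le> p (\<lambda>a b. \<Sum>k<m. cnj (X k a) * X k b)"
    "\<And>A c. (\<And>v. Re (\<Sum>a<n. \<Sum>b<n. A a b * v b * cnj (v a)) \<le> c * (\<Sum>a<n. (cmod (v a))\<^sup>2)) \<Longrightarrow> p A \<le> c"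
    "\<nu> n z0 \<le> f z0"
proof -
  define q where "q x = Inf (pair_bounds n x)" for x
  have ne: "pair_bounds n x \<noteq> {}" for x
    using pair_bounds_nonempty[OF n] by (cases x) simp
  have bdd: "bdd_below (pair_bounds n x)" for x
  proof (cases x)
    case (Pair A y)
    show ?thesis
      unfolding Pair by (rule bdd_belowI[of _ "Re (A 0 0)"]) (rule pair_bounds_ge[OF n])
  qed
  have "sublinear pair_scale q"
    unfolding q_def
    by (rule sublinear_Inf[OF ne bdd pair_bounds_add pair_bounds_scale])
  then obtain g where g: "\<And>x y. g (x + y) = g x + g y" "\<And>t x. g (pair_scale t x) = t * g x"
      "\<And>x. g x \<le> q x" "g (0, z0) = q (0, z0)"
    using Hahn_Banach_sublinear[OF pair_scale_vector_space] by metis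
  have gle: "g x \<le> c" if "c \<in> pair_bounds n x" for x c
    using g(3)[of x] cInf_lower[OF that bdd] by (simp add: q_def)
  define p where "p A = g (A, 0)" for A
  define f where "f y = g (0, y)" for y
  show ?thesis
  proof (rule that[of p f])
    show "p (A + A') = p A + p A'" for A A'
      using g(1)[of "(A, 0)" "(A', 0)"] by (simp add: p_def)
    show "f (y + y') = f y + f y'" for y y'
      using g(1)[of "(0, y)" "(0, y')"] by (simp add: f_def)
    show "p (\<lambda>a b. complex_of_real t * A a b) = t * p A" for t A
      using g(2)[of t "(A, 0)"] by (simp add: p_def pair_scale_def zero_fun_def)
    show "f (\<lambda>a b. sc (complex_of_real t) (y a b)) = t * f y" for t y
      using g(2)[of t "(0, y)"] by (simp add: f_def pair_scale_def zero_fun_def)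
    show "f (congr sc m n X z) \<le> p (\<lambda>a b. \<Sum>k<m. cnj (X k a) * X k b)"
      if X: "m \<ge> 1" "X \<in> rect m n" "z \<in> mat m" "\<nu> m z \<le> 1" for m X z
    proof -
      let ?A = "\<lambda>a b. \<Sum>k<m. cnj (X k a) * X k b"
      have sq: "(\<Sum>a<n. \<Sum>b<n. ?A a b * v b * cnj (v a))
          = complex_of_real (\<Sum>k<m. (cmod (\<Sum>a<n. X k a * v a))\<^sup>2)" for v
      proof -
        have "(\<Sum>a<n. \<Sum>b<n. ?A a b * v b * cnj (v a))
          = (\<Sum>a<n. \<Sum>b<n. \<Sum>k<m. (X k b * v b) * cnj (X k a * v a))"
          unfolding sum_distrib_right by (simp add: ac_simps)
        also have "\<dots> = (\<Sum>a<n. \<Sum>k<m. \<Sum>b<n. (X k b * v b) * cnj (X k a * v a))"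
          by (rule sum.cong[OF refl]) (rule sum.swap)
        also have "\<dots> = (\<Sum>k<m. \<Sum>a<n. \<Sum>b<n. (X k b * v b) * cnj (X k a * v a))"
          by (rule sum.swap)
        also have "\<dots> = (\<Sum>k<m. (\<Sum>b<n. X k b * v b) * cnj (\<Sum>a<n. X k a * v a))"
          unfolding cnj_sum sum_product by (rule sum.cong[OF refl]) (rule sum.swap)
        also have "\<dots> = complex_of_real (\<Sum>k<m. (cmod (\<Sum>a<n. X k a * v a))\<^sup>2)"
          by (simp only: complex_norm_square of_real_sum)
        finally show ?thesis .
      qed
      have "0 \<in> pair_bounds n (\<lambda>a b. - ?A a b, congr sc m n X z)"
        using sq by (intro pair_boundsI[OF X]) (simp_all add: sum_negf)
      then have "g (- ?A, congr sc m n X z) \<le> 0"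
        using gle by (simp add: fun_Compl_def)
      moreover have "g (- ?A, congr sc m n X z) + g (?A, 0) = g (0, congr sc m n X z)"
        using g(1)[of "(- ?A, congr sc m n X z)" "(?A, 0)"] by simp
      ultimately show ?thesis by (simp add: p_def f_def)
    qed
    show "p A \<le> c"
      if A: "\<And>v. Re (\<Sum>a<n. \<Sum>b<n. A a b * v b * cnj (v a)) \<le> c * (\<Sum>a<n. (cmod (v a))\<^sup>2)" for A c
    proof -
      have "c \<in> pair_bounds n (A, \<lambda>i j. 0)"
        using n A by (intro pair_boundsI[where X = "\<lambda>p i. 0" and z = "\<lambda>i j. 0" and m = n])
          (auto simp: rect_def gauge_zero congr_zero_left[OF vs])
      then show ?thesis using gle by (simp add: p_def zero_fun_def)
    qed
    have "\<nu> n z0 \<le> c" if "c \<in> pair_bounds n (\<lambda>a b. 0, z0)" for c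
    proof -
      obtain m X z where X: "m \<ge> 1" "X \<in> rect m n" "z \<in> mat m" "\<nu> m z \<le> 1"
        "\<And>a b. a < n \<Longrightarrow> b < n \<Longrightarrow> z0 a b = congr sc m n X z a b"
        "\<And>v. Re (\<Sum>a<n. \<Sum>b<n. 0 * v b * cnj (v a)) + (\<Sum>p<m. (cmod (\<Sum>a<n. X p a * v a))\<^sup>2)
           \<le> c * (\<Sum>a<n. (cmod (v a))\<^sup>2)"
        using pair_boundsE[OF \<open>c \<in> _\<close>] by blast
      have c: "c \<ge> 0" using pair_bounds_ge[OF n that] by simp
      have "z0 = congr sc m n X z" using X(5) by (intro mat_eqI[OF z0 congr_mat])
      then have "\<nu> n z0 \<le> c * \<nu> m z"
        using congr_le[OF X(1) n X(2,3) c] X(6) by simp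
      also have "\<dots> \<le> c" using mult_left_mono[OF X(4) c] by simp
      finally show ?thesis .
    qed
    then have "\<nu> n z0 \<le> q (\<lambda>a b. 0, z0)"
      unfolding q_def by (intro cInf_greatest ne)
    then show "\<nu> n z0 \<le> f z0"
      using g(4) by (simp add: f_def zero_fun_def)
  qed
qed

end

text \<open>The quadratic form of the amplified matrix \<phi>^(m)(z), with entries \<phi>(z_pq) in
  M_k, at a vector of (C^k)^m whose p-th block is \<open>v p\<close>.\<close>

definition block_form :: "nat \<Rightarrow> nat \<Rightarrow> ('z \<Rightarrow> nat \<Rightarrow> nat \<Rightarrow> complex) \<Rightarrow> (nat \<Rightarrow> nat \<Rightarrow> 'z)
    \<Rightarrow> (nat \<Rightarrow> nat \<Rightarrow> complex) \<Rightarrow> complex" where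
  "block_form m k \<phi> z v = (\<Sum>p<m. \<Sum>q<m. \<Sum>i<k. \<Sum>j<k. cnj (v p i) * \<phi> (z p q) i j * v q j)"

definition block_norm2 :: "nat \<Rightarrow> nat \<Rightarrow> (nat \<Rightarrow> nat \<Rightarrow> complex) \<Rightarrow> real" where
  "block_norm2 m k v = (\<Sum>p<m. \<Sum>i<k. (cmod (v p i))\<^sup>2)"

lemma complex_linear_extension_functional:
  fixes sc :: "complex \<Rightarrow> 'z::ab_group_add \<Rightarrow> 'z" and f :: "(nat \<Rightarrow> nat \<Rightarrow> 'z) \<Rightarrow> real"
  assumes vs: "vector_space sc"
    and "\<And>y y'. f (y + y') = f y + f y'" "\<And>t y. f (\<lambda>a b. sc (complex_of_real t) (y a b)) = t * f y"
  obtains F where "\<And>y y'. F (\<lambda>a b. y a b + y' a b) = F y + F y'"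
    "\<And>c y. F (\<lambda>a b. sc c (y a b)) = c * F y" "\<And>y. Re (F y) = f y"
proof -
  interpret vector_space sc by fact
  have "vector_space (\<lambda>c y a b. sc c (y a b))"
    by unfold_locales (simp_all add: fun_eq_iff scale_right_distrib scale_left_distrib)
  from complexify_functional[of "\<lambda>c y a b. sc c (y a b)" f, OF this assms(2,3)]
  obtain F where "\<And>y y'. F (y + y') = F y + F y'"
    "\<And>c y. F (\<lambda>a b. sc c (y a b)) = c * F y" "\<And>y. Re (F y) = f y" by blast
  then show ?thesis by (intro that[of F]) (simp_all add: plus_fun_def)
qed

lemma vector_space_times: "vector_space ((*) :: complex \<Rightarrow> complex \<Rightarrow> complex)"
  by unfold_locales (simp_all add: algebra_simps)

text \<open>Parseval's identity; it converts the form \<open>B\<close> on combinations of the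
  \<open>e i\<close> into the Euclidean norm of their coefficients.\<close>

lemma orthonormal_expansion:
  fixes B :: "(nat \<Rightarrow> complex) \<Rightarrow> (nat \<Rightarrow> complex) \<Rightarrow> complex" and n :: nat
  assumes add: "\<And>x y z. B x (\<lambda>a. y a + z a) = B x y + B x z"
    and scale: "\<And>c x y. B x (\<lambda>a. c * y a) = c * B x y"
    and herm: "\<And>x y. B y x = cnj (B x y)"
    and orth: "\<And>i j. i < n \<Longrightarrow> j < n \<Longrightarrow> B (e i) (e j) = (if i = j then 1 else 0)"
  shows "B (\<lambda>a. \<Sum>i<n. c i * e i a) (\<lambda>a. \<Sum>i<n. c i * e i a) = complex_of_real (\<Sum>i<n. (cmod (c i))\<^sup>2)"
proof -
  let ?x = "\<lambda>a. \<Sum>i<n. c i * e i a"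
  have B0: "B x (\<lambda>a. 0) = 0" for x using scale[of x 0 "\<lambda>a. 0"] by simp
  have Bsum: "B x (\<lambda>a. \<Sum>i\<in>I. c i * e i a) = (\<Sum>i\<in>I. c i * B x (e i))" if "finite I" for x I
    using that by (induction I rule: finite_induct) (simp_all add: add scale B0)
  have "B (e j) ?x = c j" if "j < n" for j
  proof -
    have "(\<Sum>i<n. c i * B (e j) (e i)) = (\<Sum>i<n. if i = j then c i else 0)"
      using orth that by (intro sum.cong) auto
    then show ?thesis using that unfolding Bsum[OF finite_lessThan] by simp
  qed
  then have "B ?x (e j) = cnj (c j)" if "j < n" for j
    using herm[of ?x "e j"] that by simp
  then have "(\<Sum>i<n. c i * B ?x (e i)) = (\<Sum>i<n. c i * cnj (c i))"
    by (intro sum.cong) auto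
  then show ?thesis
    unfolding Bsum[OF finite_lessThan] of_real_sum complex_norm_square .
qed

section \<open>Matrix states from Hahn--Banach functionals\<close>

context contractive_gauge
begin

text \<open>The last clause is Re \<phi>^(m)(z) <= \<nu>_m(z), written as quadratic forms on
  (C^k)^m. Entries with an index >= k are arbitrary linear functionals; a state thus has many
  representatives, which merely repeats summands in the direct sum.\<close>

definition matrix_states :: "nat \<Rightarrow> ('z \<Rightarrow> nat \<Rightarrow> nat \<Rightarrow> complex) set" where
  "matrix_states k = {\<phi>. (\<forall>x y i j. \<phi> (x + y) i j = \<phi> x i j + \<phi> y i j) \<and>
     (\<forall>c x i j. \<phi> (sc c x) i j = c * \<phi> x i j) \<and>
     (\<forall>m\<ge>1. \<forall>z\<in>mat m. \<forall>v. Re (block_form m k \<phi> z v) \<le> \<nu> m z * block_norm2 m k v)}"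

text \<open>For a matrix Y whose rows are combinations of the e_i with coefficients v, the amplified
  form at v is F(Y* z Y). Its real part is at most \<nu>(z) p(Y* Y), and p(Y* Y) is at most the sum
  of \<open>B\<close> over the rows, which is the squared Euclidean norm of v. The v for which Y is
  the identity recovers f(z0).\<close>

lemma ex_matrix_state:
  assumes n: "n \<ge> 1" and z0: "z0 \<in> mat n" and d: "d > 0"
  obtains \<phi> v where "\<phi> \<in> matrix_states n" "\<nu> n z0 \<le> Re (block_form n n \<phi> z0 v)" "block_norm2 n n v \<le> 1 + d"
proof -
  obtain p :: "(nat \<Rightarrow> nat \<Rightarrow> complex) \<Rightarrow> real" and f :: "(nat \<Rightarrow> nat \<Rightarrow> 'z) \<Rightarrow> real"
    where padd: "\<And>A A'. p (A + A') = p A + p A'"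
    and pscale: "\<And>t A. p (\<lambda>a b. complex_of_real t * A a b) = t * p A"
    and fadd: "\<And>y y'. f (y + y') = f y + f y'"
    and fscale: "\<And>t y. f (\<lambda>a b. sc (complex_of_real t) (y a b)) = t * f y"
    and fp1: "\<And>m X z. m \<ge> 1 \<Longrightarrow> X \<in> rect m n \<Longrightarrow> z \<in> mat m \<Longrightarrow> \<nu> m z \<le> 1 \<Longrightarrow>
      f (congr sc m n X z) \<le> p (\<lambda>a b. \<Sum>k<m. cnj (X k a) * X k b)"
    and pbound: "\<And>A c. (\<And>v. Re (\<Sum>a<n. \<Sum>b<n. A a b * v b * cnj (v a)) \<le> c * (\<Sum>a<n. (cmod (v a))\<^sup>2)) \<Longrightarrow> p A \<le> c"
    and fz0: "\<nu> n z0 \<le> f z0"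
    using ex_state[OF n z0] by blast
  obtain F where Fadd: "\<And>y y'. F (\<lambda>a b. y a b + y' a b) = F y + F y'"
    and Fscale: "\<And>c y. F (\<lambda>a b. sc c (y a b)) = c * F y" and ReF: "\<And>y. Re (F y) = f y"
    using complex_linear_extension_functional[OF vs fadd fscale] by blast
  obtain P where Padd: "\<And>y y'. P (\<lambda>a b. y a b + y' a b) = P y + P y'"
    and Pscale: "\<And>c y. P (\<lambda>a b. c * (y a b)) = c * P y" and ReP: "\<And>y. Re (P y) = p y"
    using complex_linear_extension_functional[OF vector_space_times padd pscale] by blast
  have pminus: "p (\<lambda>a b. - A a b) = - p A" for A
    using pscale[of "-1" A] by simp
  have psum: "p (\<lambda>a b. \<Sum>k\<in>K. g k a b) = (\<Sum>k\<in>K. p (g k))" for g and K :: "nat set"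
    using padd by (intro additive_sum) (simp add: plus_fun_def)
  have form: "(\<Sum>a<n. \<Sum>b<n. cnj (x a) * x b * v b * cnj (v a))
      = complex_of_real ((cmod (\<Sum>a<n. x a * v a))\<^sup>2)" for x v :: "nat \<Rightarrow> complex"
  proof -
    have "(\<Sum>a<n. \<Sum>b<n. cnj (x a) * x b * v b * cnj (v a))
      = (\<Sum>a<n. cnj (x a * v a)) * (\<Sum>b<n. x b * v b)"
      unfolding sum_product by (intro sum.cong refl) (simp add: ac_simps)
    then show ?thesis
      by (simp only: complex_norm_square cnj_sum[symmetric] mult.commute)
  qed
  have ppos: "0 \<le> p (\<lambda>a b. cnj (x a) * x b)" for x
  proof -
    have "p (\<lambda>a b. - (cnj (x a) * x b)) \<le> 0"
      using form[of x] by (intro pbound) (simp add: sum_negf del: of_real_power)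
    then show ?thesis by (simp add: pminus)
  qed
  \<comment> \<open>The form of i x* x is purely imaginary, so p is at most 0 on it and on its
    negative; this makes P(x* x) real.\<close>
  have pimag: "p (\<lambda>a b. s * \<i> * (cnj (x a) * x b)) \<le> 0" if "s \<in> \<real>" for x s
  proof (rule pbound)
    fix v
    have "(\<Sum>a<n. \<Sum>b<n. s * \<i> * (cnj (x a) * x b) * v b * cnj (v a))
       = s * \<i> * complex_of_real ((cmod (\<Sum>a<n. x a * v a))\<^sup>2)"
      unfolding form[symmetric] by (simp add: sum_distrib_left mult.assoc)
    then show "Re (\<Sum>a<n. \<Sum>b<n. s * \<i> * (cnj (x a) * x b) * v b * cnj (v a)) \<le> 0 * (\<Sum>a<n. (cmod (v a))\<^sup>2)"
      using that by (auto elim!: Reals_cases)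
  qed
  have Preal: "Im (P (\<lambda>a b. cnj (x a) * x b)) = 0" for x
  proof -
    have "Im (P (\<lambda>a b. cnj (x a) * x b)) = - p (\<lambda>a b. \<i> * (cnj (x a) * x b))"
      using ReP[of "\<lambda>a b. \<i> * (cnj (x a) * x b)"] by (simp only: Pscale) simp
    moreover have "p (\<lambda>a b. \<i> * (cnj (x a) * x b)) \<le> 0"
      using pimag[of 1 x] by simp
    moreover have "- p (\<lambda>a b. \<i> * (cnj (x a) * x b)) \<le> 0"
      using pimag[of "-1" x] by (simp add: pminus)
    ultimately show ?thesis by simp
  qed
  \<comment> \<open>The second term makes \<open>B\<close> definite where p may vanish. Summed over
    the n unit vectors, the factor d / n contributes exactly d, the loss in the conclusion.\<close>
  define B where "B x y = P (\<lambda>a b. cnj (x a) * y b) + complex_of_real (d / n) * (\<Sum>a<n. cnj (x a) * y a)"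
    for x y :: "nat \<Rightarrow> complex"
  have Badd: "B x (\<lambda>a. y a + z a) = B x y + B x z" for x y z
    using Padd[of "\<lambda>a b. cnj (x a) * y b" "\<lambda>a b. cnj (x a) * z b"]
    by (simp add: B_def distrib_left sum.distrib)
  have Bscale: "B x (\<lambda>a. c * y a) = c * B x y" for c x y
    using Pscale[of c "\<lambda>a b. cnj (x a) * y b"]
    by (simp add: B_def distrib_left sum_distrib_left mult.left_commute)
  have Badd': "B (\<lambda>a. y a + z a) x = B y x + B z x" for x y z
    using Padd[of "\<lambda>a b. cnj (y a) * x b" "\<lambda>a b. cnj (z a) * x b"]
    by (simp add: B_def distrib_left distrib_right sum.distrib)
  have Bscale': "B (\<lambda>a. c * y a) x = cnj c * B y x" for c x y
    using Pscale[of "cnj c" "\<lambda>a b. cnj (y a) * x b"]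
    by (simp add: B_def distrib_left sum_distrib_left mult.assoc mult.left_commute)
  have Bself: "B x x = complex_of_real (p (\<lambda>a b. cnj (x a) * x b) + d / n * (\<Sum>a<n. (cmod (x a))\<^sup>2))" for x
  proof -
    have "P (\<lambda>a b. cnj (x a) * x b) = complex_of_real (p (\<lambda>a b. cnj (x a) * x b))"
      using Preal[of x] ReP by (simp add: complex_eq_iff)
    moreover have "(\<Sum>a<n. cnj (x a) * x a) = complex_of_real (\<Sum>a<n. (cmod (x a))\<^sup>2)"
      by (simp only: of_real_sum complex_norm_square mult.commute)
    ultimately show ?thesis by (simp add: B_def)
  qed
  \<comment> \<open>Polarization: the diagonal of \<open>B\<close> is real, and its values at x + y
    and at x + i y yield the imaginary and the real part of the symmetry.\<close>
  have Bherm: "B y x = cnj (B x y)" for x y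
  proof -
    have im: "Im (B x x) = 0" for x by (simp add: Bself)
    have "Im (B (\<lambda>a. x a + y a) (\<lambda>a. x a + y a)) = Im (B x x) + Im (B y y) + Im (B x y) + Im (B y x)"
      by (simp add: Badd Badd')
    moreover have "Im (B (\<lambda>a. x a + \<i> * y a) (\<lambda>a. x a + \<i> * y a))
        = Im (B x x) + Im (B y y) + Re (B x y) - Re (B y x)"
      by (simp add: Badd Badd' Bscale Bscale')
    ultimately show ?thesis using im by (simp add: complex_eq_iff)
  qed
  have Bpos: "Re (B x x) > 0" if ex: "\<exists>a<n. x a \<noteq> 0" for x
  proof -
    obtain a where a: "a < n" "x a \<noteq> 0" using ex by blast
    have "(cmod (x a))\<^sup>2 \<le> (\<Sum>a<n. (cmod (x a))\<^sup>2)"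
      using a(1) by (intro member_le_sum) auto
    moreover have "(cmod (x a))\<^sup>2 > 0" using a(2) by simp
    ultimately have "(\<Sum>a<n. (cmod (x a))\<^sup>2) > 0" by linarith
    then have "d / n * (\<Sum>a<n. (cmod (x a))\<^sup>2) > 0" using d n by simp
    then show ?thesis using ppos[of x] unfolding Bself Re_complex_of_real by linarith
  qed
  have "\<exists>e. (\<forall>i<n. \<forall>a\<ge>n. e i a = 0) \<and> (\<forall>i<n. \<forall>j<n. B (e i) (e j) = (if i = j then 1 else 0)) \<and>
    (\<forall>x. (\<forall>a\<ge>n. x a = 0) \<longrightarrow> (\<exists>c. \<forall>a. x a = (\<Sum>i<n. c i * e i a)))"
    by (rule gram_schmidt[of B n n, OF Badd Bscale Bherm _ order_refl]) (rule Bpos)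
  then obtain e where e: "\<forall>i<n. \<forall>a\<ge>n. e i a = 0"
    "\<forall>i<n. \<forall>j<n. B (e i) (e j) = (if i = j then 1 else 0)"
    "\<forall>x. (\<forall>a\<ge>n. x a = 0) \<longrightarrow> (\<exists>c. \<forall>a. x a = (\<Sum>i<n. c i * e i a))"
    by (elim exE conjE)
  have esupp: "e i a = 0" if "i < n" "a \<ge> n" for i a using e(1) that by blast
  have orth: "B (e i) (e j) = (if i = j then 1 else 0)" if "i < n" "j < n" for i j
    using e(2) that by blast
  have span: "\<exists>c. \<forall>a. x a = (\<Sum>i<n. c i * e i a)" if "\<forall>a\<ge>n. x a = 0" for x
    using e(3) that by blast
  define \<phi> where "\<phi> z i j = F (\<lambda>a b. sc (cnj (e i a) * e j b) z)" for z i j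
  define Y where "Y m v = (\<lambda>p a. if p < m then \<Sum>i<n. v p i * e i a else 0)"
    for m :: nat and v :: "nat \<Rightarrow> nat \<Rightarrow> complex"
  have Yrect: "Y m v \<in> rect m n" for m v
    using esupp by (auto simp: Y_def rect_def)
  have Bsum: "(\<Sum>k<m. Re (B (Y m v k) (Y m v k))) = block_norm2 m n v" for m v
  proof -
    have "B (Y m v k) (Y m v k) = complex_of_real (\<Sum>i<n. (cmod (v k i))\<^sup>2)" if "k < m" for k
    proof -
      have "Y m v k = (\<lambda>a. \<Sum>i<n. v k i * e i a)" using that by (simp add: Y_def)
      then show ?thesis
        using orthonormal_expansion[of B n e "v k", OF Badd Bscale Bherm orth] by (simp only:)
    qed
    then show ?thesis by (simp add: block_norm2_def)
  qed
  have form_F: "block_form m n \<phi> z v = F (congr sc m n (Y m v) z)" if "m \<ge> 1" "z \<in> mat m" for m z v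
  proof -
    have "congr sc m n (Y m v) z
      = (\<lambda>a b. \<Sum>p<m. \<Sum>q<m. \<Sum>i<n. \<Sum>j<n. sc (cnj (v p i) * v q j) (sc (cnj (e i a) * e j b) (z p q)))"
    proof (intro ext)
      fix a b
      have "sc (cnj (Y m v p a) * Y m v q b) (z p q)
        = (\<Sum>i<n. \<Sum>j<n. sc (cnj (v p i) * v q j) (sc (cnj (e i a) * e j b) (z p q)))"
        if "p < m" "q < m" for p q
      proof -
        have "cnj (Y m v p a) * Y m v q b
          = (\<Sum>i<n. \<Sum>j<n. (cnj (v p i) * v q j) * (cnj (e i a) * e j b))"
          using that unfolding Y_def
          by (simp only: if_True cnj_sum sum_product complex_cnj_mult) (simp only: ac_simps)
        then show ?thesis by (simp only: scale_sum_left scale_scale)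
      qed
      then have eq: "(\<Sum>p<m. \<Sum>q<m. sc (cnj (Y m v p a) * Y m v q b) (z p q))
        = (\<Sum>p<m. \<Sum>q<m. \<Sum>i<n. \<Sum>j<n. sc (cnj (v p i) * v q j) (sc (cnj (e i a) * e j b) (z p q)))"
        by (intro sum.cong refl) auto
      show "congr sc m n (Y m v) z a b
        = (\<Sum>p<m. \<Sum>q<m. \<Sum>i<n. \<Sum>j<n. sc (cnj (v p i) * v q j) (sc (cnj (e i a) * e j b) (z p q)))"
      proof (cases "a < n \<and> b < n")
        case True
        then show ?thesis using eq by (simp add: congr_def)
      next
        case False
        then have "cnj (e i a) * e j b = 0" if "i < n" "j < n" for i j
          using esupp that by (auto simp: not_less)
        then have "(\<Sum>p<m. \<Sum>q<m. \<Sum>i<n. \<Sum>j<n. sc (cnj (v p i) * v q j) (sc (cnj (e i a) * e j b) (z p q)))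
          = (\<Sum>p<m. \<Sum>q<m. \<Sum>i<n. \<Sum>j<n. 0)"
          by (intro sum.cong refl) (simp only: lessThan_iff scale_zero_left scale_zero_right)
        moreover have "congr sc m n (Y m v) z a b = 0" using False by (auto simp: congr_def)
        ultimately show ?thesis by simp
      qed
    qed
    then show ?thesis
      by (simp only: additive_sum[of F, OF Fadd] Fscale block_form_def \<phi>_def) (simp add: ac_simps)
  qed
  have bound: "Re (block_form m n \<phi> z v) \<le> \<nu> m z * block_norm2 m n v" if m: "m \<ge> 1" and z: "z \<in> mat m" for m z v
  proof -
    define R where "R = p (\<lambda>a b. \<Sum>k<m. cnj (Y m v k a) * Y m v k b)"
    have R: "R = (\<Sum>k<m. p (\<lambda>a b. cnj (Y m v k a) * Y m v k b))"
      unfolding R_def by (rule psum)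
    have R0: "R \<ge> 0" unfolding R by (intro sum_nonneg ppos)
    have "R \<le> (\<Sum>k<m. Re (B (Y m v k) (Y m v k)))"
      unfolding R using d by (intro sum_mono) (simp add: Bself sum_nonneg)
    then have Rle: "R \<le> block_norm2 m n v" by (simp only: Bsum)
    \<comment> \<open>The gauge of z may be 0, so z is normalized by an arbitrary c above it;
      afterwards c is lowered to the gauge.\<close>
    have step: "f (congr sc m n (Y m v) z) \<le> c * R" if "c > \<nu> m z" for c
    proof -
      have c: "c > 0" using nonneg[OF m z] that by simp
      have "\<nu> m (msc sc (complex_of_real (1 / c)) z) \<le> 1 / c * \<nu> m z"
        using c by (intro gauge_scale_le m z) simp
      also have "\<dots> \<le> 1" using c that by (simp add: field_simps)
      finally have "f (congr sc m n (Y m v) (msc sc (complex_of_real (1 / c)) z)) \<le> R"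
        unfolding R_def by (intro fp1 m Yrect msc_mat[OF vs z])
      then have "1 / c * f (congr sc m n (Y m v) z) \<le> R"
        unfolding congr_msc[OF vs] unfolding msc_def fscale .
      then show ?thesis using c by (simp add: field_simps)
    qed
    have "f (congr sc m n (Y m v) z) \<le> \<nu> m z * R + \<epsilon>" if "\<epsilon> > 0" for \<epsilon>
    proof -
      have "f (congr sc m n (Y m v) z) \<le> (\<nu> m z + \<epsilon> / (R + 1)) * R"
        using that R0 by (intro step) simp
      also have "\<dots> \<le> \<nu> m z * R + \<epsilon>"
        using that R0 by (simp add: field_simps)
      finally show ?thesis .
    qed
    then have "f (congr sc m n (Y m v) z) \<le> \<nu> m z * R" by (rule field_le_epsilon)
    also have "\<dots> \<le> \<nu> m z * block_norm2 m n v"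
      by (intro mult_left_mono Rle nonneg m z)
    finally show ?thesis by (simp add: form_F[OF m z] ReF)
  qed
  have "\<phi> \<in> matrix_states n"
    unfolding matrix_states_def
  proof (intro CollectI conjI allI ballI impI bound)
    show "\<phi> (x + y) i j = \<phi> x i j + \<phi> y i j" for x y i j
      using Fadd[of "\<lambda>a b. sc (cnj (e i a) * e j b) x" "\<lambda>a b. sc (cnj (e i a) * e j b) y"]
      by (simp add: \<phi>_def scale_right_distrib)
    show "\<phi> (sc c x) i j = c * \<phi> x i j" for c x i j
      using Fscale[of c "\<lambda>a b. sc (cnj (e i a) * e j b) x"]
      by (simp add: \<phi>_def ac_simps)
  qed
  \<comment> \<open>Expanding the unit vectors in the e_i gives the coefficients v for which
    \<open>Y n v\<close> is the identity matrix.\<close>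
  define \<delta> where "\<delta> k = (\<lambda>a. if a = k then 1 else (0::complex))" for k :: nat
  have "\<exists>c. \<forall>a. \<delta> k a = (\<Sum>i<n. c i * e i a)" if "k < n" for k
    using that by (intro span) (auto simp: \<delta>_def)
  then obtain v where v: "\<And>k a. k < n \<Longrightarrow> \<delta> k a = (\<Sum>i<n. v k i * e i a)" by metis
  have Yv: "Y n v = dmat n 1"
    using v[symmetric] by (auto simp: Y_def dmat_def \<delta>_def fun_eq_iff)
  have "congr sc n n (dmat n 1) z0 = z0"
    by (simp add: congr_dmat[OF vs z0] msc_def)
  then have "\<nu> n z0 \<le> Re (block_form n n \<phi> z0 v)"
    using fz0 by (simp add: form_F[OF n z0] Yv ReF)
  moreover have "block_norm2 n n v \<le> 1 + d"
  proof -
    have "block_norm2 n n v = (\<Sum>k<n. Re (B (dmat n 1 k) (dmat n 1 k)))"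
      unfolding Bsum[symmetric] Yv ..
    also have "\<dots> = (\<Sum>k<n. p (\<lambda>a b. cnj (dmat n 1 k a) * dmat n 1 k b)
        + d / n * (\<Sum>a<n. (cmod (dmat n 1 k a))\<^sup>2))"
      by (simp only: Bself Re_complex_of_real)
    also have "\<dots> = p (\<lambda>a b. \<Sum>k<n. cnj (dmat n 1 k a) * dmat n 1 k b)
        + (\<Sum>k<n. d / n * (\<Sum>a<n. (cmod (dmat n 1 k a))\<^sup>2))"
      by (simp only: sum.distrib psum)
    also have "p (\<lambda>a b. \<Sum>k<n. cnj (dmat n 1 k a) * dmat n 1 k b) \<le> 1"
    proof (rule pbound)
      fix v :: "nat \<Rightarrow> complex"
      have "(\<Sum>k<n. cnj (dmat n 1 k a) * dmat n 1 k b) = (if b = a then 1 else 0)"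
        if "a < n" "b < n" for a b
      proof -
        have "(\<Sum>k<n. cnj (dmat n 1 k a) * dmat n 1 k b) = (\<Sum>k<n. if k = a then if b = a then 1 else 0 else 0)"
          using that by (intro sum.cong) (auto simp: dmat_def)
        then show ?thesis using that by simp
      qed
      then have "(\<Sum>a<n. \<Sum>b<n. (\<Sum>k<n. cnj (dmat n 1 k a) * dmat n 1 k b) * v b * cnj (v a))
        = (\<Sum>a<n. \<Sum>b<n. if b = a then v b * cnj (v a) else 0)"
        by (intro sum.cong refl) auto
      also have "\<dots> = complex_of_real (\<Sum>a<n. (cmod (v a))\<^sup>2)"
        unfolding of_real_sum complex_norm_square by simp
      finally show "Re (\<Sum>a<n. \<Sum>b<n. (\<Sum>k<n. cnj (dmat n 1 k a) * dmat n 1 k b) * v b * cnj (v a))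
          \<le> 1 * (\<Sum>a<n. (cmod (v a))\<^sup>2)" by simp
    qed
    also have "(\<Sum>k<n. d / n * (\<Sum>a<n. (cmod (dmat n 1 k a))\<^sup>2)) = d"
    proof -
      have "(\<Sum>a<n. (cmod (dmat n 1 k a))\<^sup>2) = 1" if "k < n" for k
      proof -
        have "(\<Sum>a<n. (cmod (dmat n 1 k a))\<^sup>2) = (\<Sum>a<n. if a = k then 1 else 0)"
          by (intro sum.cong) (auto simp: dmat_def)
        then show ?thesis using that by simp
      qed
      then show ?thesis using n by simp
    qed
    finally show ?thesis by simp
  qed
  ultimately show ?thesis using that \<open>\<phi> \<in> matrix_states n\<close> by blast
qed

end

section \<open>The direct sum of all matrix states\<close>

context contractive_gauge
begin

text \<open>The block-diagonal operator with block \<phi>(z) at (k, \<phi>). The value 0 off l2 is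
  what \<open>is_bop\<close> prescribes.\<close>

definition dirsum :: "'z \<Rightarrow> (nat \<times> ('z \<Rightarrow> nat \<Rightarrow> nat \<Rightarrow> complex) \<times> nat \<Rightarrow> complex)
    \<Rightarrow> nat \<times> ('z \<Rightarrow> nat \<Rightarrow> nat \<Rightarrow> complex) \<times> nat \<Rightarrow> complex" where
  "dirsum z f = (\<lambda>(k, \<phi>, i). if f \<in> l2 (blocks matrix_states) \<and> (k, \<phi>, i) \<in> blocks matrix_states
     then \<Sum>j<k. \<phi> z i j * f (k, \<phi>, j) else 0)"

lemma matrix_state_add: "\<phi> \<in> matrix_states k \<Longrightarrow> \<phi> (x + y) i j = \<phi> x i j + \<phi> y i j"
  and matrix_state_scale: "\<phi> \<in> matrix_states k \<Longrightarrow> \<phi> (sc c x) i j = c * \<phi> x i j"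
  and matrix_state_form: "\<phi> \<in> matrix_states k \<Longrightarrow> m \<ge> 1 \<Longrightarrow> z \<in> mat m \<Longrightarrow>
    Re (block_form m k \<phi> z v) \<le> \<nu> m z * block_norm2 m k v"
  unfolding matrix_states_def by blast+

lemma matrix_state_zero: "\<phi> \<in> matrix_states k \<Longrightarrow> \<phi> 0 i j = 0"
  using matrix_state_scale[of \<phi> k 0 0 i j] by simp

text \<open>Testing a matrix state on the \<open>2 \<times> 2\<close> matrix with the single off-diagonal entry \<open>z\<close> bounds the
  sesquilinear form \<open>\<langle>\<phi>(z) v, w\<rangle>\<close>, uniformly over all matrix states; this makes the direct sum bounded.\<close>

lemma matrix_state_bound:
  fixes z :: 'z
  assumes \<phi>: "\<phi> \<in> matrix_states k"
  defines "C \<equiv> 2 * (\<nu> 2 (\<lambda>p q. if p = 0 \<and> q = 1 then z else 0) + 1)"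
  shows "(\<Sum>i<k. (cmod (\<Sum>j<k. \<phi> z i j * v j))\<^sup>2) \<le> C\<^sup>2 * (\<Sum>i<k. (cmod (v i))\<^sup>2)"
proof -
  let ?z = "\<lambda>p q. if p = 0 \<and> q = 1 then z else (0::'z)"
  have z: "?z \<in> mat 2" by (auto simp: rect_def)
  have two: "{..<2} = {0, 1::nat}" by auto
  have C: "C \<ge> 2" using nonneg[OF _ z] by (simp add: C_def)
  define N where "N = C / 2"
  have N: "N > 0" "\<nu> 2 ?z \<le> N" using C by (auto simp: N_def C_def)
  define u where "u i = (\<Sum>j<k. \<phi> z i j * v j)" for i
  \<comment> \<open>Testing on (t u, v) gives t|u|^2 <= N(t^2 |u|^2 + |v|^2). With t = 1/(2N) the
    first term on the right is half the left side, which leaves |u| <= 2N |v|.\<close>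
  define t where "t = 1 / (2 * N)"
  define w where "w p i = (if p = 0 then complex_of_real t * u i else v i)" for p :: nat and i
  have "block_form 2 k \<phi> ?z w = (\<Sum>i<k. \<Sum>j<k. cnj (w 0 i) * \<phi> z i j * w 1 j)"
    by (simp add: block_form_def two matrix_state_zero[OF \<phi>])
  also have "\<dots> = (\<Sum>i<k. complex_of_real t * (cnj (u i) * u i))"
  proof (rule sum.cong[OF refl])
    fix i
    have "(\<Sum>j<k. cnj (w 0 i) * \<phi> z i j * w 1 j) = cnj (w 0 i) * (\<Sum>j<k. \<phi> z i j * w 1 j)"
      by (simp only: sum_distrib_left mult.assoc)
    also have "(\<Sum>j<k. \<phi> z i j * w 1 j) = u i" by (simp add: w_def u_def)
    finally show "(\<Sum>j<k. cnj (w 0 i) * \<phi> z i j * w 1 j) = complex_of_real t * (cnj (u i) * u i)"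
      by (simp add: w_def)
  qed
  also have "\<dots> = complex_of_real (t * (\<Sum>i<k. (cmod (u i))\<^sup>2))"
    by (simp only: sum_distrib_left of_real_mult of_real_sum complex_norm_square mult.commute)
  finally have "t * (\<Sum>i<k. (cmod (u i))\<^sup>2) \<le> \<nu> 2 ?z * block_norm2 2 k w"
    using matrix_state_form[OF \<phi> _ z, of w] by simp
  also have "\<dots> \<le> N * block_norm2 2 k w"
    using N(2) by (intro mult_right_mono) (auto simp: block_norm2_def sum_nonneg)
  also have "block_norm2 2 k w = t\<^sup>2 * (\<Sum>i<k. (cmod (u i))\<^sup>2) + (\<Sum>i<k. (cmod (v i))\<^sup>2)"
    by (simp add: block_norm2_def two w_def norm_mult power_mult_distrib
        flip: sum_distrib_left)
  finally have "(\<Sum>i<k. (cmod (u i))\<^sup>2) \<le> (2 * N)\<^sup>2 * (\<Sum>i<k. (cmod (v i))\<^sup>2)"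
    using N(1) by (simp add: t_def field_simps power2_eq_square)
  then show ?thesis by (simp add: N_def u_def)
qed

lemma dirsum_apply:
  assumes "f \<in> l2 (blocks matrix_states)" "(k, \<phi>, i) \<in> blocks matrix_states"
  shows "dirsum z f (k, \<phi>, i) = (\<Sum>j<k. \<phi> z i j * f (k, \<phi>, j))"
  using assms by (simp add: dirsum_def)

lemma dirsum_outside:
  assumes "f \<notin> l2 (blocks matrix_states) \<or> x \<notin> blocks matrix_states"
  shows "dirsum z f x = 0"
  using assms by (cases x) (auto simp: dirsum_def)

lemma is_bop_dirsum: "is_bop (blocks matrix_states) (dirsum z)"
proof -
  let ?I = "blocks matrix_states"
  define C where "C = 2 * (\<nu> 2 (\<lambda>p q. if p = 0 \<and> q = 1 then z else 0) + 1)"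
  have summ: "(\<lambda>x. (cmod (dirsum z f x))\<^sup>2) summable_on ?I"
    and le: "infsum (\<lambda>x. (cmod (dirsum z f x))\<^sup>2) ?I \<le> infsum (\<lambda>x. C\<^sup>2 * (cmod (f x))\<^sup>2) ?I"
    if f: "f \<in> l2 ?I" for f
  proof -
    have G: "(\<lambda>x. C\<^sup>2 * (cmod (f x))\<^sup>2) summable_on ?I"
      by (intro summable_on_cmult_right l2_summable f)
    have block: "(\<Sum>i<k. (cmod (dirsum z f (k, \<phi>, i)))\<^sup>2) \<le> (\<Sum>i<k. C\<^sup>2 * (cmod (f (k, \<phi>, i)))\<^sup>2)"
      if "k \<ge> 1" "\<phi> \<in> matrix_states k" for k \<phi>
    proof -
      have "(\<Sum>i<k. (cmod (dirsum z f (k, \<phi>, i)))\<^sup>2)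
          = (\<Sum>i<k. (cmod (\<Sum>j<k. \<phi> z i j * f (k, \<phi>, j)))\<^sup>2)"
        using that by (intro sum.cong refl) (simp add: dirsum_apply[OF f])
      also have "\<dots> \<le> C\<^sup>2 * (\<Sum>i<k. (cmod (f (k, \<phi>, i)))\<^sup>2)"
        unfolding C_def by (rule matrix_state_bound[OF that(2)])
      finally show ?thesis by (simp add: sum_distrib_left)
    qed
    show "(\<lambda>x. (cmod (dirsum z f x))\<^sup>2) summable_on ?I"
      by (rule blocks_comparison(1)[OF G _ _ block]) simp_all
    show "infsum (\<lambda>x. (cmod (dirsum z f x))\<^sup>2) ?I \<le> infsum (\<lambda>x. C\<^sup>2 * (cmod (f x))\<^sup>2) ?I"
      by (rule blocks_comparison(2)[OF G _ _ block]) simp_all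
  qed
  show ?thesis
    unfolding is_bop_def
  proof (intro conjI ballI allI impI exI[of _ "\<bar>C\<bar>"])
    fix f assume f: "f \<in> l2 ?I"
    show "dirsum z f \<in> l2 ?I"
      using summ[OF f] by (simp add: l2_def dirsum_outside)
    show "l2norm ?I (dirsum z f) \<le> \<bar>C\<bar> * l2norm ?I f"
    proof (rule power2_le_imp_le)
      show "(l2norm ?I (dirsum z f))\<^sup>2 \<le> (\<bar>C\<bar> * l2norm ?I f)\<^sup>2"
        using le[OF f] by (simp add: power_mult_distrib l2norm_squared infsum_cmult_right')
    qed simp
    show "dirsum z (\<lambda>x. c * f x) = (\<lambda>x. c * dirsum z f x)" for c
    proof
      fix x :: "nat \<times> ('z \<Rightarrow> nat \<Rightarrow> nat \<Rightarrow> complex) \<times> nat"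
      obtain k \<phi> i where x: "x = (k, \<phi>, i)" by (metis surj_pair)
      show "dirsum z (\<lambda>x. c * f x) x = c * dirsum z f x"
      proof (cases "x \<in> ?I")
        case True
        then show ?thesis
          unfolding x by (simp only: dirsum_apply[OF f] dirsum_apply[OF l2_scale[OF f]])
            (simp add: sum_distrib_left ac_simps)
      qed (simp add: dirsum_outside)
    qed
    fix g assume g: "g \<in> l2 ?I"
    show "dirsum z (\<lambda>x. f x + g x) = (\<lambda>x. dirsum z f x + dirsum z g x)"
    proof
      fix x :: "nat \<times> ('z \<Rightarrow> nat \<Rightarrow> nat \<Rightarrow> complex) \<times> nat"
      obtain k \<phi> i where x: "x = (k, \<phi>, i)" by (metis surj_pair)
      show "dirsum z (\<lambda>x. f x + g x) x = dirsum z f x + dirsum z g x"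
      proof (cases "x \<in> ?I")
        case True
        then show ?thesis
          unfolding x by (simp only: dirsum_apply[OF f] dirsum_apply[OF g] dirsum_apply[OF l2_add[OF f g]])
            (simp add: sum.distrib distrib_left)
      qed (simp add: dirsum_outside)
    qed
  next
    fix f assume "f \<notin> l2 ?I"
    then show "dirsum z f = (\<lambda>x. 0)" by (simp add: dirsum_outside fun_eq_iff)
  qed
qed

lemma dirsum_add: "dirsum (z + w) = (\<lambda>f x. dirsum z f x + dirsum w f x)"
proof (intro ext)
  fix f and x :: "nat \<times> ('z \<Rightarrow> nat \<Rightarrow> nat \<Rightarrow> complex) \<times> nat"
  obtain k \<phi> i where x: "x = (k, \<phi>, i)" by (metis surj_pair)
  show "dirsum (z + w) f x = dirsum z f x + dirsum w f x"
    by (auto simp: x dirsum_def matrix_state_add[of \<phi> k] sum.distrib distrib_right)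
qed

lemma dirsum_scale: "dirsum (sc c z) = (\<lambda>f x. c * dirsum z f x)"
proof (intro ext)
  fix f and x :: "nat \<times> ('z \<Rightarrow> nat \<Rightarrow> nat \<Rightarrow> complex) \<times> nat"
  obtain k \<phi> i where x: "x = (k, \<phi>, i)" by (metis surj_pair)
  show "dirsum (sc c z) f x = c * dirsum z f x"
    by (auto simp: x dirsum_def matrix_state_scale[of \<phi> k] sum_distrib_left mult.assoc)
qed

lemma linear_dirsum: "complex_linear_into_B sc (blocks matrix_states) dirsum"
  unfolding complex_linear_into_B_def by (simp add: is_bop_dirsum dirsum_add dirsum_scale)

abbreviation amp_dirsum :: "nat \<Rightarrow> (nat \<Rightarrow> nat \<Rightarrow> 'z)
    \<Rightarrow> ((nat \<times> ('z \<Rightarrow> nat \<Rightarrow> nat \<Rightarrow> complex) \<times> nat) \<times> nat \<Rightarrow> complex)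
    \<Rightarrow> (nat \<times> ('z \<Rightarrow> nat \<Rightarrow> nat \<Rightarrow> complex) \<times> nat) \<times> nat \<Rightarrow> complex" where
  "amp_dirsum n \<equiv> amp (blocks matrix_states) n dirsum"

text \<open>Regroups the inner product by the points of \<open>blocks\<close>, with the finite sum
  over p inside, so that blockwise estimates apply.\<close>

lemma amp_dirsum_has_sum:
  assumes f: "f \<in> l2 (blocks matrix_states \<times> {..<n})"
  shows "((\<lambda>x. \<Sum>p<n. amp_dirsum n z f (x, p) * cnj (f (x, p)))
    has_sum cinner (blocks matrix_states \<times> {..<n}) (amp_dirsum n z f) f) (blocks matrix_states)"
proof -
  have "amp_dirsum n z f \<in> l2 (blocks matrix_states \<times> {..<n})"
    by (rule bop_l2[OF is_bop_amp[OF is_bop_dirsum] f])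
  then show ?thesis
    unfolding cinner_slices[OF \<open>amp_dirsum n z f \<in> _\<close> f]
    by (intro has_sum_lessThan cinner_has_sum l2_slice[OF f] l2_slice)
qed

lemma amp_dirsum_block:
  assumes f: "f \<in> l2 (blocks matrix_states \<times> {..<n})" and k: "k \<ge> 1" "\<phi> \<in> matrix_states k"
  shows "(\<Sum>i<k. \<Sum>p<n. amp_dirsum n z f ((k, \<phi>, i), p) * cnj (f ((k, \<phi>, i), p)))
    = block_form n k \<phi> z (\<lambda>p i. f ((k, \<phi>, i), p))"
proof -
  have "(\<Sum>i<k. \<Sum>p<n. amp_dirsum n z f ((k, \<phi>, i), p) * cnj (f ((k, \<phi>, i), p)))
    = (\<Sum>i<k. \<Sum>p<n. \<Sum>q<n. \<Sum>j<k. cnj (f ((k, \<phi>, i), p)) * \<phi> (z p q) i j * f ((k, \<phi>, j), q))"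
    using k
    by (intro sum.cong refl)
      (simp add: amp_apply[OF f] dirsum_apply[OF l2_slice[OF f]] sum_distrib_left sum_distrib_right ac_simps)
  also have "\<dots> = (\<Sum>p<n. \<Sum>i<k. \<Sum>q<n. \<Sum>j<k. cnj (f ((k, \<phi>, i), p)) * \<phi> (z p q) i j * f ((k, \<phi>, j), q))"
    by (rule sum.swap)
  also have "\<dots> = (\<Sum>p<n. \<Sum>q<n. \<Sum>i<k. \<Sum>j<k. cnj (f ((k, \<phi>, i), p)) * \<phi> (z p q) i j * f ((k, \<phi>, j), q))"
    by (rule sum.cong[OF refl], rule sum.swap)
  finally show ?thesis by (simp add: block_form_def)
qed

text \<open>The difference of the two sides is a sum over \<open>blocks\<close>, and its part over
  each single block is nonnegative by the defining inequality of a matrix state.\<close>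

lemma amp_dirsum_upper:
  assumes n: "n \<ge> 1" and z: "z \<in> mat n" and f: "f \<in> l2 (blocks matrix_states \<times> {..<n})"
  shows "Re (cinner (blocks matrix_states \<times> {..<n}) (amp_dirsum n z f) f)
    \<le> \<nu> n z * (l2norm (blocks matrix_states \<times> {..<n}) f)\<^sup>2"
proof -
  let ?I = "blocks matrix_states"
  define G where "G x = \<nu> n z * (\<Sum>p<n. (cmod (f (x, p)))\<^sup>2)
    + - Re (\<Sum>p<n. amp_dirsum n z f (x, p) * cnj (f (x, p)))" for x
  have "((\<lambda>x. \<Sum>p<n. (cmod (f (x, p)))\<^sup>2) has_sum (l2norm (?I \<times> {..<n}) f)\<^sup>2) ?I"
    unfolding l2norm_slices[OF f] unfolding l2norm_squared
    by (intro has_sum_lessThan has_sum_infsum l2_summable l2_slice[OF f])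
  then have G: "(G has_sum (\<nu> n z * (l2norm (?I \<times> {..<n}) f)\<^sup>2
      + - Re (cinner (?I \<times> {..<n}) (amp_dirsum n z f) f))) ?I"
    unfolding G_def
    by (intro has_sum_add has_sum_cmult_right has_sum_uminusI has_sum_Re amp_dirsum_has_sum f)
  have "0 \<le> infsum G ?I"
  proof (rule infsum_blocks_nonneg[OF has_sum_imp_summable[OF G]])
    fix k :: nat and \<phi> assume k: "k \<ge> 1" "\<phi> \<in> matrix_states k"
    have "(\<Sum>i<k. \<Sum>p<n. (cmod (f ((k, \<phi>, i), p)))\<^sup>2) = block_norm2 n k (\<lambda>p i. f ((k, \<phi>, i), p))"
      unfolding block_norm2_def by (rule sum.swap)
    then have "(\<Sum>i<k. G (k, \<phi>, i)) = \<nu> n z * block_norm2 n k (\<lambda>p i. f ((k, \<phi>, i), p))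
      - Re (block_form n k \<phi> z (\<lambda>p i. f ((k, \<phi>, i), p)))"
      unfolding G_def sum.distrib sum_negf sum_distrib_left[symmetric] Re_sum[symmetric]
        amp_dirsum_block[OF f k] by simp
    then show "0 \<le> (\<Sum>i<k. G (k, \<phi>, i))"
      using matrix_state_form[OF k(2) n z] by simp
  qed
  then show ?thesis using infsumI[OF G] by simp
qed

text \<open>The vector lives in the one block of a state that nearly norms z; all other blocks
  contribute nothing.\<close>

lemma amp_dirsum_lower:
  assumes n: "n \<ge> 1" and z: "z \<in> mat n" and d: "d > 0"
  obtains f where "f \<in> l2 (blocks matrix_states \<times> {..<n})"
    "(l2norm (blocks matrix_states \<times> {..<n}) f)\<^sup>2 \<le> 1 + d"
    "\<nu> n z \<le> Re (cinner (blocks matrix_states \<times> {..<n}) (amp_dirsum n z f) f)"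
proof -
  let ?I = "blocks matrix_states"
  obtain \<phi> v where \<phi>: "\<phi> \<in> matrix_states n" "\<nu> n z \<le> Re (block_form n n \<phi> z v)"
    "block_norm2 n n v \<le> 1 + d"
    using ex_matrix_state[OF n z d] by metis
  define S where "S = (\<lambda>i. (n, \<phi>, i)) ` {..<n}"
  have S: "finite S" "S \<subseteq> ?I" using n \<phi>(1) by (auto simp: S_def)
  have inj: "inj_on (\<lambda>i. (n, \<phi>, i)) {..<n}" by (auto simp: inj_on_def)
  define f where "f y = (if y \<in> S \<times> {..<n} then v (snd y) (snd (snd (fst y))) else 0)"
    for y :: "(nat \<times> ('z \<Rightarrow> nat \<Rightarrow> nat \<Rightarrow> complex) \<times> nat) \<times> nat"
  have f: "f \<in> l2 (?I \<times> {..<n})"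
    unfolding f_def using S by (intro l2_finite_support) auto
  have fS: "f ((n, \<phi>, i), p) = v p i" if "i < n" "p < n" for i p
    using that by (simp add: f_def S_def)
  have f0: "f (x, p) = 0" if "x \<notin> S" for x p using that by (simp add: f_def)
  have "cinner (?I \<times> {..<n}) (amp_dirsum n z f) f
      = infsum (\<lambda>x. \<Sum>p<n. amp_dirsum n z f (x, p) * cnj (f (x, p))) ?I"
    by (rule infsumI[OF amp_dirsum_has_sum[OF f], symmetric])
  also have "\<dots> = infsum (\<lambda>x. \<Sum>p<n. amp_dirsum n z f (x, p) * cnj (f (x, p))) S"
    using S f0 by (intro infsum_cong_neutral) auto
  also have "\<dots> = (\<Sum>i<n. \<Sum>p<n. amp_dirsum n z f ((n, \<phi>, i), p) * cnj (f ((n, \<phi>, i), p)))"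
    using S(1) unfolding S_def by (simp add: sum.reindex[OF inj])
  also have "\<dots> = block_form n n \<phi> z (\<lambda>p i. f ((n, \<phi>, i), p))"
    by (rule amp_dirsum_block[OF f n \<phi>(1)])
  also have "\<dots> = block_form n n \<phi> z v"
    unfolding block_form_def by (intro sum.cong refl) (simp add: fS)
  finally have form: "cinner (?I \<times> {..<n}) (amp_dirsum n z f) f = block_form n n \<phi> z v" .
  have "(l2norm (?I \<times> {..<n}) f)\<^sup>2 = (\<Sum>p<n. infsum (\<lambda>x. (cmod (f (x, p)))\<^sup>2) ?I)"
    unfolding l2norm_slices[OF f] unfolding l2norm_squared ..
  also have "\<dots> = (\<Sum>p<n. infsum (\<lambda>x. (cmod (f (x, p)))\<^sup>2) S)"
    using S f0 by (intro sum.cong refl infsum_cong_neutral) auto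
  also have "\<dots> = (\<Sum>p<n. \<Sum>i<n. (cmod (f ((n, \<phi>, i), p)))\<^sup>2)"
    using S(1) unfolding S_def by (simp add: sum.reindex[OF inj])
  also have "\<dots> = block_norm2 n n v"
    unfolding block_norm2_def by (intro sum.cong refl) (simp add: fS)
  finally show ?thesis
    using that[of f] f form \<phi>(2,3) by simp
qed

end

section \<open>Normal accretive operator spaces\<close>

text \<open>Links the form bound of \<open>contractive_gauge\<close> with the supremum in the gauge
  axioms. The supremum must also be shown nonnegative before its upper bound can be squared.\<close>

lemma cmat_norm_squared_le:
  assumes c: "c \<ge> 0"
    and X: "\<And>v. (\<Sum>p<n. (cmod (\<Sum>i<k. X p i * v i))\<^sup>2) \<le> c * (\<Sum>i<k. (cmod (v i))\<^sup>2)"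
  shows "(cmat_norm n k X)\<^sup>2 \<le> c"
proof -
  let ?f = "\<lambda>v. vnorm n (\<lambda>p. \<Sum>q<k. X p q * v q)" and ?S = "{v. vnorm k v \<le> 1}"
  have le: "?f v \<le> sqrt c" if "v \<in> ?S" for v
  proof -
    have "(\<Sum>i<k. (cmod (v i))\<^sup>2) \<le> 1"
      using that by (simp add: vnorm_def)
    then have "c * (\<Sum>i<k. (cmod (v i))\<^sup>2) \<le> c * 1" using c by (rule mult_left_mono)
    then show ?thesis using X[of v] by (simp add: vnorm_def)
  qed
  have zero: "(\<lambda>_. 0) \<in> ?S" by (simp add: vnorm_def)
  have "cmat_norm n k X \<le> sqrt c"
    unfolding cmat_norm_def using zero le by (intro cSUP_least) auto
  moreover have "?f (\<lambda>_. 0) \<le> cmat_norm n k X"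
    unfolding cmat_norm_def using le zero by (intro cSUP_upper bdd_aboveI2[where M = "sqrt c"])
  then have "0 \<le> cmat_norm n k X" by (simp add: vnorm_def)
  ultimately have "(cmat_norm n k X)\<^sup>2 \<le> (sqrt c)\<^sup>2" by (intro power_mono)
  then show ?thesis using c by simp
qed

text \<open>Column i of the matrix is the unit vector at \<open>g i\<close> or zero, so the
  congruence picks out, repeats or pads entries; \<open>cone_dsum\<close> uses it to embed both
  summands.\<close>

lemma congr_select:
  assumes "vector_space sc" and g: "\<And>i. i < k \<Longrightarrow> s i \<Longrightarrow> g i < n"
  shows "congr sc n k (\<lambda>p i. if i < k \<and> s i \<and> p = g i then 1 else 0) D
    = (\<lambda>i j. if i < k \<and> j < k \<and> s i \<and> s j then D (g i) (g j) else 0)"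
proof (intro ext)
  interpret vector_space sc by fact
  fix i j
  let ?X = "\<lambda>p i. if i < k \<and> s i \<and> p = g i then 1 else (0::complex)"
  show "congr sc n k ?X D i j = (if i < k \<and> j < k \<and> s i \<and> s j then D (g i) (g j) else 0)"
  proof (cases "i < k \<and> j < k \<and> s i \<and> s j")
    case True
    have "(\<Sum>p<n. \<Sum>q<n. sc (cnj (?X p i) * ?X q j) (D p q))
      = (\<Sum>p<n. \<Sum>q<n. if q = g j then if p = g i then D p q else 0 else 0)"
      using True by (intro sum.cong refl) auto
    also have "\<dots> = D (g i) (g j)" using True g by simp
    finally show ?thesis using True by (simp add: congr_def)
  next
    case False
    then show ?thesis by (auto simp: congr_def intro!: sum.neutral)
  qed
qed

lemma congr_msub:
  assumes "vector_space sc"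
  shows "congr sc n k X (msub A B) = msub (congr sc n k X A) (congr sc n k X B)"
proof -
  interpret vector_space sc by fact
  show ?thesis
    unfolding congr_def msub_def
    by (intro ext) (simp add: scale_right_diff_distrib sum_subtractf)
qed

section \<open>The gauge of upper bounds in a normal space\<close>

locale normal_space =
  fixes sc :: "complex \<Rightarrow> 'z::ab_group_add \<Rightarrow> 'z"
    and C :: "nat \<Rightarrow> (nat \<Rightarrow> nat \<Rightarrow> 'z) set"
    and h :: "nat \<Rightarrow> (nat \<Rightarrow> nat \<Rightarrow> 'z) \<Rightarrow> real"
  assumes normal: "normal_accretive_operator_space sc C h"
begin

lemma vs: "vector_space sc"
  and cone: "matrix_cone sc C" and proper_cone: "C_proper_cone sc C"
  and gauge: "matrix_gauge sc h" and proper_gauge: "C_proper_gauge sc h"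
  and closed: "h_closed C h"
  using normal
  unfolding normal_accretive_operator_space_def accretive_mat_ordered_def hermitian_gauge_def
  by blast+

sublocale vector_space sc by (rule vs)

lemma cone_mat: "n \<ge> 1 \<Longrightarrow> A \<in> C n \<Longrightarrow> A \<in> mat n"
  and cone_add: "n \<ge> 1 \<Longrightarrow> A \<in> C n \<Longrightarrow> B \<in> C n \<Longrightarrow> madd A B \<in> C n"
  and cone_congr: "n \<ge> 1 \<Longrightarrow> k \<ge> 1 \<Longrightarrow> X \<in> rect n k \<Longrightarrow> A \<in> C n \<Longrightarrow> congr sc n k X A \<in> C k"
  using cone unfolding matrix_cone_def is_cone_mat_def by blast+

lemma h_nonneg: "n \<ge> 1 \<Longrightarrow> A \<in> mat n \<Longrightarrow> 0 \<le> h n A"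
  and h_congr: "n \<ge> 1 \<Longrightarrow> k \<ge> 1 \<Longrightarrow> X \<in> rect n k \<Longrightarrow> A \<in> mat n \<Longrightarrow>
    h k (congr sc n k X A) \<le> (cmat_norm n k X)\<^sup>2 * h n A"
  and h_dsum: "n \<ge> 1 \<Longrightarrow> m \<ge> 1 \<Longrightarrow> A \<in> mat n \<Longrightarrow> B \<in> mat m \<Longrightarrow> h (n + m) (dsum n A B) = max (h n A) (h m B)"
  using gauge unfolding matrix_gauge_def by blast+

lemma h_scale: "n \<ge> 1 \<Longrightarrow> A \<in> mat n \<Longrightarrow> h n (msc sc (complex_of_real t) A) = \<bar>t\<bar> * h n A"
  using normal unfolding normal_accretive_operator_space_def hermitian_gauge_def by blast

lemma h_between: "n \<ge> 1 \<Longrightarrow> x \<in> mat n \<Longrightarrow> y \<in> mat n \<Longrightarrow> z \<in> mat n \<Longrightarrow>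
    msub y x \<in> C n \<Longrightarrow> msub z y \<in> C n \<Longrightarrow> h n y \<le> max (h n x) (h n z)"
  using normal unfolding normal_accretive_operator_space_def by blast

lemma cone_closed:
  assumes "n \<ge> 1" "z \<in> mat n" "\<And>k. zs k \<in> C n" "(\<lambda>k. h n (msub (zs k) z)) \<longlonglongrightarrow> 0"
  shows "z \<in> C n"
  using closed[unfolded h_closed_def, rule_format, of n zs z] assms by simp

lemma uminus_mat: "A \<in> mat n \<Longrightarrow> - A \<in> mat n" for A :: "nat \<Rightarrow> nat \<Rightarrow> 'z"
  by (simp add: rect_def)

lemma h_minus: "n \<ge> 1 \<Longrightarrow> A \<in> mat n \<Longrightarrow> h n (- A) = h n A"
  using h_scale[of n A "-1"] by (simp add: msc_def fun_Compl_def)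

lemma h_zero: "n \<ge> 1 \<Longrightarrow> h n 0 = 0"
  using h_scale[of n 0 0] by (simp add: msc_def rect_def zero_fun_def)

lemma cone_zero:
  assumes "n \<ge> 1"
  shows "0 \<in> C n"
proof -
  have "mzero \<in> C 1" using proper_cone unfolding C_proper_cone_def by blast
  then have "congr sc 1 n (\<lambda>p i. 0) mzero \<in> C n"
    using assms by (intro cone_congr) (auto simp: rect_def)
  then show ?thesis by (simp add: congr_zero_left[OF vs] zero_fun_def)
qed

text \<open>The direct sum is A padded by zeros plus B padded by zeros, and each padding is a
  congruence by a coordinate projection.\<close>

lemma cone_dsum:
  assumes "n \<ge> 1" "m \<ge> 1" "A \<in> C n" "B \<in> C m"
  shows "dsum n A B \<in> C (n + m)"
proof -
  let ?P = "\<lambda>p i. if i < n + m \<and> i < n \<and> p = i then 1 else (0::complex)"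
  let ?Q = "\<lambda>p i. if i < n + m \<and> n \<le> i \<and> p = i - n then 1 else (0::complex)"
  have "madd (congr sc n (n + m) ?P A) (congr sc m (n + m) ?Q B) \<in> C (n + m)"
    using assms by (intro cone_add cone_congr) (auto simp: rect_def)
  moreover have "madd (congr sc n (n + m) ?P A) (congr sc m (n + m) ?Q B) = dsum n A B"
  proof -
    have "congr sc n (n + m) ?P A = (\<lambda>i j. if i < n + m \<and> j < n + m \<and> i < n \<and> j < n then A i j else 0)"
      by (rule congr_select[OF vs, where g = "\<lambda>i. i"])
    moreover have "congr sc m (n + m) ?Q B
        = (\<lambda>i j. if i < n + m \<and> j < n + m \<and> n \<le> i \<and> n \<le> j then B (i - n) (j - n) else 0)"
      by (rule congr_select[OF vs]) simp
    moreover have "B (i - n) (j - n) = 0" if "n \<le> i" "n \<le> j" "\<not> (i < n + m \<and> j < n + m)" for i j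
      using cone_mat[OF assms(2,4)] that by (auto simp: rect_def less_diff_conv2)
    ultimately show ?thesis
      by (intro ext) (auto simp: madd_def dsum_def)
  qed
  ultimately show ?thesis by simp
qed

definition nu :: "nat \<Rightarrow> (nat \<Rightarrow> nat \<Rightarrow> 'z) \<Rightarrow> real" where
  "nu n z = Inf (h n ` {w \<in> mat n. msub w z \<in> C n})"

lemma nu_le: "n \<ge> 1 \<Longrightarrow> w \<in> mat n \<Longrightarrow> msub w z \<in> C n \<Longrightarrow> nu n z \<le> h n w"
  unfolding nu_def by (intro cINF_lower bdd_belowI2[where m = 0] h_nonneg) auto

lemma self_upper: "n \<ge> 1 \<Longrightarrow> msub z z \<in> C n"
  using cone_zero[of n] by (simp add: msub_def zero_fun_def)

lemma nu_ge:
  assumes "n \<ge> 1" "z \<in> mat n" "\<And>w. w \<in> mat n \<Longrightarrow> msub w z \<in> C n \<Longrightarrow> c \<le> h n w"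
  shows "c \<le> nu n z"
  unfolding nu_def using assms self_upper[OF assms(1), of z] by (intro cINF_greatest) auto

lemma nu_approx:
  assumes "n \<ge> 1" "z \<in> mat n" "nu n z < c"
  obtains w where "w \<in> mat n" "msub w z \<in> C n" "h n w < c"
  using nu_ge[OF assms(1,2), of c] assms(3) by (meson not_le)

lemma msub_dsum: "msub (dsum n A B) (dsum n A' B') = dsum n (msub A A') (msub B B')"
  for A B A' B' :: "nat \<Rightarrow> nat \<Rightarrow> 'z"
  by (intro ext) (simp add: msub_def dsum_def)

text \<open>Upper bounds are inherited: if v, w lie above A, B, then \<open>dsum n v w\<close> lies
  above \<open>dsum n A B\<close>; and if w lies above A, then X* w X lies above X* A X. The axioms
  for \<open>h\<close> then bound the infimum.\<close>

sublocale contractive_gauge sc nu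
proof
  show "0 \<le> nu n A" if "n \<ge> 1" "A \<in> mat n" for n and A :: "nat \<Rightarrow> nat \<Rightarrow> 'z"
    using that h_nonneg by (intro nu_ge) auto
next
  fix n m and A B :: "nat \<Rightarrow> nat \<Rightarrow> 'z" assume nm: "n \<ge> 1" "m \<ge> 1" and AB: "A \<in> mat n" "B \<in> mat m"
  show "nu (n + m) (dsum n A B) \<le> max (nu n A) (nu m B)"
  proof (rule ccontr)
    assume "\<not> ?thesis"
    then have lt: "nu n A < nu (n + m) (dsum n A B)" "nu m B < nu (n + m) (dsum n A B)" by auto
    obtain v where v: "v \<in> mat n" "msub v A \<in> C n" "h n v < nu (n + m) (dsum n A B)"
      using nu_approx[OF nm(1) AB(1) lt(1)] by metis
    obtain w where w: "w \<in> mat m" "msub w B \<in> C m" "h m w < nu (n + m) (dsum n A B)"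
      using nu_approx[OF nm(2) AB(2) lt(2)] by metis
    have "nu (n + m) (dsum n A B) \<le> h (n + m) (dsum n v w)"
      using nm v w by (intro nu_le dsum_mat) (auto simp: msub_dsum cone_dsum)
    then show False using h_dsum[OF nm v(1) w(1)] v(3) w(3) by simp
  qed
next
  fix n k X c and A :: "nat \<Rightarrow> nat \<Rightarrow> 'z"
  assume nk: "n \<ge> 1" "k \<ge> 1" and X: "X \<in> rect n k" and A: "A \<in> mat n" and c: "0 \<le> (c::real)"
    and bound: "\<And>v. (\<Sum>p<n. (cmod (\<Sum>i<k. X p i * v i))\<^sup>2) \<le> c * (\<Sum>i<k. (cmod (v i))\<^sup>2)"
  have le: "nu k (congr sc n k X A) \<le> c * h n w" if w: "w \<in> mat n" "msub w A \<in> C n" for w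
  proof -
    have "nu k (congr sc n k X A) \<le> h k (congr sc n k X w)"
      by (rule nu_le[OF nk(2) congr_mat])
        (simp add: congr_msub[OF vs, symmetric] cone_congr[OF nk X w(2)])
    also have "\<dots> \<le> (cmat_norm n k X)\<^sup>2 * h n w" by (rule h_congr[OF nk X w(1)])
    also have "\<dots> \<le> c * h n w"
      by (intro mult_right_mono cmat_norm_squared_le c bound h_nonneg nk w)
    finally show ?thesis .
  qed
  show "nu k (congr sc n k X A) \<le> c * nu n A"
  proof (cases "c = 0")
    \<comment> \<open>Division by c is impossible here, but any single upper bound, such as
      \<open>A\<close> itself, already gives the claim.\<close>
    case True
    then show ?thesis using le[OF A self_upper[OF nk(1)]] by simp
  next
    case False
    then have "nu k (congr sc n k X A) / c \<le> nu n A"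
      using c le nk A by (intro nu_ge) (simp_all add: field_simps)
    then show ?thesis using False c by (simp add: field_simps)
  qed
qed

lemma nu_le_h: "n \<ge> 1 \<Longrightarrow> z \<in> mat n \<Longrightarrow> nu n z \<le> h n z"
  by (rule nu_le) (simp_all add: self_upper)

text \<open>If v lies above z and w above -z, then -w <= z <= v, so normality bounds h(z) by the
  larger of h(w) and h(v).\<close>

lemma h_eq_max_nu:
  assumes n: "n \<ge> 1" and z: "z \<in> mat n"
  shows "h n z = max (nu n z) (nu n (- z))"
proof (rule antisym)
  note z' = uminus_mat[OF z]
  show "max (nu n z) (nu n (- z)) \<le> h n z"
    using nu_le_h[OF n z] nu_le_h[OF n z'] h_minus[OF n z] by simp
  show "h n z \<le> max (nu n z) (nu n (- z))"
  proof (rule ccontr)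
    assume "\<not> ?thesis"
    then have lt: "nu n z < h n z" "nu n (- z) < h n z" by auto
    obtain v where v: "v \<in> mat n" "msub v z \<in> C n" "h n v < h n z"
      using nu_approx[OF n z lt(1)] by metis
    obtain w where w: "w \<in> mat n" "msub w (- z) \<in> C n" "h n w < h n z"
      using nu_approx[OF n z' lt(2)] by metis
    have "msub z (- w) = msub w (- z)"
      by (simp add: msub_def fun_eq_iff add.commute)
    then have "h n z \<le> max (h n (- w)) (h n v)"
      using v w by (intro h_between[OF n uminus_mat[OF w(1)] z v(1)]) simp_all
    then show False using v(3) w(3) h_minus[OF n w(1)] by simp
  qed
qed

text \<open>If z is accretive, then 0 lies above -z. Conversely, there are w_k above -z with h(w_k)
  tending to 0; the accretive elements w_k + z then converge to z, and closedness applies.\<close>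

lemma cone_iff_nu:
  assumes n: "n \<ge> 1" and z: "z \<in> mat n"
  shows "z \<in> C n \<longleftrightarrow> nu n (- z) \<le> 0"
proof
  assume "z \<in> C n"
  moreover have "msub 0 (- z) = z" by (simp add: msub_def fun_eq_iff)
  ultimately have "nu n (- z) \<le> h n 0"
    using n by (intro nu_le) (simp_all add: rect_def)
  then show "nu n (- z) \<le> 0" using h_zero[OF n] by simp
next
  assume le: "nu n (- z) \<le> 0"
  have "\<exists>w. w \<in> mat n \<and> msub w (- z) \<in> C n \<and> h n w < 1 / real (Suc k)" for k
    using nu_approx[OF n uminus_mat[OF z], of "1 / real (Suc k)"] le
    by (metis divide_pos_pos le_less_trans of_nat_0_less_iff zero_less_Suc zero_less_one)
  then obtain w where w: "\<And>k. w k \<in> mat n" "\<And>k. msub (w k) (- z) \<in> C n"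
    "\<And>k. h n (w k) < 1 / real (Suc k)" by metis
  have "msub (msub (w k) (- z)) z = w k" for k by (simp add: msub_def fun_eq_iff)
  moreover have "(\<lambda>k. h n (w k)) \<longlonglongrightarrow> 0"
  proof (rule tendsto_sandwich[OF _ _ tendsto_const LIMSEQ_inverse_real_of_nat])
    show "\<forall>\<^sub>F k in sequentially. 0 \<le> h n (w k)" using h_nonneg[OF n w(1)] by simp
    show "\<forall>\<^sub>F k in sequentially. h n (w k) \<le> inverse (real (Suc k))"
      using w(3) by (intro always_eventually allI) (simp add: inverse_eq_divide less_imp_le)
  qed
  ultimately have "(\<lambda>k. h n (msub (msub (w k) (- z)) z)) \<longlonglongrightarrow> 0" by simp
  with w(2) show "z \<in> C n" by (rule cone_closed[OF n z])
qed

section \<open>Recovering gauge and order from the quadratic form\<close>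

lemma dirsum_minus: "dirsum (- z) = (\<lambda>f x. - dirsum z f x)"
  using dirsum_scale[of "-1" z] by simp

lemma cinner_amp_minus:
  assumes f: "f \<in> l2 (blocks matrix_states \<times> {..<n})"
  shows "cinner (blocks matrix_states \<times> {..<n}) (amp_dirsum n (- z) f) f
    = - cinner (blocks matrix_states \<times> {..<n}) (amp_dirsum n z f) f"
proof -
  have "amp_dirsum n (- z) f x = (- 1) * amp_dirsum n z f x" for x
    by (cases x) (simp add: amp_apply[OF f] dirsum_minus sum_negf)
  then have "amp_dirsum n (- z) f = (\<lambda>x. (- 1) * amp_dirsum n z f x)" by blast
  then show ?thesis by (simp only: cinner_scale_left) simp
qed

text \<open>Converse to \<open>amp_dirsum_upper\<close>. Norming vectors have squared norm up to 1 +
  d, and d = \<epsilon>/(c + 1) keeps the excess c d below \<epsilon>. The case c = 0 is the one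
  used for the order.\<close>

lemma nu_le_of_form:
  assumes n: "n \<ge> 1" and z: "z \<in> mat n" and c: "c \<ge> 0"
    and form: "\<And>f. f \<in> l2 (blocks matrix_states \<times> {..<n}) \<Longrightarrow>
      Re (cinner (blocks matrix_states \<times> {..<n}) (amp_dirsum n z f) f)
        \<le> c * (l2norm (blocks matrix_states \<times> {..<n}) f)\<^sup>2"
  shows "nu n z \<le> c"
proof (rule field_le_epsilon)
  fix \<epsilon> :: real assume \<epsilon>: "\<epsilon> > 0"
  define d where "d = \<epsilon> / (c + 1)"
  have d: "d > 0" "c * d \<le> \<epsilon>" using c \<epsilon> by (simp_all add: d_def field_simps)
  obtain f where f: "f \<in> l2 (blocks matrix_states \<times> {..<n})"
    "(l2norm (blocks matrix_states \<times> {..<n}) f)\<^sup>2 \<le> 1 + d"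
    "nu n z \<le> Re (cinner (blocks matrix_states \<times> {..<n}) (amp_dirsum n z f) f)"
    using amp_dirsum_lower[OF n z d(1)] by metis
  have "nu n z \<le> c * (1 + d)"
    using f(3) form[OF f(1)] mult_left_mono[OF f(2) c] by linarith
  then show "nu n z \<le> c + \<epsilon>" using d(2) by (simp add: distrib_left)
qed

lemma abs_form_le:
  assumes n: "n \<ge> 1" and z: "z \<in> mat n" and f: "f \<in> l2 (blocks matrix_states \<times> {..<n})"
  shows "\<bar>Re (cinner (blocks matrix_states \<times> {..<n}) (amp_dirsum n z f) f)\<bar>
    \<le> h n z * (l2norm (blocks matrix_states \<times> {..<n}) f)\<^sup>2"
proof -
  let ?N = "(l2norm (blocks matrix_states \<times> {..<n}) f)\<^sup>2"
  have "nu n z * ?N \<le> h n z * ?N" "nu n (- z) * ?N \<le> h n z * ?N"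
    unfolding h_eq_max_nu[OF n z] by (auto intro: mult_right_mono)
  then show ?thesis
    using amp_dirsum_upper[OF n z f] amp_dirsum_upper[OF n uminus_mat[OF z] f]
    unfolding cinner_amp_minus[OF f] by simp
qed

text \<open>The norm of a real part is the supremum of the modulus of its form on unit vectors.
  \<open>nu\<close> at z and at -z control this form from above and below, and their maximum is
  h.\<close>

lemma h_eq_opnorm:
  assumes n: "n \<ge> 1" and z: "z \<in> mat n"
  shows "h n z = opnorm (blocks matrix_states \<times> {..<n})
    (ReOp (blocks matrix_states \<times> {..<n}) (amp_dirsum n z))"
proof (rule antisym)
  let ?J = "blocks matrix_states \<times> {..<n}"
  have bop: "is_bop ?J (amp_dirsum n z)" by (rule is_bop_amp[OF is_bop_dirsum])
  show "opnorm ?J (ReOp ?J (amp_dirsum n z)) \<le> h n z"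
    by (rule opnorm_ReOp_le[OF bop h_nonneg[OF n z] abs_form_le[OF n z]])
  have pos: "0 \<le> opnorm ?J (ReOp ?J (amp_dirsum n z))"
    by (rule opnorm_nonneg[OF bop_ReOp[OF bop]])
  have le: "\<bar>Re (cinner ?J (amp_dirsum n z f) f)\<bar> \<le> opnorm ?J (ReOp ?J (amp_dirsum n z)) * (l2norm ?J f)\<^sup>2"
    if "f \<in> l2 ?J" for f
    by (rule abs_Re_cinner_le_opnorm[OF bop that])
  have "nu n z \<le> opnorm ?J (ReOp ?J (amp_dirsum n z))"
    by (rule nu_le_of_form[OF n z pos]) (use le in \<open>fastforce dest: abs_le_D1\<close>)
  moreover have "nu n (- z) \<le> opnorm ?J (ReOp ?J (amp_dirsum n z))"
  proof (rule nu_le_of_form[OF n uminus_mat[OF z] pos])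
    fix f assume f: "f \<in> l2 ?J"
    show "Re (cinner ?J (amp_dirsum n (- z) f) f)
        \<le> opnorm ?J (ReOp ?J (amp_dirsum n z)) * (l2norm ?J f)\<^sup>2"
      unfolding cinner_amp_minus[OF f] using abs_le_D2[OF le[OF f]] by simp
  qed
  ultimately show "h n z \<le> opnorm ?J (ReOp ?J (amp_dirsum n z))"
    unfolding h_eq_max_nu[OF n z] by simp
qed

text \<open>A nonnegative form for z is a form bound 0 for -z; so both directions are the two form
  estimates at -z, combined with \<open>cone_iff_nu\<close>.\<close>

lemma accretive_amp_iff:
  assumes n: "n \<ge> 1" and z: "z \<in> mat n"
  shows "accretive_op (blocks matrix_states \<times> {..<n}) (amp_dirsum n z) \<longleftrightarrow> z \<in> C n"
  unfolding accretive_op_iff[OF is_bop_amp[OF is_bop_dirsum]] cone_iff_nu[OF n z]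
proof
  let ?J = "blocks matrix_states \<times> {..<n}"
  assume pos: "\<forall>f\<in>l2 ?J. 0 \<le> Re (cinner ?J (amp_dirsum n z f) f)"
  show "nu n (- z) \<le> 0"
  proof (rule nu_le_of_form[OF n uminus_mat[OF z]])
    fix f assume f: "f \<in> l2 ?J"
    show "Re (cinner ?J (amp_dirsum n (- z) f) f) \<le> 0 * (l2norm ?J f)\<^sup>2"
      unfolding cinner_amp_minus[OF f] using pos f by simp
  qed simp
next
  let ?J = "blocks matrix_states \<times> {..<n}"
  assume le: "nu n (- z) \<le> 0"
  show "\<forall>f\<in>l2 ?J. 0 \<le> Re (cinner ?J (amp_dirsum n z f) f)"
  proof
    fix f assume f: "f \<in> l2 ?J"
    have "nu n (- z) * (l2norm ?J f)\<^sup>2 \<le> 0" using le by (intro mult_nonpos_nonneg) auto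
    then show "0 \<le> Re (cinner ?J (amp_dirsum n z f) f)"
      using amp_dirsum_upper[OF n uminus_mat[OF z] f] unfolding cinner_amp_minus[OF f] by simp
  qed
qed

text \<open>If \<open>dirsum z\<close> vanishes, so do the forms of all i^k z, hence
  \<open>h 1\<close> vanishes on them, and properness of the gauge gives z = 0.\<close>

lemma inj_dirsum: "inj dirsum"
proof (rule injI)
  fix x y assume eq: "dirsum x = dirsum y"
  define z where "z = x - y"
  have "x = z + y" by (simp add: z_def)
  have z0: "dirsum z f a = 0" for f a
    using dirsum_add[of z y] eq unfolding \<open>x = z + y\<close>[symmetric] by (metis add_cancel_left_left)
  have "h 1 (sing (sc (\<i> ^ k) z)) = 0" for k
  proof -
    have mat: "sing (sc (\<i> ^ k) z) \<in> mat 1" by (auto simp: sing_def rect_def)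
    have zero: "dirsum (sing (sc (\<i> ^ k) z) p q) f a = 0" for p q f a
      using z0 dirsum_scale[of "\<i> ^ k" z] dirsum_scale[of 0 z] by (simp add: sing_def)
    have "amp_dirsum 1 (sing (sc (\<i> ^ k) z)) f a = 0" for f a
      by (cases a) (simp add: amp_def zero)
    then have "amp_dirsum 1 (sing (sc (\<i> ^ k) z)) f = (\<lambda>a. 0)" for f by blast
    then have "nu 1 (sing (sc (\<i> ^ k) z)) \<le> 0" "nu 1 (- sing (sc (\<i> ^ k) z)) \<le> 0"
      using mat uminus_mat[OF mat] by (auto intro!: nu_le_of_form simp: cinner_amp_minus)
    then show ?thesis
      using h_eq_max_nu[OF _ mat] h_nonneg[OF _ mat] by simp
  qed
  then have "z = 0" using proper_gauge unfolding C_proper_gauge_def by blast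
  then show "x = y" by (simp add: z_def)
qed

lemma dirsum_embedding: "real_complete_order_embedding sc C (blocks matrix_states) dirsum"
  unfolding real_complete_order_embedding_def real_completely_positive_def
    inverse_real_completely_positive_def
  using linear_dirsum inj_dirsum accretive_amp_iff cone_mat by blast

end

theorem theorem5p4:
  fixes sc :: "complex \<Rightarrow> 'z::ab_group_add \<Rightarrow> 'z"
    and Zac :: "nat \<Rightarrow> (nat \<Rightarrow> nat \<Rightarrow> 'z) set"
    and h :: "nat \<Rightarrow> (nat \<Rightarrow> nat \<Rightarrow> 'z) \<Rightarrow> real"
  assumes "normal_accretive_operator_space sc Zac h"
  shows "\<exists>(I :: (nat \<times> ('z \<Rightarrow> nat \<Rightarrow> nat \<Rightarrow> complex) \<times> nat) set)
            (\<phi> :: 'z \<Rightarrow> ((nat \<times> ('z \<Rightarrow> nat \<Rightarrow> nat \<Rightarrow> complex) \<times> nat) \<Rightarrow> complex)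
                     \<Rightarrow> ((nat \<times> ('z \<Rightarrow> nat \<Rightarrow> nat \<Rightarrow> complex) \<times> nat) \<Rightarrow> complex)).
           real_complete_order_embedding sc Zac I \<phi> \<and>
           (\<forall>n\<ge>1. \<forall>z\<in>mat n. h n z = opnorm (I \<times> {..<n}) (ReOp (I \<times> {..<n}) (amp I n \<phi> z)))"
proof -
  interpret normal_space sc Zac h by unfold_locales fact
  show ?thesis using dirsum_embedding h_eq_opnorm by blast
qed

end
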